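(* Let $0<\varepsilon<1$. The data $(\mathbb{C},L^2((-\varepsilon,\varepsilon),\mathbb{C}^2),T;\gamma^3)$ is an even spectral triple that represents the multiplicative unit in $KK_0(\mathbb{C},\mathbb{C})$.
   Context: $\gamma^1=\begin{pmatrix}0&1\\1&0\end{pmatrix}$, $\gamma^2=\begin{pmatrix}0&-i\\i&0\end{pmatrix}$, $\gamma^3=\begin{pmatrix}1&0\\0&-1\end{pmatrix}$. Put $\alpha=\frac{\pi}{2\varepsilon}$ and $f(s)=\alpha\tan(\alpha s)$. $T=\overline{T_0}$ is the closure of the symmetric operator $T_0$ with domain $C_c^\infty((-\varepsilon,\varepsilon),\mathbb{C}^2)\subset L^2((-\varepsilon,\varepsilon),\mathbb{C}^2)$, $$T_0\psi=i\gamma^1\partial_s\psi+\gamma^2f(s)\psi=\begin{pmatrix}0&i\partial_s-if(s)\\i\partial_s+if(s)&0\end{pmatrix}\psi.$$ $\gamma^3$ is the grading operator, and $\mathbb{C}$ acts by scalars. An even spectral triple for $\mathbb{C}$ is regarded as an even unbounded Kasparov $\mathbb{C}$-$\mathbb{C}$ cycle; $KK_0(\mathbb{C},\mathbb{C})\cong\mathbb{Z}$ as rings via the Fredholm index of the component of the operator mapping the even subspace to the odd subspace. *)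

theory Defs
  imports "HOL-Analysis.Analysis"
begin

section \<open>Unital C*-algebras\<close>

class cstar_algebra = real_normed_algebra_1 + banach +
  fixes scaleC :: "complex \<Rightarrow> 'a \<Rightarrow> 'a" and star :: "'a \<Rightarrow> 'a"
  assumes scaleC_add_right: "scaleC c (x + y) = scaleC c x + scaleC c y"
    and scaleC_add_left: "scaleC (c + d) x = scaleC c x + scaleC d x"
    and scaleC_scaleC: "scaleC c (scaleC d x) = scaleC (c * d) x"
    and scaleC_of_real: "scaleC (of_real r) x = scaleR r x"
    and norm_scaleC: "norm (scaleC c x) = cmod c * norm x"
    and mult_scaleC_left: "scaleC c x * y = scaleC c (x * y)"
    and mult_scaleC_right: "x * scaleC c y = scaleC c (x * y)"
    and star_star: "star (star x) = x"
    and star_add: "star (x + y) = star x + star y"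
    and star_mult: "star (x * y) = star y * star x"
    and star_scaleC: "star (scaleC c x) = scaleC (cnj c) (star x)"
    and cstar_identity: "norm (star x * x) = (norm x)\<^sup>2"

definition positive_elem :: "'a::cstar_algebra \<Rightarrow> bool" where
  "positive_elem a \<longleftrightarrow> (\<exists>b. a = star b * b)"

instantiation complex :: cstar_algebra
begin

definition scaleC_complex :: "complex \<Rightarrow> complex \<Rightarrow> complex" where
  "scaleC_complex c x = c * x"

definition star_complex :: "complex \<Rightarrow> complex" where
  "star_complex = cnj"

instance
  by standard
    (auto simp: scaleC_complex_def star_complex_def algebra_simps norm_mult scaleR_conv_of_real
      power2_eq_square)

end

text \<open>The C*-algebra \<open>C([0,1])\<close>. Functions on the unit interval are represented by their extension
  by \<open>0\<close> to the real line, so that equality is equality on \<open>[0,1]\<close>.\<close>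

typedef c01 = "{f :: real \<Rightarrow> complex. continuous_on {0..1} f \<and> (\<forall>t. t \<notin> {0..1} \<longrightarrow> f t = 0)}"
  morphisms c01_apply Abs_c01
  by (rule exI[of _ "\<lambda>_. 0"]) auto

setup_lifting type_definition_c01

lemma c01_continuous: "continuous_on {0..1} (c01_apply f)"
  using c01_apply[of f] by simp

lemma c01_outside: "t \<notin> {0..1} \<Longrightarrow> c01_apply f t = 0"
  using c01_apply[of f] by blast

lemma c01_eqI: "(\<And>t. t \<in> {0..1} \<Longrightarrow> c01_apply f t = c01_apply g t) \<Longrightarrow> f = g"
  by (metis c01_apply_inject c01_outside ext)

instantiation c01 :: ring_1
begin

lift_definition zero_c01 :: c01 is "\<lambda>_. 0" by simp

lift_definition one_c01 :: c01 is "\<lambda>t. if t \<in> {0..1} then 1 else 0"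
  by (auto intro: continuous_on_eq[of _ "\<lambda>_. 1"])

lift_definition plus_c01 :: "c01 \<Rightarrow> c01 \<Rightarrow> c01" is "\<lambda>f g t. f t + g t"
  by (auto intro: continuous_intros)

lift_definition minus_c01 :: "c01 \<Rightarrow> c01 \<Rightarrow> c01" is "\<lambda>f g t. f t - g t"
  by (auto intro: continuous_intros)

lift_definition uminus_c01 :: "c01 \<Rightarrow> c01" is "\<lambda>f t. - f t"
  by (auto intro: continuous_intros)

lift_definition times_c01 :: "c01 \<Rightarrow> c01 \<Rightarrow> c01" is "\<lambda>f g t. f t * g t"
  by (auto intro: continuous_intros)

instance
proof
  show "(0::c01) \<noteq> 1"
    by transfer (auto simp: fun_eq_iff intro!: exI[of _ 0])
qed (transfer; force simp: fun_eq_iff algebra_simps)+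

end

instantiation c01 :: real_vector
begin

lift_definition scaleR_c01 :: "real \<Rightarrow> c01 \<Rightarrow> c01" is "\<lambda>r f t. r *\<^sub>R f t"
  by (auto intro: continuous_intros)

instance
  by standard (transfer; simp add: fun_eq_iff algebra_simps)+

end

instantiation c01 :: real_normed_vector
begin

definition norm_c01 :: "c01 \<Rightarrow> real" where
  "norm_c01 f = (SUP t\<in>{0..1}. cmod (c01_apply f t))"

definition dist_c01 :: "c01 \<Rightarrow> c01 \<Rightarrow> real" where
  "dist_c01 f g = norm (f - g)"

definition sgn_c01 :: "c01 \<Rightarrow> c01" where
  "sgn_c01 f = f /\<^sub>R norm f"

definition uniformity_c01 :: "(c01 \<times> c01) filter" where
  "uniformity_c01 = (INF e\<in>{0 <..}. principal {(x, y). dist x y < e})"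

definition open_c01 :: "c01 set \<Rightarrow> bool" where
  "open_c01 U \<longleftrightarrow> (\<forall>x\<in>U. eventually (\<lambda>(x', y). x' = x \<longrightarrow> y \<in> U) uniformity)"

lemma norm_c01_bdd: "bdd_above ((\<lambda>t. cmod (c01_apply f t)) ` {0..1})"
proof -
  have "compact ((\<lambda>t. cmod (c01_apply f t)) ` {0..1})"
    by (intro compact_continuous_image continuous_intros c01_continuous) auto
  then show ?thesis
    by (meson bounded_imp_bdd_above compact_imp_bounded)
qed

lemma norm_c01_ge: "t \<in> {0..1} \<Longrightarrow> cmod (c01_apply f t) \<le> norm f"
  unfolding norm_c01_def by (rule cSUP_upper[OF _ norm_c01_bdd])

lemma norm_c01_le: "(\<And>t. t \<in> {0..1} \<Longrightarrow> cmod (c01_apply f t) \<le> c) \<Longrightarrow> norm f \<le> c"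
  unfolding norm_c01_def by (rule cSUP_least) auto

lemma norm_c01_attained: "\<exists>t\<in>{0..1}. norm f = cmod (c01_apply f t)"
proof -
  have "\<exists>t\<in>{0..1}. \<forall>s\<in>{0..1}. cmod (c01_apply f s) \<le> cmod (c01_apply f t)"
    by (intro continuous_attains_sup continuous_intros c01_continuous) auto
  then show ?thesis
    by (metis norm_c01_ge norm_c01_le order_antisym)
qed

instance
proof
  fix a :: real and x y :: c01
  show "(norm x = 0) = (x = 0)"
  proof
    assume *: "norm x = 0"
    show "x = 0"
      using norm_c01_ge[of _ x] * by (intro c01_eqI) (auto simp: zero_c01.rep_eq)
  next
    assume "x = 0"
    then show "norm x = 0"
      using norm_c01_attained[of x] by (auto simp: zero_c01.rep_eq)
  qed
  show "norm (x + y) \<le> norm x + norm y"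
    by (rule norm_c01_le)
      (metis add_mono norm_c01_ge norm_triangle_le plus_c01.rep_eq)
  show "norm (a *\<^sub>R x) = \<bar>a\<bar> * norm x"
  proof (rule order_antisym)
    show "norm (a *\<^sub>R x) \<le> \<bar>a\<bar> * norm x"
      by (rule norm_c01_le) (simp add: scaleR_c01.rep_eq mult_left_mono norm_c01_ge)
    show "\<bar>a\<bar> * norm x \<le> norm (a *\<^sub>R x)"
      by (metis norm_c01_attained norm_c01_ge norm_scaleR scaleR_c01.rep_eq)
  qed
qed (simp_all add: dist_c01_def sgn_c01_def uniformity_c01_def open_c01_def)

end

instance c01 :: real_normed_algebra_1
proof
  fix a :: real and x y :: c01
  show "a *\<^sub>R x * y = a *\<^sub>R (x * y)" "x * a *\<^sub>R y = a *\<^sub>R (x * y)"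
    by (transfer; simp add: fun_eq_iff)+
  show "norm (x * y) \<le> norm x * norm y"
    by (rule norm_c01_le)
      (metis mult_mono norm_c01_ge norm_ge_zero norm_mult times_c01.rep_eq)
  show "norm (1 :: c01) = 1"
    using norm_c01_attained[of 1] by (auto simp: one_c01.rep_eq)
qed

instance c01 :: banach
proof
  fix X :: "nat \<Rightarrow> c01"
  assume X: "Cauchy X"
  have "uniformly_Cauchy_on {0..1} (\<lambda>n. c01_apply (X n))"
    unfolding uniformly_Cauchy_on_def
  proof (intro allI impI)
    fix e :: real
    assume "e > 0"
    then obtain M where M: "\<And>m n. m \<ge> M \<Longrightarrow> n \<ge> M \<Longrightarrow> norm (X m - X n) < e"
      using X unfolding Cauchy_def dist_norm by blast
    have "dist (c01_apply (X m) t) (c01_apply (X n) t) < e"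
      if "t \<in> {0..1}" "m \<ge> M" "n \<ge> M" for t m n
      using M[OF that(2,3)] norm_c01_ge[OF that(1), of "X m - X n"]
      by (simp add: dist_norm minus_c01.rep_eq)
    then show "\<exists>M. \<forall>t\<in>{0..1}. \<forall>m\<ge>M. \<forall>n\<ge>M. dist (c01_apply (X m) t) (c01_apply (X n) t) < e"
      by blast
  qed
  then obtain l where l: "uniform_limit {0..1} (\<lambda>n. c01_apply (X n)) l sequentially"
    using Cauchy_uniformly_convergent uniformly_convergent_on_def by blast
  then have cl: "continuous_on {0..1} l"
    by (rule uniform_limit_theorem[rotated]) (simp_all add: c01_continuous)
  define L where "L = Abs_c01 (\<lambda>t. if t \<in> {0..1} then l t else 0)"
  have L: "c01_apply L t = l t" if "t \<in> {0..1}" for t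
  proof -
    have "continuous_on {0..1} (\<lambda>t. if t \<in> {0..1} then l t else 0)"
      by (rule continuous_on_eq[OF cl]) auto
    then show ?thesis
      unfolding L_def using that by (subst Abs_c01_inverse) auto
  qed
  have "X \<longlonglongrightarrow> L"
  proof (rule LIMSEQ_I)
    fix r :: real
    assume r: "r > 0"
    then have "\<forall>\<^sub>F n in sequentially. \<forall>t\<in>{0..1}. dist (c01_apply (X n) t) (l t) < r / 2"
      using l unfolding uniform_limit_iff by (meson half_gt_zero)
    then obtain N where N: "\<And>n t. n \<ge> N \<Longrightarrow> t \<in> {0..1} \<Longrightarrow> dist (c01_apply (X n) t) (l t) < r / 2"
      unfolding eventually_sequentially by blast
    have "norm (X n - L) < r" if "n \<ge> N" for n
    proof -
      have "norm (X n - L) \<le> r / 2"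
        by (rule norm_c01_le)
          (use N[OF that] in \<open>auto simp: minus_c01.rep_eq L dist_norm less_imp_le\<close>)
      then show ?thesis
        using r by simp
    qed
    then show "\<exists>no. \<forall>n\<ge>no. norm (X n - L) < r"
      by blast
  qed
  then show "convergent X"
    by (auto simp: convergent_def)
qed

instantiation c01 :: cstar_algebra
begin

lift_definition scaleC_c01 :: "complex \<Rightarrow> c01 \<Rightarrow> c01" is "\<lambda>c f t. c * f t"
  by (auto intro: continuous_intros)

lift_definition star_c01 :: "c01 \<Rightarrow> c01" is "\<lambda>f t. cnj (f t)"
  by (auto intro: continuous_intros)

instance
proof
  fix c d :: complex and r :: real and x y :: c01
  show "scaleC c (x + y) = scaleC c x + scaleC c y" "scaleC (c + d) x = scaleC c x + scaleC d x"
    "scaleC c (scaleC d x) = scaleC (c * d) x" "scaleC (of_real r) x = scaleR r x"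
    "scaleC c x * y = scaleC c (x * y)" "x * scaleC c y = scaleC c (x * y)"
    "star (star x) = x" "star (x + y) = star x + star y" "star (x * y) = star y * star x"
    "star (scaleC c x) = scaleC (cnj c) (star x)"
    by (transfer; simp add: fun_eq_iff algebra_simps scaleR_conv_of_real)+
  show "norm (scaleC c x) = cmod c * norm x"
  proof (rule order_antisym)
    show "norm (scaleC c x) \<le> cmod c * norm x"
      by (rule norm_c01_le) (simp add: scaleC_c01.rep_eq norm_mult mult_left_mono norm_c01_ge)
    show "cmod c * norm x \<le> norm (scaleC c x)"
      by (metis norm_c01_attained norm_c01_ge norm_mult scaleC_c01.rep_eq)
  qed
  have *: "cmod (c01_apply (star x * x) t) = (cmod (c01_apply x t))\<^sup>2" for t
    by (simp add: times_c01.rep_eq star_c01.rep_eq norm_mult power2_eq_square)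
  show "norm (star x * x) = (norm x)\<^sup>2"
  proof (rule order_antisym)
    show "norm (star x * x) \<le> (norm x)\<^sup>2"
      by (rule norm_c01_le) (simp add: * norm_c01_ge power_mono)
    show "(norm x)\<^sup>2 \<le> norm (star x * x)"
      by (metis * norm_c01_attained norm_c01_ge)
  qed
qed

end


section \<open>Hilbert C*-modules\<close>

text \<open>Right Hilbert modules over \<open>'b\<close>, with inner products conjugate linear in the first variable.
  Complex scalars act through \<open>scaleC c 1\<close>. For \<open>'b = complex\<close> these are exactly the complex Hilbert
  spaces. An operator is a function on the type \<open>'v\<close>, of which only the restriction to the carrier
  is relevant.\<close>

record ('v, 'b) hmod =
  hcarrier :: "'v set"
  hadd :: "'v \<Rightarrow> 'v \<Rightarrow> 'v"
  hzero :: "'v"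
  hact :: "'v \<Rightarrow> 'b \<Rightarrow> 'v"
  hip :: "'v \<Rightarrow> 'v \<Rightarrow> 'b"

definition hsub :: "('v, 'b::cstar_algebra) hmod \<Rightarrow> 'v \<Rightarrow> 'v \<Rightarrow> 'v" where
  "hsub E x y = hadd E x (hact E y (- 1))"

definition hscale :: "('v, 'b::cstar_algebra) hmod \<Rightarrow> complex \<Rightarrow> 'v \<Rightarrow> 'v" where
  "hscale E c x = hact E x (scaleC c 1)"

definition hnorm :: "('v, 'b::cstar_algebra) hmod \<Rightarrow> 'v \<Rightarrow> real" where
  "hnorm E x = sqrt (norm (hip E x x))"

locale hilbert_module =
  fixes E :: "('v, 'b::cstar_algebra) hmod"
  assumes zero_closed: "hzero E \<in> hcarrier E"
    and add_closed: "\<lbrakk>x \<in> hcarrier E; y \<in> hcarrier E\<rbrakk> \<Longrightarrow> hadd E x y \<in> hcarrier E"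
    and add_assoc: "\<lbrakk>x \<in> hcarrier E; y \<in> hcarrier E; z \<in> hcarrier E\<rbrakk> \<Longrightarrow>
      hadd E (hadd E x y) z = hadd E x (hadd E y z)"
    and add_commute: "\<lbrakk>x \<in> hcarrier E; y \<in> hcarrier E\<rbrakk> \<Longrightarrow> hadd E x y = hadd E y x"
    and add_zero: "x \<in> hcarrier E \<Longrightarrow> hadd E x (hzero E) = x"
    and add_inverse: "x \<in> hcarrier E \<Longrightarrow> \<exists>y\<in>hcarrier E. hadd E x y = hzero E"
    and act_closed: "x \<in> hcarrier E \<Longrightarrow> hact E x b \<in> hcarrier E"
    and act_add_left: "\<lbrakk>x \<in> hcarrier E; y \<in> hcarrier E\<rbrakk> \<Longrightarrow>
      hact E (hadd E x y) b = hadd E (hact E x b) (hact E y b)"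
    and act_add_right: "x \<in> hcarrier E \<Longrightarrow> hact E x (b + c) = hadd E (hact E x b) (hact E x c)"
    and act_mult: "x \<in> hcarrier E \<Longrightarrow> hact E x (b * c) = hact E (hact E x b) c"
    and act_one: "x \<in> hcarrier E \<Longrightarrow> hact E x 1 = x"
    and ip_add_right: "\<lbrakk>x \<in> hcarrier E; y \<in> hcarrier E; z \<in> hcarrier E\<rbrakk> \<Longrightarrow>
      hip E x (hadd E y z) = hip E x y + hip E x z"
    and ip_act_right: "\<lbrakk>x \<in> hcarrier E; y \<in> hcarrier E\<rbrakk> \<Longrightarrow> hip E x (hact E y b) = hip E x y * b"
    and ip_star: "\<lbrakk>x \<in> hcarrier E; y \<in> hcarrier E\<rbrakk> \<Longrightarrow> star (hip E x y) = hip E y x"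
    and ip_positive: "x \<in> hcarrier E \<Longrightarrow> positive_elem (hip E x x)"
    and ip_definite: "\<lbrakk>x \<in> hcarrier E; hip E x x = 0\<rbrakk> \<Longrightarrow> x = hzero E"
    and complete: "\<lbrakk>\<And>n. X n \<in> hcarrier E;
        \<And>e. e > 0 \<Longrightarrow> \<exists>N. \<forall>m\<ge>N. \<forall>n\<ge>N. hnorm E (hsub E (X m) (X n)) < e\<rbrakk> \<Longrightarrow>
      \<exists>x\<in>hcarrier E. (\<lambda>n. hnorm E (hsub E (X n) x)) \<longlonglongrightarrow> 0"

definition lincomb :: "('v, 'b::cstar_algebra) hmod \<Rightarrow> ('v \<times> 'b) list \<Rightarrow> 'v" where
  "lincomb E ps = foldr (\<lambda>(x, b) w. hadd E (hact E x b) w) ps (hzero E)"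

definition countably_generated :: "('v, 'b::cstar_algebra) hmod \<Rightarrow> bool" where
  "countably_generated E \<longleftrightarrow> (\<exists>S \<subseteq> hcarrier E. countable S \<and>
     (\<forall>x\<in>hcarrier E. \<forall>e>0. \<exists>ps. fst ` set ps \<subseteq> S \<and> hnorm E (hsub E x (lincomb E ps)) < e))"

definition adjoint_pair :: "('v, 'b::cstar_algebra) hmod \<Rightarrow> ('v \<Rightarrow> 'v) \<Rightarrow> ('v \<Rightarrow> 'v) \<Rightarrow> bool" where
  "adjoint_pair E F G \<longleftrightarrow> F \<in> hcarrier E \<rightarrow> hcarrier E \<and> G \<in> hcarrier E \<rightarrow> hcarrier E \<and>
     (\<forall>x\<in>hcarrier E. \<forall>y\<in>hcarrier E. hip E (F x) y = hip E x (G y))"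

text \<open>Adjointable operators are automatically linear over \<open>'b\<close> and bounded.\<close>

definition adjointable :: "('v, 'b::cstar_algebra) hmod \<Rightarrow> ('v \<Rightarrow> 'v) \<Rightarrow> bool" where
  "adjointable E F \<longleftrightarrow> (\<exists>G. adjoint_pair E F G)"

text \<open>For a list of pairs \<open>(x, y)\<close>, this is the sum of the operators \<open>z \<mapsto> x \<langle>y, z\<rangle>\<close>.\<close>

definition finite_rank :: "('v, 'b::cstar_algebra) hmod \<Rightarrow> ('v \<times> 'v) list \<Rightarrow> 'v \<Rightarrow> 'v" where
  "finite_rank E ps z = lincomb E (map (\<lambda>(x, y). (x, hip E y z)) ps)"

text \<open>The closure of the finite rank operators in the operator norm.\<close>

definition compact_operator :: "('v, 'b::cstar_algebra) hmod \<Rightarrow> ('v \<Rightarrow> 'v) \<Rightarrow> bool" where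
  "compact_operator E K \<longleftrightarrow> adjointable E K \<and>
     (\<forall>e>0. \<exists>ps. set ps \<subseteq> hcarrier E \<times> hcarrier E \<and>
        (\<forall>z\<in>hcarrier E. hnorm E (hsub E (K z) (finite_rank E ps z)) \<le> e * hnorm E z))"

definition grading_operator :: "('v, 'b::cstar_algebra) hmod \<Rightarrow> ('v \<Rightarrow> 'v) \<Rightarrow> bool" where
  "grading_operator E \<gamma> \<longleftrightarrow> adjoint_pair E \<gamma> \<gamma> \<and> (\<forall>x\<in>hcarrier E. \<gamma> (\<gamma> x) = x)"

text \<open>Even *-homomorphisms from \<open>\<complex>\<close> to the adjointable operators, not necessarily unital.\<close>

definition even_representation ::
    "('v, 'b::cstar_algebra) hmod \<Rightarrow> (complex \<Rightarrow> 'v \<Rightarrow> 'v) \<Rightarrow> ('v \<Rightarrow> 'v) \<Rightarrow> bool" where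
  "even_representation E \<phi> \<gamma> \<longleftrightarrow>
     (\<forall>a. adjoint_pair E (\<phi> a) (\<phi> (cnj a))) \<and>
     (\<forall>a b. \<forall>x\<in>hcarrier E. \<phi> (a + b) x = hadd E (\<phi> a x) (\<phi> b x)) \<and>
     (\<forall>a b. \<forall>x\<in>hcarrier E. \<phi> (a * b) x = \<phi> a (\<phi> b x)) \<and>
     (\<forall>c a. \<forall>x\<in>hcarrier E. \<phi> (c * a) x = hscale E c (\<phi> a x)) \<and>
     (\<forall>a. \<forall>x\<in>hcarrier E. \<phi> a (\<gamma> x) = \<gamma> (\<phi> a x))"


section \<open>Even Kasparov cycles and homotopy\<close>

record ('v, 'b) cycle =
  cmod_of :: "('v, 'b) hmod"
  crep :: "complex \<Rightarrow> 'v \<Rightarrow> 'v"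
  cop :: "'v \<Rightarrow> 'v"
  cgrad :: "'v \<Rightarrow> 'v"

definition kasparov_cycle :: "('v, 'b::cstar_algebra) cycle \<Rightarrow> bool" where
  "kasparov_cycle \<E> \<longleftrightarrow> (let E = cmod_of \<E>; \<phi> = crep \<E>; F = cop \<E>; \<gamma> = cgrad \<E> in
     hilbert_module E \<and> countably_generated E \<and>
     grading_operator E \<gamma> \<and> even_representation E \<phi> \<gamma> \<and>
     (\<forall>x\<in>hcarrier E. F (\<gamma> x) = hscale E (- 1) (\<gamma> (F x))) \<and>
     (\<forall>a. compact_operator E (\<lambda>x. hsub E (F (\<phi> a x)) (\<phi> a (F x)))) \<and>
     (\<forall>a. compact_operator E (\<lambda>x. hsub E (F (F (\<phi> a x))) (\<phi> a x))) \<and>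
     (\<exists>F'. adjoint_pair E F F' \<and>
        (\<forall>a. compact_operator E (\<lambda>x. hsub E (F (\<phi> a x)) (F' (\<phi> a x))))))"

text \<open>The push-forward of a \<open>\<complex>\<close>-\<open>C([0,1])\<close> cycle along the evaluation \<open>C([0,1]) \<rightarrow> \<complex>\<close> at \<open>t\<close> is
  determined up to unitary equivalence by the property below: \<open>u\<close> is the canonical map from the module
  \<open>E\<close> to the completion of its quotient by the vectors with \<open>\<langle>e, e\<rangle>(t) = 0\<close>, that is, to the interior
  tensor product of \<open>E\<close> and \<open>\<complex>\<close>.\<close>

definition evaluates_to ::
    "real \<Rightarrow> ('w, c01) cycle \<Rightarrow> ('v, complex) cycle \<Rightarrow> bool" where
  "evaluates_to t \<E> \<H> \<longleftrightarrow> (let E = cmod_of \<E>; H = cmod_of \<H> in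
     \<exists>u. u \<in> hcarrier E \<rightarrow> hcarrier H \<and>
       (\<forall>x\<in>hcarrier E. \<forall>y\<in>hcarrier E. u (hadd E x y) = hadd H (u x) (u y)) \<and>
       (\<forall>x\<in>hcarrier E. \<forall>b. u (hact E x b) = hact H (u x) (c01_apply b t)) \<and>
       (\<forall>x\<in>hcarrier E. \<forall>y\<in>hcarrier E. hip H (u x) (u y) = c01_apply (hip E x y) t) \<and>
       (\<forall>h\<in>hcarrier H. \<forall>e>0. \<exists>x\<in>hcarrier E. hnorm H (hsub H h (u x)) < e) \<and>
       (\<forall>a. \<forall>x\<in>hcarrier E. u (crep \<E> a x) = crep \<H> a (u x)) \<and>
       (\<forall>x\<in>hcarrier E. u (cop \<E> x) = cop \<H> (u x)) \<and>
       (\<forall>x\<in>hcarrier E. u (cgrad \<E> x) = cgrad \<H> (u x)))"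

text \<open>Equality in \<open>KK\<^sub>0(\<complex>, \<complex>)\<close>. By Kasparov's stabilization theorem every countably generated Hilbert
  module over \<open>C([0,1])\<close> is isomorphic to one with carrier in \<open>nat \<Rightarrow> c01\<close>, so fixing this type for
  the module of the homotopy is no restriction.\<close>

definition kk_equal :: "('v, complex) cycle \<Rightarrow> ('w, complex) cycle \<Rightarrow> bool" where
  "kk_equal x y \<longleftrightarrow> kasparov_cycle x \<and> kasparov_cycle y \<and>
     (\<exists>\<E> :: (nat \<Rightarrow> c01, c01) cycle.
        kasparov_cycle \<E> \<and> evaluates_to 0 \<E> x \<and> evaluates_to 1 \<E> y)"

text \<open>The cycle \<open>(\<complex>, \<complex>, 0)\<close>, with \<open>\<complex>\<close> purely even, represents the unit for the Kasparov product.\<close>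

definition kk_unit :: "(complex, complex) cycle" where
  "kk_unit = \<lparr>cmod_of = \<lparr>hcarrier = UNIV, hadd = (+), hzero = 0, hact = (*), hip = (\<lambda>x y. cnj x * y)\<rparr>,
     crep = (*), cop = (\<lambda>_. 0), cgrad = (\<lambda>x. x)\<rparr>"


section \<open>Unbounded operators and even spectral triples\<close>

text \<open>Unbounded operators on a Hilbert space are represented by their graphs.\<close>

definition linear_graph :: "('v, complex) hmod \<Rightarrow> ('v \<times> 'v) set \<Rightarrow> bool" where
  "linear_graph H T \<longleftrightarrow> T \<subseteq> hcarrier H \<times> hcarrier H \<and> single_valued T \<and>
     (hzero H, hzero H) \<in> T \<and>
     (\<forall>(x, y)\<in>T. \<forall>(x', y')\<in>T. (hadd H x x', hadd H y y') \<in> T) \<and>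
     (\<forall>c. \<forall>(x, y)\<in>T. (hscale H c x, hscale H c y) \<in> T)"

definition graph_closure :: "('v, complex) hmod \<Rightarrow> ('v \<times> 'v) set \<Rightarrow> ('v \<times> 'v) set" where
  "graph_closure H T = {(x, y) \<in> hcarrier H \<times> hcarrier H. \<forall>e>0. \<exists>(x', y')\<in>T.
     hnorm H (hsub H x x') < e \<and> hnorm H (hsub H y y') < e}"

definition densely_defined :: "('v, complex) hmod \<Rightarrow> ('v \<times> 'v) set \<Rightarrow> bool" where
  "densely_defined H T \<longleftrightarrow>
     (\<forall>h\<in>hcarrier H. \<forall>e>0. \<exists>x\<in>Domain T. hnorm H (hsub H h x) < e)"

definition adjoint_graph :: "('v, complex) hmod \<Rightarrow> ('v \<times> 'v) set \<Rightarrow> ('v \<times> 'v) set" where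
  "adjoint_graph H T = {(y, z) \<in> hcarrier H \<times> hcarrier H. \<forall>(x, w)\<in>T. hip H y w = hip H z x}"

definition self_adjoint :: "('v, complex) hmod \<Rightarrow> ('v \<times> 'v) set \<Rightarrow> bool" where
  "self_adjoint H T \<longleftrightarrow> linear_graph H T \<and> densely_defined H T \<and> adjoint_graph H T = T"

text \<open>\<open>R\<close> is the everywhere defined inverse of \<open>1 + T\<^sup>2\<close>, where \<open>T\<^sup>2\<close> has the graph \<open>T O T\<close>.\<close>

definition inverse_one_plus_square ::
    "('v, complex) hmod \<Rightarrow> ('v \<times> 'v) set \<Rightarrow> ('v \<Rightarrow> 'v) \<Rightarrow> bool" where
  "inverse_one_plus_square H T R \<longleftrightarrow>
     {(hadd H x z, x) |x z. (x, z) \<in> T O T} = {(y, R y) |y. y \<in> hcarrier H}"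

text \<open>\<open>F = T (1 + T\<^sup>2)\<^bsup>-1/2\<^esup>\<close>: the operator \<open>B\<close> is the positive square root of \<open>(1 + T\<^sup>2)\<^bsup>-1\<^esup>\<close>.\<close>

definition bounded_transform ::
    "('v, complex) hmod \<Rightarrow> ('v \<times> 'v) set \<Rightarrow> ('v \<Rightarrow> 'v) \<Rightarrow> bool" where
  "bounded_transform H T F \<longleftrightarrow> (\<exists>B. adjoint_pair H B B \<and>
     (\<forall>x\<in>hcarrier H. positive_elem (hip H x (B x))) \<and>
     inverse_one_plus_square H T (\<lambda>x. B (B x)) \<and>
     (\<forall>x\<in>hcarrier H. (B x, F x) \<in> T))"

text \<open>An even spectral triple \<open>(\<complex>, H, T; \<gamma>)\<close> with \<open>\<complex>\<close> represented on \<open>H\<close> by \<open>\<phi>\<close>, that is, an even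
  unbounded Kasparov \<open>\<complex>\<close>-\<open>\<complex>\<close> cycle.\<close>

definition even_spectral_triple :: "('v, complex) hmod \<Rightarrow> (complex \<Rightarrow> 'v \<Rightarrow> 'v) \<Rightarrow>
    ('v \<times> 'v) set \<Rightarrow> ('v \<Rightarrow> 'v) \<Rightarrow> bool" where
  "even_spectral_triple H \<phi> T \<gamma> \<longleftrightarrow>
     hilbert_module H \<and> countably_generated H \<and>
     grading_operator H \<gamma> \<and> even_representation H \<phi> \<gamma> \<and>
     self_adjoint H T \<and>
     (\<forall>(x, y)\<in>T. (\<gamma> x, hscale H (- 1) (\<gamma> y)) \<in> T) \<and>
     (\<forall>a. \<exists>c. \<forall>(x, y)\<in>T. \<exists>z. (\<phi> a x, z) \<in> T \<and> hnorm H (hsub H z (\<phi> a y)) \<le> c * hnorm H x) \<and>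
     (\<exists>R. inverse_one_plus_square H T R \<and> (\<forall>a. compact_operator H (\<lambda>x. \<phi> a (R x))))"

text \<open>The class of an unbounded cycle in \<open>KK\<^sub>0(\<complex>, \<complex>)\<close> is the class of its bounded transform.\<close>

definition represents_kk_unit :: "('v, complex) hmod \<Rightarrow> (complex \<Rightarrow> 'v \<Rightarrow> 'v) \<Rightarrow>
    ('v \<times> 'v) set \<Rightarrow> ('v \<Rightarrow> 'v) \<Rightarrow> bool" where
  "represents_kk_unit H \<phi> T \<gamma> \<longleftrightarrow> (\<exists>F. bounded_transform H T F \<and>
     kk_equal \<lparr>cmod_of = H, crep = \<phi>, cop = F, cgrad = \<gamma>\<rparr> kk_unit)"


section \<open>The space \<open>L\<^sup>2((-\<epsilon>, \<epsilon>), \<complex>\<^sup>2)\<close> and the operator \<open>T\<close>\<close>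

abbreviation interval_measure :: "real \<Rightarrow> real measure" where
  "interval_measure \<epsilon> \<equiv> lebesgue_on {-\<epsilon><..<\<epsilon>}"

definition square_integrable :: "real \<Rightarrow> (real \<Rightarrow> complex ^ 2) set" where
  "square_integrable \<epsilon> = {\<psi>. \<psi> \<in> borel_measurable (interval_measure \<epsilon>) \<and>
     integrable (interval_measure \<epsilon>) (\<lambda>s. (norm (\<psi> s))\<^sup>2)}"

definition ae_equal :: "real \<Rightarrow> ((real \<Rightarrow> complex ^ 2) \<times> (real \<Rightarrow> complex ^ 2)) set" where
  "ae_equal \<epsilon> = {(\<psi>, \<xi>) \<in> square_integrable \<epsilon> \<times> square_integrable \<epsilon>.
     AE s in interval_measure \<epsilon>. \<psi> s = \<xi> s}"

definition ae_class :: "real \<Rightarrow> (real \<Rightarrow> complex ^ 2) \<Rightarrow> (real \<Rightarrow> complex ^ 2) set" where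
  "ae_class \<epsilon> \<psi> = ae_equal \<epsilon> `` {\<psi>}"

definition ae_rep :: "(real \<Rightarrow> complex ^ 2) set \<Rightarrow> real \<Rightarrow> complex ^ 2" where
  "ae_rep X = (SOME \<psi>. \<psi> \<in> X)"

definition L2_space :: "real \<Rightarrow> ((real \<Rightarrow> complex ^ 2) set, complex) hmod" where
  "L2_space \<epsilon> = \<lparr>hcarrier = square_integrable \<epsilon> // ae_equal \<epsilon>,
     hadd = (\<lambda>X Y. ae_class \<epsilon> (\<lambda>s. ae_rep X s + ae_rep Y s)),
     hzero = ae_class \<epsilon> (\<lambda>_. 0),
     hact = (\<lambda>X c. ae_class \<epsilon> (\<lambda>s. c *s ae_rep X s)),
     hip = (\<lambda>X Y. \<integral>s. (\<Sum>j\<in>UNIV. cnj (ae_rep X s $ j) * ae_rep Y s $ j) \<partial>interval_measure \<epsilon>)\<rparr>"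

definition gamma1 :: "complex ^ 2 ^ 2" where
  "gamma1 = vector [vector [0, 1], vector [1, 0]]"

definition gamma2 :: "complex ^ 2 ^ 2" where
  "gamma2 = vector [vector [0, - \<i>], vector [\<i>, 0]]"

definition gamma3 :: "complex ^ 2 ^ 2" where
  "gamma3 = vector [vector [1, 0], vector [0, - 1]]"

definition alpha :: "real \<Rightarrow> real" where
  "alpha \<epsilon> = pi / (2 * \<epsilon>)"

definition potential :: "real \<Rightarrow> real \<Rightarrow> real" where
  "potential \<epsilon> s = alpha \<epsilon> * tan (alpha \<epsilon> * s)"

definition smooth :: "(real \<Rightarrow> complex ^ 2) \<Rightarrow> bool" where
  "smooth \<psi> \<longleftrightarrow>
     (\<forall>n. ((\<lambda>\<xi> s. vector_derivative \<xi> (at s)) ^^ n) \<psi> differentiable_on UNIV)"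

text \<open>\<open>C\<^sub>c\<^sup>\<infinity>((-\<epsilon>, \<epsilon>), \<complex>\<^sup>2)\<close>, with functions extended by \<open>0\<close> to the real line.\<close>

definition test_functions :: "real \<Rightarrow> (real \<Rightarrow> complex ^ 2) set" where
  "test_functions \<epsilon> = {\<psi>. smooth \<psi> \<and> closure {s. \<psi> s \<noteq> 0} \<subseteq> {-\<epsilon><..<\<epsilon>}}"

definition T0_fun :: "real \<Rightarrow> (real \<Rightarrow> complex ^ 2) \<Rightarrow> real \<Rightarrow> complex ^ 2" where
  "T0_fun \<epsilon> \<psi> s = \<i> *s (gamma1 *v vector_derivative \<psi> (at s)) +
     of_real (potential \<epsilon> s) *s (gamma2 *v \<psi> s)"

definition T0_graph :: "real \<Rightarrow> ((real \<Rightarrow> complex ^ 2) set \<times> (real \<Rightarrow> complex ^ 2) set) set" where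
  "T0_graph \<epsilon> = {(ae_class \<epsilon> \<psi>, ae_class \<epsilon> (T0_fun \<epsilon> \<psi>)) |\<psi>. \<psi> \<in> test_functions \<epsilon>}"

definition T_graph :: "real \<Rightarrow> ((real \<Rightarrow> complex ^ 2) set \<times> (real \<Rightarrow> complex ^ 2) set) set" where
  "T_graph \<epsilon> = graph_closure (L2_space \<epsilon>) (T0_graph \<epsilon>)"

definition gamma3_operator ::
    "real \<Rightarrow> (real \<Rightarrow> complex ^ 2) set \<Rightarrow> (real \<Rightarrow> complex ^ 2) set" where
  "gamma3_operator \<epsilon> X = ae_class \<epsilon> (\<lambda>s. gamma3 *v ae_rep X s)"

end

theory Submission
  imports Defs "HOL-Computational_Algebra.Polynomial"
begin

text \<open>
  Put \<open>\<theta> = \<alpha> (s + \<epsilon>) \<in> (0, \<pi>)\<close>, so that \<open>f = - \<alpha> cot \<theta>\<close>. The functions \<open>sin ((k + 1) \<theta>)\<close> in the even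
  component and \<open>C\<^sub>k = sin \<theta> d/d\<theta> (sin ((k + 1) \<theta>) / sin \<theta>)\<close>, \<open>k \<ge> 1\<close>, in the odd component are an
  orthogonal basis, and \<open>T\<close> interchanges them up to scalars, with singular values
  \<open>\<alpha> \<surd>((k + 1)\<^sup>2 - 1)\<close>. They are \<open>sin \<theta>\<close> and \<open>sin\<^sup>2 \<theta>\<close> times polynomials in \<open>cos \<theta>\<close>, hence complete
  by the Weierstrass theorem. They vanish at the end points at least linearly, which is just enough
  for cutoffs to show that they belong to the domain of the closure. So \<open>T\<close> is diagonal with compact
  resolvent, and its kernel is spanned by the even vector \<open>sin \<theta>\<close>.

  The homotopy from the bounded transform to the unit uses \<open>C([0,1])\<close> for the kernel and
  \<open>C\<^sub>0([0,1))\<close> for each remaining basis vector, so that only the kernel survives at \<open>t = 1\<close>;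
  meanwhile the singular values of the bounded transform are moved to \<open>1\<close>, which makes \<open>F\<^sup>2 - 1\<close>
  vanish there and keeps it compact.
\<close>

section \<open>Pointwise estimates in \<open>C([0,1])\<close> and the module of the homotopy\<close>

text \<open>The potential f satisfies f' = f^2 + \<alpha>^2, so on the even part the square of
  \<open>T\<close> is -d^2/ds^2 + f^2 - f' = -d^2/ds^2 - \<alpha>^2, a shifted Dirichlet Laplacian.
  This is where the sines and the singular values come from; the odd vectors are the images of the
  sines under d/ds + f. An odd zero mode would be a multiple of 1 / sin \<theta>, which is not
  square integrable; hence the index 1.

  No deficiency spaces are computed. Integration by parts on test functions gives a relation between
  the coefficients of \<psi> and of its image, and this relation survives the closure. Conversely,
  finite sums of basis vectors lie in the domain of the closure and form a core for the operator
  defined by that relation. So the closure equals a maximal diagonal operator, whose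
  self-adjointness is elementary.

  The bounded transform and the unit both have to be cycles. As they are the two fibres of one
  homotopy, all cycle conditions are verified once, on the module over \<open>C([0,1])\<close>, and
  pushed forward along the evaluations; boundedness and compactness on the Hilbert space are
  obtained in the same way.\<close>

lemmas c01_rep_eq = zero_c01.rep_eq one_c01.rep_eq plus_c01.rep_eq minus_c01.rep_eq
  uminus_c01.rep_eq times_c01.rep_eq scaleR_c01.rep_eq scaleC_c01.rep_eq star_c01.rep_eq

lemma c01_apply_scaleC_1: "t \<in> {0..1} \<Longrightarrow> c01_apply (scaleC c 1) t = c"
  by (simp add: c01_rep_eq)

lemma bounded_linear_c01_apply: "bounded_linear (\<lambda>f. c01_apply f t)"
proof (rule bounded_linear_intro[where K = 1])
  show "norm (c01_apply f t) \<le> norm f * 1" for f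
    using norm_c01_ge[of t f] c01_outside[of t f] by (cases "t \<in> {0..1}") auto
qed (simp_all add: c01_rep_eq)

lemma c01_apply_sum: "c01_apply (sum f A) t = (\<Sum>i\<in>A. c01_apply (f i) t)"
  by (rule linear_sum[OF bounded_linear.linear[OF bounded_linear_c01_apply]])

lemma c01_apply_sums: "f sums s \<Longrightarrow> (\<lambda>n. c01_apply (f n) t) sums c01_apply s t"
  by (rule bounded_linear.sums[OF bounded_linear_c01_apply])

lemma c01_tendsto_apply: "f \<longlonglongrightarrow> s \<Longrightarrow> (\<lambda>n. c01_apply (f n) t) \<longlonglongrightarrow> c01_apply s t"
  by (rule bounded_linear.tendsto[OF bounded_linear_c01_apply])

lemma c01_summable_dominated:
  fixes f g :: "nat \<Rightarrow> c01"
  assumes g: "summable g"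
    and le: "\<And>n t. t \<in> {0..1} \<Longrightarrow> cmod (c01_apply (f n) t) \<le> Re (c01_apply (g n) t)"
  shows "summable f"
  unfolding summable_Cauchy
proof (intro allI impI)
  fix e :: real
  assume "e > 0"
  then obtain N where N: "\<And>m n. m \<ge> N \<Longrightarrow> norm (sum g {m..<n}) < e"
    using g unfolding summable_Cauchy by blast
  have "norm (sum f {m..<n}) \<le> norm (sum g {m..<n})" for m n
  proof (rule norm_c01_le)
    fix t :: real
    assume t: "t \<in> {0..1}"
    have "cmod (c01_apply (sum f {m..<n}) t) \<le> (\<Sum>i\<in>{m..<n}. Re (c01_apply (g i) t))"
      unfolding c01_apply_sum by (rule order_trans[OF norm_sum]) (intro sum_mono le t)
    also have "\<dots> = Re (c01_apply (sum g {m..<n}) t)"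
      by (simp add: c01_apply_sum)
    also have "\<dots> \<le> norm (sum g {m..<n})"
      using complex_Re_le_cmod norm_c01_ge[OF t] order_trans by blast
    finally show "cmod (c01_apply (sum f {m..<n}) t) \<le> norm (sum g {m..<n})" .
  qed
  then show "\<exists>N. \<forall>m\<ge>N. \<forall>n. norm (sum f {m..<n}) < e"
    using N by (meson le_less_trans)
qed

lemma c01_positive_elemI:
  assumes "\<And>t. t \<in> {0..1} \<Longrightarrow> c01_apply h t = of_real (r t)" "\<And>t. t \<in> {0..1} \<Longrightarrow> r t \<ge> 0"
  shows "positive_elem h"
proof -
  \<comment> \<open>The function \<open>r\<close> is not assumed continuous, so the square root is
    taken of the real part of \<open>h\<close> itself.\<close>
  define b where "b = Abs_c01 (\<lambda>t. of_real (sqrt (Re (c01_apply h t))))"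
  have b: "c01_apply b = (\<lambda>t. of_real (sqrt (Re (c01_apply h t))))"
    unfolding b_def
    by (rule Abs_c01_inverse) (auto intro!: continuous_intros c01_continuous simp: c01_outside)
  have "h = star b * b"
    by (rule c01_eqI)
      (auto simp: c01_rep_eq b assms simp flip: of_real_mult)
  then show ?thesis
    unfolding positive_elem_def by blast
qed

text \<open>A strictly positive element of the ideal of functions vanishing at 1: its multiples are
  dense there, so it can serve as the single generator of a coordinate.\<close>

definition cone_fun :: c01
  where "cone_fun = Abs_c01 (\<lambda>t. if t \<in> {0..1} then of_real (1 - t) else 0)"

lemma cone_apply: "c01_apply cone_fun t = (if t \<in> {0..1} then of_real (1 - t) else 0)"
proof -
  have "continuous_on {0..1} (\<lambda>t::real. if t \<in> {0..1} then of_real (1 - t) else 0 :: complex)"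
    by (rule continuous_on_eq[of _ "\<lambda>t. of_real (1 - t)"]) (auto intro!: continuous_intros)
  then show ?thesis
    unfolding cone_fun_def by (subst Abs_c01_inverse) auto
qed

text \<open>Division by 1 - t is regularised to f / (1 - t + \<delta>). The error f \<delta> / (1 -
  t + \<delta>) is small near 1 because f is, and away from 1 because \<delta> is.\<close>

lemma cone_multiple_dense:
  assumes f1: "c01_apply f 1 = 0" and d: "d > 0"
  obtains b where "norm (f - cone_fun * b) \<le> d"
proof -
  have "\<exists>\<rho>>0. \<forall>t\<in>{0..1}. dist t 1 < \<rho> \<longrightarrow> dist (c01_apply f t) (c01_apply f 1) < d"
    using c01_continuous[of f] d unfolding continuous_on_iff by
        (metis atLeastAtMost_iff order_refl zero_le_one)
  then obtain \<rho> where \<rho>: "\<rho> > 0" "\<And>t. t \<in> {0..1} \<Longrightarrow> 1 - t < \<rho> \<Longrightarrow> cmod (c01_apply f t) < d"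
    using f1 by (auto simp: dist_norm abs_minus_commute)
  \<comment> \<open>Away from 1 the quotient is at most \<delta> / \<rho>, and this choice makes
    \<open>norm f * (\<delta> / \<rho>)\<close> at most \<open>d\<close>; the added 1 covers f =
    0.\<close>
  define \<delta> where "\<delta> = \<rho> * d / (norm f + 1)"
  have nf: "norm f + 1 > 0"
    by (simp add: add_nonneg_pos)
  have \<delta>: "\<delta> > 0"
    unfolding \<delta>_def using \<rho>(1) d nf by simp
  \<comment> \<open>The absolute value keeps the denominator positive on the whole line, not only on
    the unit interval.\<close>
  define b where "b = Abs_c01 (\<lambda>t. c01_apply f t / of_real (\<bar>1 - t\<bar> + \<delta>))"
  have "\<bar>1 - t\<bar> + \<delta> \<noteq> 0" for t :: real
    using \<delta> by linarith
  then have ne: "complex_of_real \<bar>1 - t\<bar> + complex_of_real \<delta> \<noteq> 0" for t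
    by (metis of_real_add of_real_eq_0_iff)
  have b: "c01_apply b = (\<lambda>t. c01_apply f t / of_real (\<bar>1 - t\<bar> + \<delta>))"
    unfolding b_def
    by (rule Abs_c01_inverse) (use ne in
        \<open>auto intro!: continuous_intros c01_continuous simp: c01_outside\<close>)
  have "norm (f - cone_fun * b) \<le> d"
  proof (rule norm_c01_le)
    fix t :: real
    assume t: "t \<in> {0..1}"
    have eq: "c01_apply (f - cone_fun * b) t = c01_apply f t * of_real (\<delta> / (1 - t + \<delta>))"
      using t ne[of t] by (simp add: c01_rep_eq b cone_apply field_simps)
    have *: "cmod (c01_apply (f - cone_fun * b) t) = cmod (c01_apply f t) * (\<delta> / (1 - t + \<delta>))"
      using t \<delta> unfolding eq norm_mult norm_of_real by simp
    show "cmod (c01_apply (f - cone_fun * b) t) \<le> d"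
    proof (cases "1 - t < \<rho>")
      case True
      have "\<delta> / (1 - t + \<delta>) \<le> 1"
        using t \<delta> by simp
      then have "cmod (c01_apply f t) * (\<delta> / (1 - t + \<delta>)) \<le> cmod (c01_apply f t)"
        by (intro mult_left_le) auto
      then show ?thesis
        using \<rho>(2)[OF t True] * by linarith
    next
      case False
      have "\<delta> / (1 - t + \<delta>) \<le> \<delta> / \<rho>"
        using False \<delta> \<rho>(1) by (intro divide_left_mono mult_pos_pos) auto
      then have "cmod (c01_apply f t) * (\<delta> / (1 - t + \<delta>)) \<le> norm f * (\<delta> / \<rho>)"
        using \<delta> t by (intro mult_mono norm_c01_ge) auto
      also have "\<dots> = d * (norm f / (norm f + 1))"
        unfolding \<delta>_def using \<rho>(1) by simp
      also have "\<dots> \<le> d"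
        using d nf by (intro mult_left_le) auto
      finally show ?thesis
        using * by simp
    qed
  qed
  then show ?thesis
    using that by blast
qed

text \<open>The coordinate \<open>0\<close> ranges over \<open>C([0,1])\<close> and all others over \<open>C\<^sub>0([0,1))\<close>, so the fibre at
    \<open>0\<close> is
  \<open>l\<^sup>2\<close> and the fibre at \<open>1\<close> is \<open>\<complex>\<close>.\<close>

definition cone_module :: "(nat \<Rightarrow> c01, c01) hmod" where
  "cone_module = \<lparr>hcarrier = {x. (\<forall>n>0. c01_apply (x n) 1 = 0) \<and> summable (\<lambda>n. star (x n) * x n)},
     hadd = (\<lambda>x y n. x n + y n), hzero = (\<lambda>_. 0), hact = (\<lambda>x b n. x n * b),
     hip = (\<lambda>x y. \<Sum>n. star (x n) * y n)\<rparr>"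

lemma cone_module_simps [simp]:
  "hadd cone_module x y = (\<lambda>n. x n + y n)" "hzero cone_module = (\<lambda>_. 0)"
  "hact cone_module x b = (\<lambda>n. x n * b)" "hip cone_module x y = (\<Sum>n. star (x n) * y n)"
  "hsub cone_module x y = (\<lambda>n. x n - y n)"
  "hscale cone_module c x = (\<lambda>n. scaleC c (x n))"
  by (simp_all add: cone_module_def hsub_def hscale_def mult_scaleC_right)

lemma cone_carrier_iff:
  "x \<in> hcarrier cone_module \<longleftrightarrow> (\<forall>n>0. c01_apply (x n) 1 = 0) \<and> summable (\<lambda>n. star (x n) * x n)"
  by (simp add: cone_module_def)

lemma star_mult_self_apply: "c01_apply (star x * x) t = of_real ((cmod (c01_apply x t))\<^sup>2)"
  unfolding times_c01.rep_eq star_c01.rep_eq by (metis complex_norm_square mult.commute)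

lemma cone_carrierI:
  assumes g: "summable g" and "\<And>n. n > 0 \<Longrightarrow> c01_apply (x n) 1 = 0"
    and "\<And>n t. t \<in> {0..1} \<Longrightarrow> (cmod (c01_apply (x n) t))\<^sup>2 \<le> Re (c01_apply (g n) t)"
  shows "x \<in> hcarrier cone_module"
  unfolding cone_carrier_iff
  by (intro conjI allI impI assms c01_summable_dominated[OF g])
    (use assms(3) in \<open>auto simp: star_mult_self_apply norm_mult norm_power\<close>)

lemma cone_carrierD: "x \<in> hcarrier cone_module \<Longrightarrow> summable (\<lambda>n. star (x n) * x n)"
  "x \<in> hcarrier cone_module \<Longrightarrow> n > 0 \<Longrightarrow> c01_apply (x n) 1 = 0"
  by (auto simp: cone_carrier_iff)

lemma cone_summable_ip:
  assumes "x \<in> hcarrier cone_module" "y \<in> hcarrier cone_module"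
  shows "summable (\<lambda>n. star (x n) * y n)"
proof (rule c01_summable_dominated)
  show "summable (\<lambda>n. star (x n) * x n + star (y n) * y n)"
    by (rule summable_add[OF cone_carrierD(1)[OF assms(1)] cone_carrierD(1)[OF assms(2)]])
  show "cmod (c01_apply (star (x n) * y n) t)
      \<le> Re (c01_apply (star (x n) * x n + star (y n) * y n) t)" for n t
    using sum_squares_bound[of "cmod (c01_apply (x n) t)" "cmod (c01_apply (y n) t)"]
    unfolding plus_c01.rep_eq star_mult_self_apply
    by (simp add: c01_rep_eq norm_mult)
      (use mult_nonneg_nonneg[OF norm_ge_zero norm_ge_zero, of "c01_apply (x n) t"
          "c01_apply (y n) t"] in linarith)
qed

lemma cone_ip_sums:
  assumes "x \<in> hcarrier cone_module" "y \<in> hcarrier cone_module"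
  shows "(\<lambda>n. cnj (c01_apply (x n) t) * c01_apply (y n) t) sums c01_apply (hip cone_module x y) t"
  using c01_apply_sums[OF summable_sums[OF cone_summable_ip[OF assms]], of t]
  by (simp add: c01_rep_eq)

lemma cone_sq_sums:
  assumes "x \<in> hcarrier cone_module"
  shows "(\<lambda>n. (cmod (c01_apply (x n) t))\<^sup>2) sums Re (c01_apply (hip cone_module x x) t)"
  using sums_Re[OF cone_ip_sums[OF assms assms, of t]]
  by (simp only: mult.commute[of "cnj _"] complex_norm_square[symmetric] Re_complex_of_real)

lemma cone_ip_self:
  assumes "x \<in> hcarrier cone_module"
  shows "c01_apply (hip cone_module x x) t = of_real (\<Sum>n. (cmod (c01_apply (x n) t))\<^sup>2)"
proof -
  have "(\<lambda>n. cnj (c01_apply (x n) t) * c01_apply (x n) t)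
      = (\<lambda>n. of_real ((cmod (c01_apply (x n) t))\<^sup>2))"
    by (simp add: complex_norm_square mult.commute fun_eq_iff del: of_real_power)
  then have "(\<lambda>n. complex_of_real ((cmod (c01_apply (x n) t))\<^sup>2)) sums c01_apply (hip cone_module
      x x) t"
    using cone_ip_sums[OF assms assms, of t] by simp
  then show ?thesis
    using sums_unique2 sums_of_real[OF summable_sums[OF sums_summable[OF cone_sq_sums[OF assms]]]]
        by blast
qed

lemma cone_sq_le:
  assumes "x \<in> hcarrier cone_module" "t \<in> {0..1}"
  shows "(\<Sum>n. (cmod (c01_apply (x n) t))\<^sup>2) \<le> (hnorm cone_module x)\<^sup>2"
proof -
  have "(\<Sum>n. (cmod (c01_apply (x n) t))\<^sup>2) = Re (c01_apply (hip cone_module x x) t)"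
    using cone_ip_self[OF assms(1)] by simp
  also have "\<dots> \<le> norm (hip cone_module x x)"
    using norm_c01_ge[OF assms(2)] complex_Re_le_cmod order_trans by blast
  finally show ?thesis
    by (simp add: hnorm_def)
qed

lemma cone_norm_le:
  assumes "x \<in> hcarrier cone_module" "c \<ge> 0"
    and "\<And>t. t \<in> {0..1} \<Longrightarrow> (\<Sum>n. (cmod (c01_apply (x n) t))\<^sup>2) \<le> c\<^sup>2"
  shows "hnorm cone_module x \<le> c"
proof -
  have "norm (hip cone_module x x) \<le> c\<^sup>2"
  proof (rule norm_c01_le)
    fix t :: real
    assume "t \<in> {0..1}"
    then show "cmod (c01_apply (hip cone_module x x) t) \<le> c\<^sup>2"
      unfolding cone_ip_self[OF assms(1)] norm_of_real
      using assms(3)[of t] by (simp add: suminf_nonneg[OF sums_summable[OF cone_sq_sums[OF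
          assms(1)]]])
  qed
  then show ?thesis
    unfolding hnorm_def using assms(2) by (metis abs_of_nonneg real_sqrt_abs real_sqrt_le_iff)
qed

lemma cone_norm_component: "x \<in> hcarrier cone_module \<Longrightarrow> norm (x n) \<le> hnorm cone_module x"
proof (rule norm_c01_le)
  fix t :: real
  assume x: "x \<in> hcarrier cone_module" and t: "t \<in> {0..1}"
  have "(cmod (c01_apply (x n) t))\<^sup>2 \<le> (\<Sum>n. (cmod (c01_apply (x n) t))\<^sup>2)"
    using sum_le_suminf[OF sums_summable[OF cone_sq_sums[OF x]], of "{n}" t] by simp
  then have "(cmod (c01_apply (x n) t))\<^sup>2 \<le> (hnorm cone_module x)\<^sup>2"
    using cone_sq_le[OF x t] by simp
  then show "cmod (c01_apply (x n) t) \<le> hnorm cone_module x"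
    by (simp add: hnorm_def power2_le_imp_le)
qed

lemma norm_add_sq_le: "(norm (x + y))\<^sup>2 \<le> 2 * (norm x)\<^sup>2
  + 2 * (norm (y :: 'a :: real_normed_vector))\<^sup>2"
proof -
  have "(norm (x + y))\<^sup>2 \<le> (norm x + norm y)\<^sup>2"
    by (simp add: norm_triangle_ineq power_mono)
  then show ?thesis
    using sum_squares_bound[of "norm x" "norm y"] by (simp add: power2_sum)
qed

lemma cone_add_closed:
  assumes "x \<in> hcarrier cone_module" "y \<in> hcarrier cone_module"
  shows "(\<lambda>n. x n + y n) \<in> hcarrier cone_module"
proof (rule cone_carrierI)
  show "summable (\<lambda>n. 2 * (star (x n) * x n) + 2 * (star (y n) * y n))"
    by (rule summable_add[OF summable_mult summable_mult,
          OF cone_carrierD(1)[OF assms(1)] cone_carrierD(1)[OF assms(2)]])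
  show "(cmod (c01_apply (x n + y n) t))\<^sup>2
      \<le> Re (c01_apply (2 * (star (x n) * x n) + 2 * (star (y n) * y n)) t)" for n t
    using norm_add_sq_le[of "c01_apply (x n) t" "c01_apply (y n) t"]
    unfolding mult_2 plus_c01.rep_eq star_mult_self_apply by simp
qed (simp add: cone_carrierD[OF assms(1)] cone_carrierD[OF assms(2)] c01_rep_eq)

lemma cone_act_closed:
  assumes "x \<in> hcarrier cone_module"
  shows "(\<lambda>n. x n * b) \<in> hcarrier cone_module"
proof (rule cone_carrierI)
  show "summable (\<lambda>n. (star (x n) * x n) * (norm b)\<^sup>2 *\<^sub>R 1)"
    by (rule summable_mult2[OF cone_carrierD(1)[OF assms]])
  show "(cmod (c01_apply (x n * b) t))\<^sup>2 \<le> Re (c01_apply ((star (x n) * x n) * (norm b)\<^sup>2 *\<^sub>R 1) t)"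
    if "t \<in> {0..1}" for n t
    using norm_c01_ge[OF that, of b] that
    unfolding times_c01.rep_eq[of "star (x n) * x n"] star_mult_self_apply
    by (simp add: c01_rep_eq norm_mult power_mult_distrib mult_left_mono power_mono
        mult.commute[of "(norm b)\<^sup>2"])
qed (simp add: cone_carrierD[OF assms(1)] c01_rep_eq)

lemma cone_sub_closed:
  assumes "x \<in> hcarrier cone_module" "y \<in> hcarrier cone_module"
  shows "(\<lambda>n. x n - y n) \<in> hcarrier cone_module"
  using cone_add_closed[OF assms(1) cone_act_closed[OF assms(2), of "- 1"]] by simp

text \<open>Coordinatewise limits exist because the coordinates are contractive. What needs an
  argument is membership of the limit: the tail of \<open>L\<close> is compared with the tail of one
  fixed \<open>X m\<close>, which is small in the sup norm, that is, uniformly in t.\<close>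

lemma cone_complete:
  assumes X: "\<And>n. X n \<in> hcarrier cone_module"
    and C: "\<And>e. e > 0 \<Longrightarrow> \<exists>N. \<forall>m\<ge>N. \<forall>n\<ge>N. hnorm cone_module (hsub cone_module (X m) (X n)) < e"
  shows "\<exists>x\<in>hcarrier cone_module. (\<lambda>n. hnorm cone_module (hsub cone_module (X n) x)) \<longlonglongrightarrow> 0"
proof -
  have "Cauchy (\<lambda>m. X m n)" for n
  proof (rule CauchyI)
    fix e :: real
    assume "e > 0"
    from C[OF this] obtain N where N: "\<And>m k. m \<ge> N \<Longrightarrow> k \<ge> N
        \<Longrightarrow> hnorm cone_module (hsub cone_module (X m) (X k)) < e"
      by blast
    have "norm (X m n - X k n) < e" if "m \<ge> N" "k \<ge> N" for m k
      using N[OF that] cone_norm_component[OF cone_sub_closed[OF X[of m] X[of k]], of n] by simp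
    then show "\<exists>M. \<forall>m\<ge>M. \<forall>k\<ge>M. norm (X m n - X k n) < e"
      by blast
  qed
  then have "\<exists>L. (\<lambda>m. X m n) \<longlonglongrightarrow> L" for n
    using Cauchy_convergent convergent_def by blast
  then obtain L where L: "\<And>n. (\<lambda>m. X m n) \<longlonglongrightarrow> L n"
    by metis
  have L1: "c01_apply (L n) 1 = 0" if "n > 0" for n
    using c01_tendsto_apply[OF L, of n 1] X that cone_carrierD(2) by (simp add: LIMSEQ_const_iff)
  \<comment> \<open>Finite sums allow the limit in k to be taken termwise. The estimate is uniform
    in t and in the finite set, so it serves both for membership of \<open>L\<close> and for
    convergence in norm.\<close>
  have block: "\<exists>N. \<forall>m\<ge>N. \<forall>A t. finite A \<longrightarrow> t \<in> {0..1} \<longrightarrow>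
      (\<Sum>n\<in>A. (cmod (c01_apply (X m n - L n) t))\<^sup>2) \<le> e\<^sup>2" if "e > 0" for e
  proof -
    obtain N where N: "\<And>m k. m \<ge> N \<Longrightarrow> k \<ge> N \<Longrightarrow> hnorm cone_module (\<lambda>n. X m n - X k n) < e"
      using C[OF \<open>e > 0\<close>] by auto
    have "(\<Sum>n\<in>A. (cmod (c01_apply (X m n - L n) t))\<^sup>2) \<le> e\<^sup>2"
      if m: "m \<ge> N" and A: "finite A" and t: "t \<in> {0..1}" for m A t
    proof (rule LIMSEQ_le_const2)
      show "(\<lambda>k. \<Sum>n\<in>A. (cmod (c01_apply (X m n - X k n) t))\<^sup>2)
          \<longlonglongrightarrow> (\<Sum>n\<in>A. (cmod (c01_apply (X m n - L n) t))\<^sup>2)"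
        by (intro tendsto_intros c01_tendsto_apply L)
      show "\<exists>K. \<forall>k\<ge>K. (\<Sum>n\<in>A. (cmod (c01_apply (X m n - X k n) t))\<^sup>2) \<le> e\<^sup>2"
      proof (intro exI allI impI)
        fix k
        assume k: "k \<ge> N"
        note D = cone_sub_closed[OF X X, of m k]
        have "(\<Sum>n\<in>A. (cmod (c01_apply (X m n - X k n) t))\<^sup>2)
            \<le> (\<Sum>n. (cmod (c01_apply (X m n - X k n) t))\<^sup>2)"
          by (intro sum_le_suminf sums_summable[OF cone_sq_sums[OF D]] A) auto
        also have "\<dots> \<le> (hnorm cone_module (\<lambda>n. X m n - X k n))\<^sup>2"
          by (rule cone_sq_le[OF D t])
        also have "\<dots> \<le> e\<^sup>2"
          using N[OF m k] by (intro power_mono) (auto simp: hnorm_def)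
        finally show "(\<Sum>n\<in>A. (cmod (c01_apply (X m n - X k n) t))\<^sup>2) \<le> e\<^sup>2" .
      qed
    qed
    then show ?thesis
      by blast
  qed
  have LE: "L \<in> hcarrier cone_module"
    unfolding cone_carrier_iff
  proof (intro conjI allI impI L1)
    show "summable (\<lambda>n. star (L n) * L n)"
      unfolding summable_Cauchy
    proof (intro allI impI)
      fix e :: real
      assume e: "e > 0"
      \<comment> \<open>Two terms of size at most 2 * (e / 8) leave e / 2, which keeps the final
        inequality strict.\<close>
      define d where "d = sqrt (e / 8)"
      have d: "d > 0" "d\<^sup>2 = e / 8"
        using e by (simp_all add: d_def)
      obtain m where m: "\<And>A t. finite A \<Longrightarrow> t \<in> {0..1} \<Longrightarrow>
          (\<Sum>n\<in>A. (cmod (c01_apply (X m n - L n) t))\<^sup>2) \<le> d\<^sup>2"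
        using block[OF d(1)] by blast
      obtain N where N: "\<And>k l. k \<ge> N \<Longrightarrow> norm (\<Sum>n = k..<l. star (X m n) * X m n) < e / 8"
        using cone_carrierD(1)[OF X[of m]] e unfolding summable_Cauchy
        by (meson divide_pos_pos zero_less_numeral)
      have "norm (\<Sum>n = k..<l. star (L n) * L n) < e" if k: "k \<ge> N" for k l
      proof -
        have "norm (\<Sum>n = k..<l. star (L n) * L n) \<le> e / 2"
        proof (rule norm_c01_le)
          fix t :: real
          assume t: "t \<in> {0..1}"
          have "cmod (c01_apply (\<Sum>n = k..<l. star (L n) * L n) t)
              = (\<Sum>n = k..<l. (cmod (c01_apply (L n) t))\<^sup>2)"
            unfolding c01_apply_sum star_mult_self_apply of_real_sum[symmetric] norm_of_real
            by (simp add: sum_nonneg)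
          also have "\<dots> \<le> (\<Sum>n = k..<l. 2 * (cmod (c01_apply (X m n) t))\<^sup>2
              + 2 * (cmod (c01_apply (X m n - L n) t))\<^sup>2)"
            by (rule sum_mono)
              (use norm_add_sq_le[of "c01_apply (X m n) t" "c01_apply (L n) t
                  - c01_apply (X m n) t" for n]
                in \<open>simp add: c01_rep_eq norm_minus_commute[of "c01_apply (X m _) t"]\<close>)
          also have "\<dots> = 2 * (\<Sum>n = k..<l. (cmod (c01_apply (X m n) t))\<^sup>2)
              + 2 * (\<Sum>n = k..<l. (cmod (c01_apply (X m n - L n) t))\<^sup>2)"
            by (simp add: sum.distrib sum_distrib_left)
          also have "(\<Sum>n = k..<l. (cmod (c01_apply (X m n) t))\<^sup>2)
              = cmod (c01_apply (\<Sum>n = k..<l. star (X m n) * X m n) t)"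
            unfolding c01_apply_sum star_mult_self_apply of_real_sum[symmetric] norm_of_real
            by (simp add: sum_nonneg)
          also have "\<dots> \<le> e / 8"
            using N[OF k, of l] norm_c01_ge[OF t, of "\<Sum>n = k..<l. star (X m n) * X m n"] by linarith
          also have "(\<Sum>n = k..<l. (cmod (c01_apply (X m n - L n) t))\<^sup>2) \<le> e / 8"
            using m[of "{k..<l}" t] t d(2) by simp
          finally show "cmod (c01_apply (\<Sum>n = k..<l. star (L n) * L n) t) \<le> e / 2"
            by simp
        qed
        then show ?thesis
          using e by linarith
      qed
      then show "\<exists>N. \<forall>m\<ge>N. \<forall>n. norm (\<Sum>n = m..<n. star (L n) * L n) < e"
        by blast
    qed
  qed
  have "(\<lambda>n. hnorm cone_module (hsub cone_module (X n) L)) \<longlonglongrightarrow> 0"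
  proof (rule LIMSEQ_I)
    fix r :: real
    assume r: "r > 0"
    then obtain N where N: "\<And>m A t. m \<ge> N \<Longrightarrow> finite A \<Longrightarrow> t \<in> {0..1} \<Longrightarrow>
        (\<Sum>n\<in>A. (cmod (c01_apply (X m n - L n) t))\<^sup>2) \<le> (r / 2)\<^sup>2"
      using block[of "r / 2"] by auto
    have "hnorm cone_module (\<lambda>n. X m n - L n) \<le> r / 2" if "m \<ge> N" for m
    proof (rule cone_norm_le[OF cone_sub_closed[OF X LE]])
      show "(\<Sum>n. (cmod (c01_apply (X m n - L n) t))\<^sup>2) \<le> (r / 2)\<^sup>2" if "t \<in> {0..1}" for t
        by (intro suminf_le_const sums_summable[OF cone_sq_sums[OF cone_sub_closed[OF X LE]]]
            N[OF \<open>m \<ge> N\<close> _ that]) auto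
    qed (use r in simp)
    then have "norm (hnorm cone_module (hsub cone_module (X m) L) - 0) < r" if "m \<ge> N" for m
      using that r by (fastforce simp: hnorm_def)
    then show "\<exists>N. \<forall>n\<ge>N. norm (hnorm cone_module (hsub cone_module (X n) L) - 0) < r"
      by blast
  qed
  then show ?thesis
    using LE by blast
qed

lemma hilbert_module_cone: "hilbert_module cone_module"
proof
  show "hzero cone_module \<in> hcarrier cone_module"
    by (simp add: cone_carrier_iff c01_rep_eq)
next
  fix x :: "nat \<Rightarrow> c01"
  assume x: "x \<in> hcarrier cone_module"
  show "\<exists>y\<in>hcarrier cone_module. hadd cone_module x y = hzero cone_module"
    by (rule bexI[OF _ cone_act_closed[OF x, of "- 1"]]) simp
  show "positive_elem (hip cone_module x x)"
    by (rule c01_positive_elemI[OF cone_ip_self[OF x]])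
      (simp add: suminf_nonneg[OF sums_summable[OF cone_sq_sums[OF x]]])
  show "x = hzero cone_module" if "hip cone_module x x = 0"
  proof -
    have "x n = 0" for n
    proof (rule c01_eqI)
      fix t :: real
      have "(\<Sum>n. (cmod (c01_apply (x n) t))\<^sup>2) = 0"
        using cone_ip_self[OF x, of t] that by (simp add: c01_rep_eq)
      then show "c01_apply (x n) t = c01_apply 0 t"
        by (subst (asm) suminf_eq_zero_iff[OF sums_summable[OF cone_sq_sums[OF x]]])
          (auto simp: c01_rep_eq)
    qed
    then show ?thesis
      by auto
  qed
next
  fix x y :: "nat \<Rightarrow> c01" and b
  assume xy: "x \<in> hcarrier cone_module" "y \<in> hcarrier cone_module"
  show "star (hip cone_module x y) = hip cone_module y x"
  proof (rule c01_eqI)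
    fix t :: real
    have "(\<lambda>n. cnj (cnj (c01_apply (x n) t) * c01_apply (y n) t)) sums c01_apply (hip cone_module
        y x) t"
      using cone_ip_sums[OF xy(2,1), of t] by (simp add: mult.commute)
    then show "c01_apply (star (hip cone_module x y)) t = c01_apply (hip cone_module y x) t"
      using cone_ip_sums[OF xy, of t] sums_cnj sums_unique2 unfolding star_c01.rep_eq by blast
  qed
  show "hip cone_module x (hact cone_module y b) = hip cone_module x y * b"
    using suminf_mult2[OF cone_summable_ip[OF xy], of b] by (simp add: mult.assoc)
next
  fix x y z :: "nat \<Rightarrow> c01"
  assume "x \<in> hcarrier cone_module" "y \<in> hcarrier cone_module" "z \<in> hcarrier cone_module"
  then show "hip cone_module x (hadd cone_module y z) = hip cone_module x y + hip cone_module x z"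
    using suminf_add[OF cone_summable_ip cone_summable_ip] by (simp add: distrib_left)
next
  show "\<exists>x\<in>hcarrier cone_module. (\<lambda>n. hnorm cone_module (hsub cone_module (X n) x)) \<longlonglongrightarrow> 0"
    if "\<And>n. X n \<in> hcarrier cone_module"
      and "\<And>e. e > 0 \<Longrightarrow> \<exists>N. \<forall>m\<ge>N. \<forall>n\<ge>N. hnorm cone_module (hsub cone_module (X m) (X n)) < e" for X
    using that by (rule cone_complete)
next
  fix x y z :: "nat \<Rightarrow> c01" and b c
  assume x: "x \<in> hcarrier cone_module"
  show "hact cone_module x b \<in> hcarrier cone_module"
    using cone_act_closed[OF x] by simp
  show "hact cone_module x (b + c) = hadd cone_module (hact cone_module x b) (hact cone_module x c)"
    by (simp add: fun_eq_iff distrib_left)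
  show "hact cone_module x (b * c) = hact cone_module (hact cone_module x b) c"
    by (simp add: fun_eq_iff mult.assoc)
  assume y: "y \<in> hcarrier cone_module"
  show "hadd cone_module x y \<in> hcarrier cone_module"
    using cone_add_closed[OF x y] by simp
  show "hact cone_module (hadd cone_module x y) b
      = hadd cone_module (hact cone_module x b) (hact cone_module y b)"
    by (simp add: fun_eq_iff distrib_right)
  show "hadd cone_module (hadd cone_module x y) z
      = hadd cone_module x (hadd cone_module y z)" "hadd cone_module x y = hadd cone_module y x"
    by (simp_all add: fun_eq_iff add.assoc add.commute)
qed (simp_all only: cone_module_simps mult_1_right add_0_right)

section \<open>Weighted permutations\<close>

text \<open>As \<open>\<sigma> n\<close> is one of \<open>n - 1\<close>, \<open>n\<close>, \<open>n
    + 1\<close>, a permuted series is dominated by shifts of the original one;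
  this matters because the series in \<open>C([0,1])\<close> need not converge absolutely.\<close>

definition adjacent_involution :: "(nat \<Rightarrow> nat) \<Rightarrow> bool" where
  "adjacent_involution \<sigma> \<longleftrightarrow> (\<forall>n. \<sigma> (\<sigma> n) = n) \<and> \<sigma> 0 = 0 \<and> (\<forall>n. \<sigma> n \<le> Suc n)"

lemma adjacent_involution_id: "adjacent_involution (\<lambda>n. n)"
  by (simp add: adjacent_involution_def)

lemma adjacent_involution_invol: "adjacent_involution \<sigma> \<Longrightarrow> \<sigma> (\<sigma> n) = n"
  by (simp add: adjacent_involution_def)

lemma adjacent_involution_pos: "adjacent_involution \<sigma> \<Longrightarrow> \<sigma> n > 0 \<longleftrightarrow> n > 0"
proof -
  assume "adjacent_involution \<sigma>"
  then have "\<sigma> 0 = 0" "\<sigma> (\<sigma> n) = n"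
    by (simp_all add: adjacent_involution_def)
  then show "\<sigma> n > 0 \<longleftrightarrow> n > 0"
    by (cases "n = 0"; cases "\<sigma> n = 0") auto
qed

text \<open>The upper bound applied to \<open>\<sigma> n\<close> reads
  \<open>n \<le> Suc (\<sigma> n)\<close>, which is the missing lower bound.\<close>

lemma adjacent_involution_cases: "adjacent_involution \<sigma> \<Longrightarrow> \<sigma> n = n \<or> \<sigma> n = Suc n \<or> n = Suc (\<sigma> n)"
proof -
  assume \<sigma>: "adjacent_involution \<sigma>"
  have "\<sigma> n \<le> Suc n" "\<sigma> (\<sigma> n) \<le> Suc (\<sigma> n)"
    using \<sigma> unfolding adjacent_involution_def by blast+
  then show "\<sigma> n = n \<or> \<sigma> n = Suc n \<or> n = Suc (\<sigma> n)"
    unfolding adjacent_involution_invol[OF \<sigma>] by linarith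
qed

lemma adjacent_involution_bij: "adjacent_involution \<sigma> \<Longrightarrow> bij \<sigma>"
  by (rule o_bij[of \<sigma> \<sigma>]) (auto simp: adjacent_involution_def fun_eq_iff)

lemma adjacent_involution_inj: "adjacent_involution \<sigma> \<Longrightarrow> inj \<sigma>"
  using adjacent_involution_bij bij_is_inj by blast

lemma adjacent_involution_suminf:
  fixes f :: "nat \<Rightarrow> real"
  assumes "adjacent_involution \<sigma>" "summable f" "\<And>n. f n \<ge> 0"
  shows "(\<lambda>n. f (\<sigma> n)) sums suminf f"
proof -
  have s: "summable (\<lambda>n. f (\<sigma> n))"
    using summable_reindex[OF assms(2) adjacent_involution_inj[OF assms(1)] assms(3)] by
        (simp add: o_def)
  have "suminf (f \<circ> \<sigma>) = suminf f"
    by (rule suminf_reindex[OF assms(2) adjacent_involution_inj[OF assms(1)] assms(3)])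
      (use bij_is_surj[OF adjacent_involution_bij[OF assms(1)]] in auto)
  then show ?thesis
    using s by (simp add: o_def sums_iff)
qed

lemma adjacent_involution_sums:
  fixes f :: "nat \<Rightarrow> complex"
  assumes "adjacent_involution \<sigma>" "summable (\<lambda>n. norm (f n))" "f sums s"
  shows "(\<lambda>n. f (\<sigma> n)) sums s"
proof -
  have "(f has_sum s) UNIV"
    using norm_summable_imp_has_sum[OF assms(2,3)] .
  then have "((\<lambda>n. f (\<sigma> n)) has_sum s) UNIV"
    by (simp only: has_sum_reindex_bij_betw[OF adjacent_involution_bij[OF assms(1)], of f])
  then show ?thesis
    by (rule has_sum_imp_sums)
qed

text \<open>Scalars, the grading, the operator of the homotopy and all defects that have to be
  compact are of this form, so one lemma each on boundedness, adjoints and compactness covers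
  them.\<close>

definition wperm :: "(nat \<Rightarrow> 'b) \<Rightarrow> (nat \<Rightarrow> nat) \<Rightarrow> (nat \<Rightarrow> 'b) \<Rightarrow> nat \<Rightarrow> 'b :: times" where
  "wperm m \<sigma> x = (\<lambda>n. m n * x (\<sigma> n))"

lemma wperm_closed:
  assumes \<sigma>: "adjacent_involution \<sigma>" and m: "\<And>n. norm (m n) \<le> C" and x: "x \<in> hcarrier cone_module"
  shows "wperm m \<sigma> x \<in> hcarrier cone_module"
proof (rule cone_carrierI)
  let ?s = "\<lambda>n. star (x n) * x n"
  note s = cone_carrierD(1)[OF x]
  have 1: "summable (\<lambda>n. ?s (Suc n))"
    using s by (subst summable_Suc_iff)
  \<comment> \<open>For n = 0 the truncated subtraction repeats the term at 0, which does no harm to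
    summability.\<close>
  have 2: "summable (\<lambda>n. ?s (n - 1))"
    by (rule summable_Suc_iff[THEN iffD1]) (simp add: s)
  show "summable (\<lambda>n. C\<^sup>2 *\<^sub>R (?s n + ?s (Suc n) + ?s (n - 1)))"
    by (rule summable_scaleR_right[OF summable_add[OF summable_add[OF s 1] 2]])
  show "c01_apply (wperm m \<sigma> x n) 1 = 0" if "n > 0" for n
    using cone_carrierD(2)[OF x] that adjacent_involution_pos[OF \<sigma>] by
        (simp add: wperm_def c01_rep_eq)
  show "(cmod (c01_apply (wperm m \<sigma> x n) t))\<^sup>2
      \<le> Re (c01_apply (C\<^sup>2 *\<^sub>R (?s n + ?s (Suc n) + ?s (n - 1))) t)" if t: "t \<in> {0..1}" for n t
  proof -
    have "cmod (c01_apply (m n) t) \<le> C"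
      using norm_c01_ge[OF t, of "m n"] m[of n] by linarith
    then have "(cmod (c01_apply (wperm m \<sigma> x n) t))\<^sup>2 \<le> C\<^sup>2 * (cmod (c01_apply (x (\<sigma> n)) t))\<^sup>2"
      by (simp add: wperm_def c01_rep_eq norm_mult power_mult_distrib mult_right_mono power_mono)
    also have "(cmod (c01_apply (x (\<sigma> n)) t))\<^sup>2 \<le> (cmod (c01_apply (x n) t))\<^sup>2
        + (cmod (c01_apply (x (Suc n)) t))\<^sup>2 + (cmod (c01_apply (x (n - 1)) t))\<^sup>2"
      using adjacent_involution_cases[OF \<sigma>, of n]
    proof (elim disjE)
      assume "n = Suc (\<sigma> n)"
      then have "n - 1 = \<sigma> n"
        by linarith
      then show ?thesis
        by simp
    qed simp_all
    finally show ?thesis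
      unfolding scaleR_c01.rep_eq plus_c01.rep_eq star_mult_self_apply
      by (simp add: mult_left_mono)
  qed
qed

lemma cone_abs_summable:
  assumes "x \<in> hcarrier cone_module" "y \<in> hcarrier cone_module"
  shows "summable (\<lambda>n. norm (cnj (c01_apply (x n) t) * c01_apply (y n) t))"
proof (rule summable_comparison_test')
  show "summable (\<lambda>n. (cmod (c01_apply (x n) t))\<^sup>2 + (cmod (c01_apply (y n) t))\<^sup>2)"
    by (intro summable_add sums_summable[OF cone_sq_sums] assms)
  show "norm (norm (cnj (c01_apply (x n) t) * c01_apply (y n) t))
      \<le> (cmod (c01_apply (x n) t))\<^sup>2 + (cmod (c01_apply (y n) t))\<^sup>2" if "n \<ge> 0" for n
    using sum_squares_bound[of "cmod (c01_apply (x n) t)" "cmod (c01_apply (y n) t)"]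
      mult_nonneg_nonneg[OF norm_ge_zero norm_ge_zero, of "c01_apply (x n) t" "c01_apply (y n) t"]
    by (simp only: norm_mult complex_mod_cnj abs_norm_cancel real_norm_def abs_mult)
qed

text \<open>Reindexing the inner product by \<open>\<sigma>\<close> moves the weight to the other
  side, with its index changed to \<open>\<sigma> n\<close>. The rearrangement is made for each
  fixed t, where the scalar series converges absolutely.\<close>

lemma wperm_adjoint:
  assumes \<sigma>: "adjacent_involution \<sigma>" and m: "\<And>n. norm (m n) \<le> C"
  shows "adjoint_pair cone_module (wperm m \<sigma>) (wperm (\<lambda>n. star (m (\<sigma> n))) \<sigma>)"
proof -
  have m': "norm (star (m (\<sigma> n))) \<le> C" for n
    by (rule order_trans[OF _ m[of "\<sigma> n"]]) (rule norm_c01_le, simp add: c01_rep_eq norm_c01_ge)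
  have "hip cone_module (wperm m \<sigma> x) y = hip cone_module x (wperm (\<lambda>n. star (m (\<sigma> n))) \<sigma> y)"
    if x: "x \<in> hcarrier cone_module" and y: "y \<in> hcarrier cone_module" for x y
  proof (rule c01_eqI)
    fix t :: real
    note c = wperm_closed[OF \<sigma> m x] wperm_closed[OF \<sigma> m' y]
    have "(\<lambda>n. cnj (c01_apply (wperm m \<sigma> x (\<sigma> n)) t) * c01_apply (y (\<sigma> n)) t)
        sums c01_apply (hip cone_module (wperm m \<sigma> x) y) t"
      by (rule adjacent_involution_sums[OF \<sigma> cone_abs_summable cone_ip_sums]) (fact c y)+
    moreover have "(\<lambda>n. cnj (c01_apply (wperm m \<sigma> x (\<sigma> n)) t) * c01_apply (y (\<sigma> n)) t)
        = (\<lambda>n. cnj (c01_apply (x n) t) * c01_apply (wperm (\<lambda>n. star (m (\<sigma> n))) \<sigma> y n) t)"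
      by (simp add: fun_eq_iff wperm_def c01_rep_eq adjacent_involution_invol[OF \<sigma>] mult_ac)
    ultimately have "(\<lambda>n. cnj (c01_apply (x n) t) * c01_apply (wperm (\<lambda>n. star (m (\<sigma> n))) \<sigma> y n) t)
        sums c01_apply (hip cone_module (wperm m \<sigma> x) y) t"
      by simp
    then show "c01_apply (hip cone_module (wperm m \<sigma> x) y) t
        = c01_apply (hip cone_module x (wperm (\<lambda>n. star (m (\<sigma> n))) \<sigma> y)) t"
      using cone_ip_sums[OF x c(2), of t] by (rule sums_unique2)
  qed
  then show ?thesis
    unfolding adjoint_pair_def
    by (auto simp del: cone_module_simps intro!: wperm_closed[OF \<sigma> m] wperm_closed[OF \<sigma> m'])
qed

section \<open>Compact operators and generators of the homotopy module\<close>

lemma lincomb_cone: "lincomb cone_module qs n = (\<Sum>(x, b)\<leftarrow>qs. x n * b)"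
  unfolding lincomb_def by (induction qs) auto

lemma cone_finite_support:
  assumes "finite A" "\<And>n. n \<notin> A \<Longrightarrow> x n = 0" "\<And>n. n > 0 \<Longrightarrow> c01_apply (x n) 1 = 0"
  shows "x \<in> hcarrier cone_module"
  unfolding cone_carrier_iff using assms by (auto intro!: summable_finite[OF assms(1)])

lemma compact_operator_cong:
  assumes "compact_operator E K" "\<And>x. x \<in> hcarrier E \<Longrightarrow> K' x = K x"
  shows "compact_operator E K'"
proof -
  have "adjointable E K'"
  proof -
    obtain G where "adjoint_pair E K G"
      using assms(1) unfolding compact_operator_def adjointable_def by blast
    then have "adjoint_pair E K' G"
      by (auto simp: adjoint_pair_def assms(2))
    then show ?thesis
      unfolding adjointable_def by blast
  qed
  then show ?thesis
    using assms(1) unfolding compact_operator_def by (simp add: assms(2))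
qed

text \<open>The weight has to factor: a rank one operator z \<mapsto> x \<langle>y, z\<rangle>
  multiplies by a product of two coordinates, and at positive index both of them vanish at t = 1.
  Truncation to n < N then has an error bounded by the remaining weights.\<close>

lemma wperm_compact:
  assumes \<sigma>: "adjacent_involution \<sigma>" and m: "\<And>n. m n = s n * r n"
    and sr: "\<And>n. n > 0 \<Longrightarrow> c01_apply (s n) 1 = 0" "\<And>n. n > 0 \<Longrightarrow> c01_apply (r n) 1 = 0"
    and lim: "(\<lambda>n. norm (m n)) \<longlonglongrightarrow> 0"
  shows "compact_operator cone_module (wperm m \<sigma>)"
  unfolding compact_operator_def
proof (intro conjI allI impI)
  have "Bseq m"
    using lim by (metis convergentI convergent_imp_Bseq tendsto_norm_zero_iff)
  then obtain C where C: "\<And>n. norm (m n) \<le> C"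
    unfolding Bseq_def by blast
  show "adjointable cone_module (wperm m \<sigma>)"
    unfolding adjointable_def using wperm_adjoint[of \<sigma> m C, OF \<sigma> C] by blast
  fix e :: real
  assume e: "e > 0"
  then obtain N where N: "\<And>n. n \<ge> N \<Longrightarrow> norm (m n) \<le> e"
    using LIMSEQ_D[OF lim, of e] by fastforce
  \<comment> \<open>In the rank one operator number k, the vector x sits at k and carries
    \<open>s k\<close>, while y sits at \<open>\<sigma> k\<close> and carries
    \<open>star (r k)\<close>, so that \<langle>y, z\<rangle> is
    \<open>r k * z (\<sigma> k)\<close>.\<close>
  define ps where "ps = map (\<lambda>k. (\<lambda>n. if n = k then s k else 0, \<lambda>n. if n = \<sigma> k then star (r k)
      else 0)) [0..<N]"
  have in1: "(\<lambda>n. if n = k then s k else 0) \<in> hcarrier cone_module" for k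
    by (rule cone_finite_support[of "{k}"]) (use sr in \<open>auto simp: c01_rep_eq\<close>)
  have in2: "(\<lambda>n. if n = \<sigma> k then star (r k) else 0) \<in> hcarrier cone_module" for k
    by (rule cone_finite_support[of "{\<sigma> k}"])
        (use sr adjacent_involution_pos[OF \<sigma>] in \<open>auto simp: c01_rep_eq\<close>)
  have ps: "set ps \<subseteq> hcarrier cone_module \<times> hcarrier cone_module"
    unfolding ps_def using in1 in2 by auto
  have ip: "hip cone_module (\<lambda>n. if n = \<sigma> k then star (r k) else 0) z = r k * z (\<sigma> k)" for k z
  proof -
    have 0: "star (0 :: c01) = 0"
      by (rule c01_eqI) (simp add: c01_rep_eq)
    have "hip cone_module (\<lambda>n. if n = \<sigma> k then star (r k) else 0) z
        = (\<Sum>n\<in>{\<sigma> k}. star (if n = \<sigma> k then star (r k) else 0) * z n)"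
      unfolding cone_module_simps by (rule suminf_finite) (auto simp: 0)
    then show ?thesis
      by (simp add: star_star)
  qed
  have fr: "finite_rank cone_module ps z n = (if n < N then wperm m \<sigma> z n else 0)" for z n
  proof -
    have "finite_rank cone_module ps z n = (\<Sum>k<N. (if n = k then s k else 0) * (r k * z (\<sigma> k)))"
      unfolding finite_rank_def lincomb_cone ps_def
      by (simp only: map_map o_def split_beta fst_conv snd_conv ip interv_sum_list_conv_sum_set_nat
          set_upt atLeast0LessThan)
    also have "\<dots> = (\<Sum>k<N. if n = k then s k * (r k * z (\<sigma> k)) else 0)"
      by (intro sum.cong) auto
    also have "\<dots> = (if n < N then wperm m \<sigma> z n else 0)"
      by (simp add: wperm_def m mult.assoc)
    finally show ?thesis .
  qed
  have "hnorm cone_module (hsub cone_module (wperm m \<sigma> z) (finite_rank cone_module ps z))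
      \<le> e * hnorm cone_module z"
    if z: "z \<in> hcarrier cone_module" for z
  proof (rule cone_norm_le)
    define m' where "m' n = (if n < N then 0 else m n)" for n
    have D: "hsub cone_module (wperm m \<sigma> z) (finite_rank cone_module ps z) = wperm m' \<sigma> z"
      by (auto simp: fr fun_eq_iff wperm_def m'_def)
    have m'e: "norm (m' n) \<le> e" for n
      using N[of n] e by (auto simp: m'_def)
    show c: "hsub cone_module (wperm m \<sigma> z) (finite_rank cone_module ps z) \<in> hcarrier cone_module"
      unfolding D by (rule wperm_closed[OF \<sigma> m'e z])
    show "0 \<le> e * hnorm cone_module z"
      using e by (simp add: hnorm_def)
    fix t :: real
    assume t: "t \<in> {0..1}"
    note S = adjacent_involution_suminf[OF \<sigma> sums_summable[OF cone_sq_sums[OF z, of t]]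
        zero_le_power2]
    have "(\<Sum>n. (cmod (c01_apply (wperm m' \<sigma> z n) t))\<^sup>2)
        \<le> (\<Sum>n. e\<^sup>2 * (cmod (c01_apply (z (\<sigma> n)) t))\<^sup>2)"
    proof (rule suminf_le)
      show "summable (\<lambda>n. e\<^sup>2 * (cmod (c01_apply (z (\<sigma> n)) t))\<^sup>2)"
        by (intro summable_mult sums_summable[OF S])
      show "summable (\<lambda>n. (cmod (c01_apply (wperm m' \<sigma> z n) t))\<^sup>2)"
        using sums_summable[OF cone_sq_sums[OF c, of t]] unfolding D .
      show "(cmod (c01_apply (wperm m' \<sigma> z n) t))\<^sup>2 \<le> e\<^sup>2 * (cmod (c01_apply (z (\<sigma> n)) t))\<^sup>2" for n
      proof -
        have "cmod (c01_apply (m' n) t) \<le> e"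
          using norm_c01_ge[OF t, of "m' n"] m'e[of n] by linarith
        then show ?thesis
          by (simp add: wperm_def c01_rep_eq norm_mult power_mult_distrib mult_right_mono
              power_mono)
      qed
    qed
    also have "\<dots> = e\<^sup>2 * (\<Sum>n. (cmod (c01_apply (z n) t))\<^sup>2)"
      using suminf_mult[OF sums_summable[OF S]] sums_unique[OF S] by simp
    also have "\<dots> \<le> (e * hnorm cone_module z)\<^sup>2"
      using cone_sq_le[OF z t] by (simp add: power_mult_distrib mult_left_mono)
    finally show "(\<Sum>n. (cmod (c01_apply (hsub cone_module (wperm m \<sigma> z) (finite_rank cone_module
        ps z) n) t))\<^sup>2)
        \<le> (e * hnorm cone_module z)\<^sup>2"
      unfolding D .
  qed
  then show "\<exists>ps. set ps \<subseteq> hcarrier cone_module \<times> hcarrier cone_module \<and>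
      (\<forall>z\<in>hcarrier cone_module. hnorm cone_module
          (hsub cone_module (wperm m \<sigma> z) (finite_rank cone_module ps z)) \<le> e * hnorm cone_module
          z)"
    using ps by blast
qed

lemma countably_generated_cone: "countably_generated cone_module"
proof -
  \<comment> \<open>Coordinate 0 is generated by the unit, every other coordinate by 1 - t.\<close>
  define g :: "nat \<Rightarrow> nat \<Rightarrow> c01" where
    "g k n = (if n = k then (if k = 0 then 1 else cone_fun) else 0)" for k n
  have g: "g k \<in> hcarrier cone_module" for k
    by (rule cone_finite_support[of "{k}"]) (auto simp: g_def c01_rep_eq cone_apply)
  have "\<exists>ps. fst ` set ps \<subseteq> range g
      \<and> hnorm cone_module (hsub cone_module x (lincomb cone_module ps)) < e"
    if x: "x \<in> hcarrier cone_module" and e: "e > 0" for x e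
  proof -
    have e2: "e\<^sup>2 / 4 > 0"
      using e by simp
    then obtain N where N: "\<And>n. norm (\<Sum>k = N..<n. star (x k) * x k) < e\<^sup>2 / 4"
      using cone_carrierD(1)[OF x] unfolding summable_Cauchy by (meson le_refl)
    \<comment> \<open>With this bound on each of the first N coordinates their squares add up to at
      most e^2 / 4, as much as is allowed for the tail; N + 1 avoids division by 0.\<close>
    define d where "d = sqrt (e\<^sup>2 / 4 / (real N + 1))"
    have d: "d > 0" "d\<^sup>2 * (real N + 1) = e\<^sup>2 / 4"
    proof -
      have N: "real N + 1 > 0"
        by simp
      show "d > 0"
        using e N by (simp add: d_def)
      have "d\<^sup>2 = e\<^sup>2 / 4 / (real N + 1)"
        unfolding d_def by (rule real_sqrt_pow2) (use N in simp)
      then show "d\<^sup>2 * (real N + 1) = e\<^sup>2 / 4"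
        using N by (metis less_irrefl nonzero_eq_divide_eq)
    qed
    have "\<exists>b. norm (x k - g k k * b) \<le> d" for k
    proof (cases "k = 0")
      case True
      then show ?thesis
        using d by (intro exI[of _ "x k"]) (simp add: g_def)
    next
      case False
      then show ?thesis
        using cone_multiple_dense[OF _ d(1), of "x k"] cone_carrierD(2)[OF x, of k]
        by (metis g_def gr0I)
    qed
    then obtain b where b: "\<And>k. norm (x k - g k k * b k) \<le> d"
      by metis
    define ps where "ps = map (\<lambda>k. (g k, b k)) [0..<N]"
    have lc: "lincomb cone_module ps n = (if n < N then g n n * b n else 0)" for n
    proof -
      have "lincomb cone_module ps n = (\<Sum>k<N. g k n * b k)"
        unfolding lincomb_cone ps_def
        by (simp only: map_map o_def split_beta fst_conv snd_conv interv_sum_list_conv_sum_set_nat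
            set_upt atLeast0LessThan)
      also have "\<dots> = (\<Sum>k<N. if n = k then g n n * b n else 0)"
        by (intro sum.cong) (auto simp: g_def)
      finally show ?thesis
        by simp
    qed
    have lcE: "lincomb cone_module ps \<in> hcarrier cone_module"
      by (rule cone_finite_support[of "{..<N}"]) (auto simp: lc g_def c01_rep_eq cone_apply)
    let ?D = "\<lambda>n. x n - lincomb cone_module ps n"
    note DE = cone_sub_closed[OF x lcE]
    have "hnorm cone_module ?D \<le> sqrt (e\<^sup>2 / 2)"
    proof (rule cone_norm_le[OF DE])
      fix t :: real
      assume t: "t \<in> {0..1}"
      let ?f = "\<lambda>n. (cmod (c01_apply (?D n) t))\<^sup>2"
      have "sum ?f {..<M} \<le> e\<^sup>2 / 2" for M
      proof -
        have "sum ?f {..<M} \<le> sum ?f ({..<N} \<union> {N..<M})"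
          by (rule sum_mono2) auto
        also have "\<dots> = sum ?f {..<N} + sum ?f {N..<M}"
          by (rule sum.union_disjoint) auto
        also have "sum ?f {..<N} \<le> (\<Sum>n<N. d\<^sup>2)"
        proof (rule sum_mono)
          fix n
          assume "n \<in> {..<N}"
          then have "cmod (c01_apply (?D n) t) \<le> d"
            using norm_c01_ge[OF t, of "?D n"] b[of n] by (simp add: lc)
          then show "?f n \<le> d\<^sup>2"
            by (simp add: power_mono)
        qed
        also have "(\<Sum>n<N. d\<^sup>2) \<le> d\<^sup>2 * (real N + 1)"
          by (simp add: algebra_simps)
        also have "\<dots> = e\<^sup>2 / 4"
          by (rule d(2))
        also have "sum ?f {N..<M} = cmod (c01_apply (\<Sum>k = N..<M. star (x k) * x k) t)"
          unfolding c01_apply_sum star_mult_self_apply of_real_sum[symmetric] norm_of_real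
          by (simp add: sum_nonneg lc)
        also have "\<dots> \<le> e\<^sup>2 / 4"
          using N[of M] norm_c01_ge[OF t, of "\<Sum>k = N..<M. star (x k) * x k"] by linarith
        finally show ?thesis
          by simp
      qed
      then have "suminf ?f \<le> e\<^sup>2 / 2"
        by (rule suminf_le_const[OF sums_summable[OF cone_sq_sums[OF DE]]])
      then show "suminf ?f \<le> (sqrt (e\<^sup>2 / 2))\<^sup>2"
        by simp
    qed simp
    also have "\<dots> < e"
      by (rule real_less_lsqrt)
        (use e in auto)
    finally have "hnorm cone_module (hsub cone_module x (lincomb cone_module ps)) < e"
      by simp
    moreover have "fst ` set ps \<subseteq> range g"
      by (auto simp: ps_def)
    ultimately show ?thesis
      by blast
  qed
  then show ?thesis
    unfolding countably_generated_def using g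
    by (intro exI[of _ "range g"]) (auto simp del: cone_module_simps)
qed

section \<open>Orthonormal bases of complex Hilbert modules\<close>

locale complex_hilbert = hilbert_module H for H :: "('v, complex) hmod"
begin

lemma ip_commute: "\<lbrakk>x \<in> hcarrier H; y \<in> hcarrier H\<rbrakk> \<Longrightarrow> cnj (hip H x y) = hip H y x"
  using ip_star unfolding star_complex_def .

lemma sub_closed: "\<lbrakk>x \<in> hcarrier H; y \<in> hcarrier H\<rbrakk> \<Longrightarrow> hsub H x y \<in> hcarrier H"
  unfolding hsub_def by (intro add_closed act_closed)

lemma ip_add_left:
  assumes "x \<in> hcarrier H" "y \<in> hcarrier H" "z \<in> hcarrier H"
  shows "hip H (hadd H x y) z = hip H x z + hip H y z"
  using assms ip_add_right[of z x y] ip_commute[of z "hadd H x y"] ip_commute[of z x] ip_commute[of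
      z y]
  by (simp add: add_closed)

lemma ip_act_left:
  assumes "x \<in> hcarrier H" "y \<in> hcarrier H"
  shows "hip H (hact H x c) y = cnj c * hip H x y"
  using assms ip_act_right[of y x c] ip_commute[of y "hact H x c"] ip_commute[of y x]
  by (simp add: act_closed mult.commute)

lemma ip_sub_right:
  assumes "x \<in> hcarrier H" "y \<in> hcarrier H" "z \<in> hcarrier H"
  shows "hip H x (hsub H y z) = hip H x y - hip H x z"
  using assms by (simp add: hsub_def ip_add_right act_closed ip_act_right)

lemma ip_sub_left:
  assumes "x \<in> hcarrier H" "y \<in> hcarrier H" "z \<in> hcarrier H"
  shows "hip H (hsub H y z) x = hip H y x - hip H z x"
  using assms by (simp add: hsub_def ip_add_left act_closed ip_act_left)

lemma ip_zero_right: "x \<in> hcarrier H \<Longrightarrow> hip H x (hzero H) = 0"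
  using ip_add_right[of x "hzero H" "hzero H"] add_zero[of "hzero H"] zero_closed by simp

lemma act_zero: "x \<in> hcarrier H \<Longrightarrow> hact H x 0 = hzero H"
  by (rule ip_definite) (simp_all add: act_closed ip_act_right)

lemma ip_self: "x \<in> hcarrier H \<Longrightarrow> hip H x x = of_real ((hnorm H x)\<^sup>2)"
proof -
  assume "x \<in> hcarrier H"
  then obtain c where c: "hip H x x = cnj c * c"
    using ip_positive[of x] unfolding positive_elem_def star_complex_def by blast
  then have "hip H x x = of_real ((cmod c)\<^sup>2)"
    by (metis complex_norm_square mult.commute)
  then show ?thesis
    by (simp add: hnorm_def norm_power)
qed

lemma norm_nonneg [simp]: "hnorm H x \<ge> 0"
  by (simp add: hnorm_def)

lemma eqI:
  assumes x: "x \<in> hcarrier H" and y: "y \<in> hcarrier H"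
    and "\<And>z. z \<in> hcarrier H \<Longrightarrow> hip H z x = hip H z y"
  shows "x = y"
proof -
  have "hip H (hsub H x y) (hsub H x y) = 0"
    using assms by (simp add: ip_sub_right sub_closed)
  then have 0: "hadd H x (hact H y (- 1)) = hzero H"
    using ip_definite[OF sub_closed[OF x y]] by (simp add: hsub_def)
  have "hadd H (hact H y (- 1)) y = hact H y (- 1 + 1)"
    using act_add_right[OF y, of "- 1" 1] act_one[OF y] by simp
  then have 1: "hadd H (hact H y (- 1)) y = hzero H"
    by (simp add: act_zero[OF y])
  have "hadd H (hadd H x (hact H y (- 1))) y = x"
    unfolding add_assoc[OF x act_closed[OF y] y] 1 add_zero[OF x] ..
  then show "x = y"
    unfolding 0 using add_commute[OF zero_closed y] add_zero[OF y] by simp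
qed

lemma cauchy_schwarz:
  assumes x: "x \<in> hcarrier H" and y: "y \<in> hcarrier H"
  shows "cmod (hip H x y) \<le> hnorm H x * hnorm H y"
proof (cases "hnorm H x = 0")
  case True
  then have "x = hzero H"
    using ip_definite[OF x] ip_self[OF x] by simp
  then have "hip H x y = 0"
    using ip_zero_right[OF y] ip_commute[OF y x] by simp
  then show ?thesis
    by simp
next
  case False
  let ?n = "(hnorm H x)\<^sup>2"
  define c where "c = hip H x y / of_real ?n"
  have n: "?n > 0"
    using False by simp
  let ?w = "hsub H y (hact H x c)"
  note cl = act_closed[OF x, of c]
  have yx: "hip H y x = cnj (hip H x y)"
    using ip_commute[OF x y] by simp
  have "hip H ?w ?w = hip H y y - hip H y x * c - cnj c * hip H x y + cnj c * (c * hip H x x)"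
    using x y cl sub_closed[OF y cl]
    by (simp add: ip_sub_left ip_sub_right ip_act_right ip_act_left algebra_simps)
  also have "c * hip H x x = hip H x y"
    using n ip_self[OF x] by (simp add: c_def)
  also have "hip H y x * c = of_real ((cmod (hip H x y))\<^sup>2 / ?n)"
    unfolding yx c_def by (simp add: complex_norm_square mult.commute del: of_real_power)
  finally have "of_real ((hnorm H ?w)\<^sup>2)
      = complex_of_real ((hnorm H y)\<^sup>2 - (cmod (hip H x y))\<^sup>2 / ?n)"
    using ip_self[OF y] ip_self[OF sub_closed[OF y cl]] by simp
  then have "(hnorm H ?w)\<^sup>2 = (hnorm H y)\<^sup>2 - (cmod (hip H x y))\<^sup>2 / ?n"
    by (simp only: of_real_eq_iff)
  then have "(cmod (hip H x y))\<^sup>2 / ?n \<le> (hnorm H y)\<^sup>2"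
    by (smt (verit) zero_le_power2)
  then have "(cmod (hip H x y))\<^sup>2 \<le> (hnorm H x * hnorm H y)\<^sup>2"
    using n by (simp add: field_simps power_mult_distrib)
  then show ?thesis
    by (rule power2_le_imp_le) simp
qed

lemma norm_add_le:
  assumes x: "x \<in> hcarrier H" and y: "y \<in> hcarrier H"
  shows "hnorm H (hadd H x y) \<le> hnorm H x + hnorm H y"
proof (rule power2_le_imp_le)
  have "hip H (hadd H x y) (hadd H x y) = hip H x x + hip H y y + (hip H x y + cnj (hip H x y))"
    using x y ip_commute[OF x y] by (simp add: ip_add_left ip_add_right add_closed)
  then have "complex_of_real ((hnorm H (hadd H x y))\<^sup>2)
      = of_real ((hnorm H x)\<^sup>2 + (hnorm H y)\<^sup>2 + 2 * Re (hip H x y))"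
    unfolding ip_self[OF x] ip_self[OF y] ip_self[OF add_closed[OF x y]] complex_add_cnj by simp
  then have "(hnorm H (hadd H x y))\<^sup>2 = (hnorm H x)\<^sup>2 + (hnorm H y)\<^sup>2 + 2 * Re (hip H x y)"
    by (simp only: of_real_eq_iff)
  also have "Re (hip H x y) \<le> hnorm H x * hnorm H y"
    using complex_Re_le_cmod cauchy_schwarz[OF x y] order_trans by blast
  finally show "(hnorm H (hadd H x y))\<^sup>2 \<le> (hnorm H x + hnorm H y)\<^sup>2"
    by (simp add: power2_sum)
qed simp

lemma norm_sub_triangle:
  assumes "x \<in> hcarrier H" "y \<in> hcarrier H" "z \<in> hcarrier H"
  shows "hnorm H (hsub H x z) \<le> hnorm H (hsub H x y) + hnorm H (hsub H y z)"
proof -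
  have "hsub H x z = hadd H (hsub H x y) (hsub H y z)"
    by (rule eqI) (use assms in \<open>simp_all add: sub_closed add_closed ip_add_right ip_sub_right\<close>)
  then show ?thesis
    using norm_add_le[of "hsub H x y" "hsub H y z"] assms by (simp add: sub_closed)
qed

lemma norm_act: "x \<in> hcarrier H \<Longrightarrow> hnorm H (hact H x c) = cmod c * hnorm H x"
  by (simp add: hnorm_def ip_act_left ip_act_right act_closed norm_mult real_sqrt_mult)

lemma norm_sub_commute:
  assumes "x \<in> hcarrier H" "y \<in> hcarrier H"
  shows "hnorm H (hsub H x y) = hnorm H (hsub H y x)"
proof -
  have "hsub H x y = hact H (hsub H y x) (- 1)"
    by (rule eqI) (use assms in \<open>simp_all add: sub_closed act_closed ip_sub_right ip_act_right\<close>)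
  then show ?thesis
    using norm_act[OF sub_closed[OF assms(2,1)], of "- 1"] by simp
qed

lemma ip_tendsto:
  assumes X: "\<And>n. X n \<in> hcarrier H" and x: "x \<in> hcarrier H" and y: "y \<in> hcarrier H"
    and lim: "(\<lambda>n. hnorm H (hsub H (X n) x)) \<longlonglongrightarrow> 0"
  shows "(\<lambda>n. hip H y (X n)) \<longlonglongrightarrow> hip H y x"
proof -
  have "(\<lambda>n. hip H y (X n) - hip H y x) \<longlonglongrightarrow> 0"
  proof (rule Lim_null_comparison)
    show "\<forall>\<^sub>F n in sequentially. norm (hip H y (X n) - hip H y x)
        \<le> hnorm H y * hnorm H (hsub H (X n) x)"
      using cauchy_schwarz[OF y sub_closed[OF X x]] by (simp add: ip_sub_right X x y)
    show "(\<lambda>n. hnorm H y * hnorm H (hsub H (X n) x)) \<longlonglongrightarrow> 0"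
      using tendsto_mult_right_zero[OF lim] .
  qed
  then show ?thesis
    by (rule LIM_zero_cancel)
qed

end

locale orthonormal_basis = complex_hilbert H for H :: "('v, complex) hmod" +
  fixes b :: "nat \<Rightarrow> 'v"
  assumes b_closed: "b n \<in> hcarrier H"
    and b_orthonormal: "hip H (b i) (b j) = (if i = j then 1 else 0)"
    and b_total: "\<lbrakk>x \<in> hcarrier H; \<And>n. hip H (b n) x = 0\<rbrakk> \<Longrightarrow> x = hzero H"
begin

definition coef :: "'v \<Rightarrow> nat \<Rightarrow> complex" where
  "coef x n = hip H (b n) x"

primrec psum :: "(nat \<Rightarrow> complex) \<Rightarrow> nat \<Rightarrow> 'v" where
  "psum a 0 = hzero H"
| "psum a (Suc N) = hadd H (psum a N) (hact H (b N) (a N))"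

lemma psum_closed: "psum a N \<in> hcarrier H"
  by (induction N) (simp_all add: zero_closed add_closed act_closed b_closed)

lemma coef_add: "\<lbrakk>x \<in> hcarrier H; y \<in> hcarrier H\<rbrakk> \<Longrightarrow> coef (hadd H x y) n = coef x n + coef y n"
  by (simp add: coef_def ip_add_right b_closed)

lemma coef_sub: "\<lbrakk>x \<in> hcarrier H; y \<in> hcarrier H\<rbrakk> \<Longrightarrow> coef (hsub H x y) n = coef x n - coef y n"
  by (simp add: coef_def ip_sub_right b_closed)

lemma coef_act: "x \<in> hcarrier H \<Longrightarrow> coef (hact H x c) n = coef x n * c"
  by (simp add: coef_def ip_act_right b_closed)

lemma coef_scale: "x \<in> hcarrier H \<Longrightarrow> coef (hscale H c x) n = c * coef x n"
  by (simp add: hscale_def coef_act scaleC_complex_def)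

lemma coef_zero: "coef (hzero H) n = 0"
  by (simp add: coef_def ip_zero_right b_closed)

lemma coef_b: "coef (b i) n = (if n = i then 1 else 0)"
  by (simp add: coef_def b_orthonormal)

lemma coef_eqI:
  assumes x: "x \<in> hcarrier H" and y: "y \<in> hcarrier H" and eq: "\<And>n. coef x n = coef y n"
  shows "x = y"
proof -
  have "hsub H x y = hzero H"
    by (rule b_total[OF sub_closed[OF x y]]) (use coef_sub[OF x y] eq in \<open>simp add: coef_def\<close>)
  then have "hip H z x - hip H z y = 0" if "z \<in> hcarrier H" for z
    using ip_sub_right[OF that x y] ip_zero_right[OF that] by simp
  then show ?thesis
    by (intro eqI[OF x y]) simp
qed

lemma coef_psum: "coef (psum a N) n = (if n < N then a n else 0)"
proof (induction N)
  case 0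
  then show ?case
    by (simp add: coef_zero)
next
  case (Suc N)
  have "coef (hact H (b N) (a N)) n = (if n = N then a N else 0)"
    using coef_act[OF b_closed, of N "a N" n] coef_b[of N n] by simp
  then show ?case
    using Suc by (simp add: coef_add psum_closed act_closed b_closed less_Suc_eq)
qed

lemma ip_psum: "y \<in> hcarrier H \<Longrightarrow> hip H (psum a N) y = (\<Sum>n<N. cnj (a n) * coef y n)"
proof (induction N)
  case 0
  then show ?case
    using ip_zero_right[of y] ip_commute[of y "hzero H"] zero_closed by simp
next
  case (Suc N)
  then show ?case
    by (simp add: ip_add_left psum_closed act_closed b_closed ip_act_left coef_def)
qed

lemma ip_psum_self: "hip H (psum a N) (psum a N) = of_real (\<Sum>n<N. (cmod (a n))\<^sup>2)"
  unfolding ip_psum[OF psum_closed] of_real_sum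
  by (intro sum.cong) (simp_all add: coef_psum complex_norm_square mult.commute del: of_real_power)

text \<open>Pythagoras for the projection onto the first N basis vectors; Bessel's inequality
  follows because the left side is nonnegative.\<close>

lemma norm_sub_psum:
  assumes x: "x \<in> hcarrier H"
  shows "(hnorm H (hsub H x (psum (coef x) N)))\<^sup>2 = (hnorm H x)\<^sup>2 - (\<Sum>n<N. (cmod (coef x n))\<^sup>2)"
proof -
  let ?p = "psum (coef x) N"
  note p = psum_closed[of "coef x" N]
  have px: "hip H ?p x = of_real (\<Sum>n<N. (cmod (coef x n))\<^sup>2)"
    unfolding ip_psum[OF x] of_real_sum
    by (intro sum.cong) (simp_all add: complex_norm_square mult.commute del: of_real_power)
  have "hip H (hsub H x ?p) (hsub H x ?p) = hip H x x - cnj (hip H ?p x)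
      - (hip H ?p x - hip H ?p ?p)"
    using x p ip_commute[OF p x] by (simp add: ip_sub_left ip_sub_right sub_closed)
  then have "complex_of_real ((hnorm H (hsub H x ?p))\<^sup>2)
      = of_real ((hnorm H x)\<^sup>2 - (\<Sum>n<N. (cmod (coef x n))\<^sup>2))"
    unfolding px ip_psum_self ip_self[OF x] ip_self[OF sub_closed[OF x p]] by simp
  then show ?thesis
    by (simp only: of_real_eq_iff)
qed

lemma coef_square_summable: "x \<in> hcarrier H \<Longrightarrow> summable (\<lambda>n. (cmod (coef x n))\<^sup>2)"
proof (rule summableI_nonneg_bounded[where x = "(hnorm H x)\<^sup>2"])
  assume x: "x \<in> hcarrier H"
  show "(\<Sum>i<n. (cmod (coef x i))\<^sup>2) \<le> (hnorm H x)\<^sup>2" for n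
    using norm_sub_psum[OF x, of n] zero_le_power2[of "hnorm H (hsub H x (psum (coef x) n))"]
        by linarith
qed simp

lemma riesz_fischer:
  assumes a: "summable (\<lambda>n. (cmod (a n))\<^sup>2)"
  obtains x where "x \<in> hcarrier H" "coef x = a" "(\<lambda>N. hnorm H (hsub H (psum a N) x)) \<longlonglongrightarrow> 0"
proof -
  let ?S = "\<lambda>N. \<Sum>n<N. (cmod (a n))\<^sup>2"
  \<comment> \<open>By orthonormality the distance of two partial sums is governed by the scalar
    series alone; the absolute value makes the formula symmetric in M and N.\<close>
  have D: "(hnorm H (hsub H (psum a M) (psum a N)))\<^sup>2 = \<bar>?S M - ?S N\<bar>" for M N
  proof -
    have *: "hip H (psum a M) (psum a N) = of_real (?S (min M N))" for M N
    proof -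
      have "(\<Sum>n<M. cnj (a n) * coef (psum a N) n) = (\<Sum>n<min M N. cnj (a n) * a n)"
        by (rule sum.mono_neutral_cong_right) (auto simp: coef_psum)
      also have "\<dots> = of_real (?S (min M N))"
        unfolding of_real_sum
        by (intro sum.cong) (simp_all add: complex_norm_square mult.commute del: of_real_power)
      finally show ?thesis
        by (simp add: ip_psum psum_closed)
    qed
    have "hip H (hsub H (psum a M) (psum a N)) (hsub H (psum a M) (psum a N))
        = of_real (?S M - ?S (min M N) - (?S (min M N) - ?S N))"
      by (simp add: ip_sub_left ip_sub_right sub_closed psum_closed * min.commute)
    then have "complex_of_real ((hnorm H (hsub H (psum a M) (psum a N)))\<^sup>2)
        = of_real (?S M - ?S (min M N) - (?S (min M N) - ?S N))"
      by (simp only: ip_self[OF sub_closed[OF psum_closed psum_closed]])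
    then have "(hnorm H (hsub H (psum a M) (psum a N)))\<^sup>2 = ?S M - ?S (min M N)
        - (?S (min M N) - ?S N)"
      by (simp only: of_real_eq_iff)
    moreover have "?S (min M N) \<le> ?S (max M N)"
      by (rule sum_mono2) auto
    ultimately show ?thesis
      by (cases "M \<le> N") (auto simp: min_def max_def)
  qed
  have "\<exists>x\<in>hcarrier H. (\<lambda>N. hnorm H (hsub H (psum a N) x)) \<longlonglongrightarrow> 0"
  proof (rule complete)
    fix e :: real
    assume e: "e > 0"
    have "Cauchy ?S"
      using a by (simp add: summable_iff_convergent convergent_Cauchy)
    then obtain K where K: "\<And>m n. m \<ge> K \<Longrightarrow> n \<ge> K \<Longrightarrow> norm (?S m - ?S n) < e\<^sup>2"
      using CauchyD[of ?S "e\<^sup>2"] e by auto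
    have "hnorm H (hsub H (psum a m) (psum a n)) < e" if "m \<ge> K" "n \<ge> K" for m n
      by (rule power2_less_imp_less) (use K[OF that] D[of m n] e in auto)
    then show "\<exists>N. \<forall>m\<ge>N. \<forall>n\<ge>N. hnorm H (hsub H (psum a m) (psum a n)) < e"
      by blast
  qed (rule psum_closed)
  then obtain x where x: "x \<in> hcarrier H" "(\<lambda>N. hnorm H (hsub H (psum a N) x)) \<longlonglongrightarrow> 0"
    by blast
  have "coef x n = a n" for n
  proof (rule LIMSEQ_unique)
    show "(\<lambda>N. hip H (b n) (psum a N)) \<longlonglongrightarrow> coef x n"
      unfolding coef_def by (rule ip_tendsto[OF psum_closed x(1) b_closed x(2)])
    have "\<forall>\<^sub>F N in sequentially. hip H (b n) (psum a N) = a n"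
      using eventually_gt_at_top[of n] by eventually_elim
          (use coef_psum[of a _ n] in \<open>simp add: coef_def\<close>)
    then show "(\<lambda>N. hip H (b n) (psum a N)) \<longlonglongrightarrow> a n"
      by (rule tendsto_eventually)
  qed
  then show ?thesis
    using that x by blast
qed

lemma psum_tendsto:
  assumes x: "x \<in> hcarrier H"
  shows "(\<lambda>N. hnorm H (hsub H (psum (coef x) N) x)) \<longlonglongrightarrow> 0"
proof -
  obtain y where y: "y \<in> hcarrier H" "coef y = coef x" "(\<lambda>N. hnorm H (hsub H (psum (coef x) N) y))
      \<longlonglongrightarrow> 0"
    using riesz_fischer[OF coef_square_summable[OF x]] .
  then show ?thesis
    using coef_eqI[OF y(1) x] by simp
qed

lemma parseval:
  assumes x: "x \<in> hcarrier H" and y: "y \<in> hcarrier H"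
  shows "(\<lambda>n. cnj (coef x n) * coef y n) sums hip H x y"
proof -
  have "(\<lambda>N. cnj (hip H y (psum (coef x) N))) \<longlonglongrightarrow> cnj (hip H y x)"
    by (intro tendsto_cnj ip_tendsto psum_closed x y psum_tendsto)
  then show ?thesis
    using ip_commute[OF y psum_closed] ip_commute[OF y x] ip_psum[OF y] by (simp add: sums_def)
qed

lemma parseval_norm:
  assumes x: "x \<in> hcarrier H"
  shows "(\<lambda>n. (cmod (coef x n))\<^sup>2) sums (hnorm H x)\<^sup>2"
  using sums_Re[OF parseval[OF x x]] ip_self[OF x]
  by (simp only: mult.commute[of "cnj _"] complex_norm_square[symmetric] Re_complex_of_real)

definition vec :: "(nat \<Rightarrow> complex) \<Rightarrow> 'v" where
  "vec a = (SOME x. x \<in> hcarrier H \<and> coef x = a)"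

lemma vec:
  assumes "summable (\<lambda>n. (cmod (a n))\<^sup>2)"
  shows "vec a \<in> hcarrier H" "coef (vec a) = a"
proof -
  have "vec a \<in> hcarrier H \<and> coef (vec a) = a"
    unfolding vec_def by (rule someI_ex) (metis riesz_fischer[OF assms])
  then show "vec a \<in> hcarrier H" "coef (vec a) = a"
    by auto
qed

end

section \<open>Push-forward along evaluations\<close>

context complex_hilbert
begin

lemma eqI_left:
  assumes x: "x \<in> hcarrier H" and y: "y \<in> hcarrier H"
    and eq: "\<And>z. z \<in> hcarrier H \<Longrightarrow> hip H x z = hip H y z"
  shows "x = y"
proof (rule eqI[OF x y])
  show "hip H z x = hip H z y" if "z \<in> hcarrier H" for z
    using ip_commute[OF x that] ip_commute[OF y that] eq[OF that] by simp
qed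

lemma adjointable_act:
  assumes "adjoint_pair H A G" "x \<in> hcarrier H"
  shows "A (hact H x c) = hact H (A x) c"
proof (rule eqI_left)
  have A: "A v \<in> hcarrier H" "G v \<in> hcarrier H" if "v \<in> hcarrier H" for v
    using assms(1) that by (auto simp: adjoint_pair_def)
  show "A (hact H x c) \<in> hcarrier H" "hact H (A x) c \<in> hcarrier H"
    using A assms by (simp_all add: act_closed)
  have "hip H (A v) z = hip H v (G z)" if "v \<in> hcarrier H" "z \<in> hcarrier H" for v z
    using assms(1) that by (auto simp: adjoint_pair_def)
  then show "hip H (A (hact H x c)) z = hip H (hact H (A x) c) z" if "z \<in> hcarrier H" for z
    using assms A that by (simp add: act_closed ip_act_left)
qed

lemma adjointable_scale:
  "\<lbrakk>adjoint_pair H A G; x \<in> hcarrier H\<rbrakk> \<Longrightarrow> A (hscale H c x) = hscale H c (A x)"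
  unfolding hscale_def by (rule adjointable_act)

lemma scale_closed: "x \<in> hcarrier H \<Longrightarrow> hscale H c x \<in> hcarrier H"
  by (simp add: hscale_def act_closed)

lemma even_representation_scale:
  assumes "grading_operator H \<gamma>"
  shows "even_representation H (hscale H) \<gamma>"
  unfolding even_representation_def adjoint_pair_def
proof (intro conjI allI ballI)
  fix a b x
  assume x: "x \<in> hcarrier H"
  show "hscale H (a + b) x = hadd H (hscale H a x) (hscale H b x)"
    using x by (simp add: hscale_def scaleC_complex_def act_add_right)
  show "hscale H (a * b) x = hscale H a (hscale H b x)"
    using x act_mult[of x b a] by (simp add: hscale_def scaleC_complex_def mult.commute)
  show "hscale H (a * b) x = hscale H a (hscale H b x)" by fact
  show "hscale H a (\<gamma> x) = \<gamma> (hscale H a x)"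
    using adjointable_scale[of \<gamma> \<gamma> x a] assms x by (simp add: grading_operator_def)
qed (auto simp: act_closed ip_act_left ip_act_right hscale_def scaleC_complex_def)

end

text \<open>\<open>evaluates_to\<close> asks for dense range only. The lift without increase of the
  norm makes \<open>u\<close> surjective and lets operator estimates pass to the fibre: an
  inequality for the lift becomes the same inequality for the vector.\<close>

locale evaluation_map = complex_hilbert H for H :: "('v, complex) hmod" +
  fixes t :: real and u :: "(nat \<Rightarrow> c01) \<Rightarrow> 'v"
  assumes t: "t \<in> {0..1}"
    and u_closed: "x \<in> hcarrier cone_module \<Longrightarrow> u x \<in> hcarrier H"
    and u_add: "\<lbrakk>x \<in> hcarrier cone_module; y \<in> hcarrier cone_module\<rbrakk> \<Longrightarrow> u (hadd cone_module x y)
        = hadd H (u x) (u y)"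
    and u_act: "x \<in> hcarrier cone_module \<Longrightarrow> u (hact cone_module x c) = hact H (u x) (c01_apply c t)"
    and u_ip: "\<lbrakk>x \<in> hcarrier cone_module; y \<in> hcarrier cone_module\<rbrakk> \<Longrightarrow> hip H (u x) (u y)
        = c01_apply (hip cone_module x y) t"
    and u_lift: "h \<in> hcarrier H \<Longrightarrow> \<exists>x\<in>hcarrier cone_module. u x = h \<and> hnorm cone_module x
        \<le> hnorm H h"
begin

interpretation E: hilbert_module cone_module
  by (rule hilbert_module_cone)

lemma u_sub: "\<lbrakk>x \<in> hcarrier cone_module; y \<in> hcarrier cone_module\<rbrakk> \<Longrightarrow> u (hsub cone_module x y)
  = hsub H (u x) (u y)"
  unfolding hsub_def[of cone_module] hsub_def[of H]
  using u_add[OF _ E.act_closed] u_act[of y "- 1"] t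
  by (simp add: c01_rep_eq del: cone_module_simps)

lemma u_scale: "x \<in> hcarrier cone_module \<Longrightarrow> u (hscale cone_module c x) = hscale H c (u x)"
  unfolding hscale_def[of cone_module] hscale_def[of H]
  using u_act[of x "scaleC c 1"] t c01_apply_scaleC_1[of t c]
  by (simp add: scaleC_complex_def del: cone_module_simps)

lemma u_zero: "u (hzero cone_module) = hzero H"
  using u_act[OF E.zero_closed, of 0] act_zero[OF u_closed[OF E.zero_closed]]
  by (simp add: c01_rep_eq)

lemma norm_u_le: "x \<in> hcarrier cone_module \<Longrightarrow> hnorm H (u x) \<le> hnorm cone_module x"
  unfolding hnorm_def by (simp add: u_ip norm_c01_ge[OF t] del: cone_module_simps)

lemma E_lincomb_closed: "fst ` set qs \<subseteq> hcarrier cone_module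
  \<Longrightarrow> lincomb cone_module qs \<in> hcarrier cone_module"
  unfolding lincomb_def
  by (induction qs) (auto simp: E.zero_closed E.add_closed E.act_closed simp del: cone_module_simps)

lemma u_lincomb:
  "fst ` set qs \<subseteq> hcarrier cone_module \<Longrightarrow> u (lincomb cone_module qs)
      = lincomb H (map (\<lambda>(x, c). (u x, c01_apply c t)) qs)"
proof (induction qs)
  case Nil
  then show ?case
    by (simp add: lincomb_def u_zero del: cone_module_simps)
next
  case (Cons q qs)
  obtain x c where q: "q = (x, c)"
    by (cases q)
  have "lincomb cone_module (q # qs)
      = hadd cone_module (hact cone_module x c) (lincomb cone_module qs)"
    by (simp add: lincomb_def q)
  then show ?case
    using Cons E_lincomb_closed[of qs]
    by (simp add: q u_add E.act_closed u_act del: cone_module_simps) (simp add: lincomb_def)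
qed

lemma u_finite_rank:
  assumes ps: "set ps \<subseteq> hcarrier cone_module \<times> hcarrier cone_module"
      and z: "z \<in> hcarrier cone_module"
  shows "finite_rank cone_module ps z \<in> hcarrier cone_module"
    and "u (finite_rank cone_module ps z) = finite_rank H (map (\<lambda>(x, y). (u x, u y)) ps) (u z)"
proof -
  let ?qs = "map (\<lambda>(x, y). (x, hip cone_module y z)) ps"
  have qs: "fst ` set ?qs \<subseteq> hcarrier cone_module"
    using ps by auto
  show "finite_rank cone_module ps z \<in> hcarrier cone_module"
    unfolding finite_rank_def by (rule E_lincomb_closed[OF qs])
  have eq: "map (\<lambda>(x, c). (u x, c01_apply c t)) ?qs
      = map (\<lambda>(x, y). (x, hip H y (u z))) (map (\<lambda>(x, y). (u x, u y)) ps)"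
    using ps z by (auto simp: u_ip simp del: cone_module_simps)
  show "u (finite_rank cone_module ps z) = finite_rank H (map (\<lambda>(x, y). (u x, u y)) ps) (u z)"
    unfolding finite_rank_def u_lincomb[OF qs] eq ..
qed

lemma push_closed:
  assumes "A \<in> hcarrier cone_module \<rightarrow> hcarrier cone_module" "\<And>x. x \<in> hcarrier cone_module \<Longrightarrow> u (A x)
      = A' (u x)"
  shows "A' \<in> hcarrier H \<rightarrow> hcarrier H"
proof
  fix h
  assume "h \<in> hcarrier H"
  then obtain x where x: "x \<in> hcarrier cone_module" "u x = h"
    using u_lift by blast
  then show "A' h \<in> hcarrier H"
    using assms(1) assms(2)[OF x(1)] u_closed[of "A x"] by auto
qed

lemma push_adjoint:
  assumes AG: "adjoint_pair cone_module A G"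
    and A: "\<And>x. x \<in> hcarrier cone_module \<Longrightarrow> u (A x) = A' (u x)"
    and G: "\<And>x. x \<in> hcarrier cone_module \<Longrightarrow> u (G x) = G' (u x)"
  shows "adjoint_pair H A' G'"
proof -
  have c: "A \<in> hcarrier cone_module \<rightarrow> hcarrier cone_module"
      "G \<in> hcarrier cone_module \<rightarrow> hcarrier cone_module"
    using AG by (simp_all add: adjoint_pair_def)
  have "hip H (A' h) k = hip H h (G' k)" if h: "h \<in> hcarrier H" and k: "k \<in> hcarrier H" for h k
  proof -
    obtain x y where x: "x \<in> hcarrier cone_module" "u x = h"
        and y: "y \<in> hcarrier cone_module" "u y = k"
      using u_lift[OF h] u_lift[OF k] by blast
    have cl: "A x \<in> hcarrier cone_module" "G y \<in> hcarrier cone_module"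
      using c x y by auto
    have "hip cone_module (A x) y = hip cone_module x (G y)"
      using AG x(1) y(1) unfolding adjoint_pair_def by blast
    then have "hip H (u (A x)) (u y) = hip H (u x) (u (G y))"
      unfolding u_ip[OF cl(1) y(1)] u_ip[OF x(1) cl(2)] by simp
    then show ?thesis
      using A[OF x(1)] G[OF y(1)] x y by simp
  qed
  then show ?thesis
    unfolding adjoint_pair_def using push_closed[OF c(1) A] push_closed[OF c(2) G] by blast
qed

text \<open>The adjoint of \<open>K'\<close> lifts a vector by a choice \<open>l\<close>, applies
  the adjoint upstairs and maps down again. The norm estimate uses a lift of norm at most
  \<open>hnorm H h\<close>, so that the constant \<open>e\<close> does not deteriorate.\<close>

lemma push_compact:
  assumes K: "compact_operator cone_module K"
      and K': "\<And>x. x \<in> hcarrier cone_module \<Longrightarrow> u (K x) = K' (u x)"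
  shows "compact_operator H K'"
  unfolding compact_operator_def
proof (intro conjI allI impI)
  obtain G where G: "adjoint_pair cone_module K G"
    using K unfolding compact_operator_def adjointable_def by blast
  have c: "K \<in> hcarrier cone_module \<rightarrow> hcarrier cone_module"
      "G \<in> hcarrier cone_module \<rightarrow> hcarrier cone_module"
    using G by (simp_all add: adjoint_pair_def)
  have "\<exists>l. \<forall>h\<in>hcarrier H. l h \<in> hcarrier cone_module \<and> u (l h) = h"
    by (rule bchoice) (use u_lift in blast)
  then obtain l where l: "\<And>h. h \<in> hcarrier H \<Longrightarrow> l h \<in> hcarrier cone_module" "\<And>h. h \<in> hcarrier H
      \<Longrightarrow> u (l h) = h"
    by blast
  have "hip H (K' h) k = hip H h (u (G (l k)))" if h: "h \<in> hcarrier H" and k: "k \<in> hcarrier H"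
      for h k
  proof -
    have cl: "K (l h) \<in> hcarrier cone_module" "G (l k) \<in> hcarrier cone_module"
      using c l(1) h k by auto
    have "hip cone_module (K (l h)) (l k) = hip cone_module (l h) (G (l k))"
      using G l(1)[OF h] l(1)[OF k] unfolding adjoint_pair_def by blast
    then have "hip H (u (K (l h))) (u (l k)) = hip H (u (l h)) (u (G (l k)))"
      unfolding u_ip[OF cl(1) l(1)[OF k]] u_ip[OF l(1)[OF h] cl(2)] by simp
    then show ?thesis
      using K'[OF l(1)[OF h]] l(2) h k by simp
  qed
  moreover have "(\<lambda>h. u (G (l h))) \<in> hcarrier H \<rightarrow> hcarrier H"
    using c l(1) u_closed by auto
  ultimately show "adjointable H K'"
    unfolding adjointable_def adjoint_pair_def using push_closed[OF c(1) K'] by blast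
  fix e :: real
  assume e: "e > 0"
  obtain ps where ps: "set ps \<subseteq> hcarrier cone_module \<times> hcarrier cone_module"
    and le: "\<And>z. z \<in> hcarrier cone_module
        \<Longrightarrow> hnorm cone_module
        (hsub cone_module (K z) (finite_rank cone_module ps z)) \<le> e * hnorm cone_module z"
    using K e unfolding compact_operator_def by blast
  let ?qs = "map (\<lambda>(x, y). (u x, u y)) ps"
  have "hnorm H (hsub H (K' h) (finite_rank H ?qs h)) \<le> e * hnorm H h" if h: "h \<in> hcarrier H" for h
  proof -
    obtain z where z: "z \<in> hcarrier cone_module" "u z = h" "hnorm cone_module z \<le> hnorm H h"
      using u_lift[OF h] by blast
    note fr = u_finite_rank[OF ps z(1)]
    have Kz: "K z \<in> hcarrier cone_module"
      using c z by auto
    have "hsub H (K' h) (finite_rank H ?qs h)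
        = u (hsub cone_module (K z) (finite_rank cone_module ps z))"
      unfolding u_sub[OF Kz fr(1)] K'[OF z(1)] fr(2) z(2) ..
    also have "hnorm H \<dots>
        \<le> hnorm cone_module (hsub cone_module (K z) (finite_rank cone_module ps z))"
      by (rule norm_u_le) (use cone_sub_closed[OF Kz fr(1)] in simp)
    also have "\<dots> \<le> e * hnorm cone_module z"
      by (rule le[OF z(1)])
    also have "\<dots> \<le> e * hnorm H h"
      using z(3) e by simp
    finally show ?thesis .
  qed
  moreover have "set ?qs \<subseteq> hcarrier H \<times> hcarrier H"
    using ps u_closed by auto
  ultimately show "\<exists>ps. set ps \<subseteq> hcarrier H \<times> hcarrier H \<and>
      (\<forall>z\<in>hcarrier H. hnorm H (hsub H (K' z) (finite_rank H ps z)) \<le> e * hnorm H z)"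
    by blast
qed

lemma countably_generated: "countably_generated H"
proof -
  obtain S where S: "S \<subseteq> hcarrier cone_module" "countable S"
    and gen: "\<And>x e. x \<in> hcarrier cone_module \<Longrightarrow> e > 0 \<Longrightarrow>
      \<exists>ps. fst ` set ps \<subseteq> S \<and> hnorm cone_module (hsub cone_module x (lincomb cone_module ps)) < e"
    using countably_generated_cone unfolding countably_generated_def by metis
  have "\<exists>qs. fst ` set qs \<subseteq> u ` S \<and> hnorm H (hsub H h (lincomb H qs)) < e"
    if h: "h \<in> hcarrier H" and e: "e > 0" for h e
  proof -
    obtain x where x: "x \<in> hcarrier cone_module" "u x = h"
      using u_lift[OF h] by blast
    obtain ps where ps: "fst ` set ps \<subseteq> S"
        "hnorm cone_module (hsub cone_module x (lincomb cone_module ps)) < e"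
      using gen[OF x(1) e] by blast
    have psE: "fst ` set ps \<subseteq> hcarrier cone_module"
      using ps(1) S(1) by blast
    let ?qs = "map (\<lambda>(x, c). (u x, c01_apply c t)) ps"
    have "hsub H h (lincomb H ?qs) = u (hsub cone_module x (lincomb cone_module ps))"
      unfolding u_sub[OF x(1) E_lincomb_closed[OF psE]] u_lincomb[OF psE] x(2) ..
    moreover have "hnorm H (u (hsub cone_module x (lincomb cone_module ps)))
        \<le> hnorm cone_module (hsub cone_module x (lincomb cone_module ps))"
      by (rule norm_u_le) (use cone_sub_closed[OF x(1) E_lincomb_closed[OF psE]] in simp)
    ultimately have "hnorm H (hsub H h (lincomb H ?qs)) < e"
      using ps(2) by simp
    moreover have "fst ` set ?qs \<subseteq> u ` S"
      using ps(1) by force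
    ultimately show ?thesis
      by blast
  qed
  then show ?thesis
    unfolding countably_generated_def using S u_closed
    by (intro exI[of _ "u ` S"]) blast
qed

lemma push_grading:
  assumes "grading_operator cone_module \<gamma>" "\<And>x. x \<in> hcarrier cone_module \<Longrightarrow> u (\<gamma> x) = \<gamma>' (u x)"
  shows "grading_operator H \<gamma>'"
proof -
  have \<gamma>: "adjoint_pair cone_module \<gamma> \<gamma>" "\<And>x. x \<in> hcarrier cone_module \<Longrightarrow> \<gamma> (\<gamma> x) = x"
    using assms(1) by (auto simp: grading_operator_def)
  have "\<gamma>' (\<gamma>' h) = h" if h: "h \<in> hcarrier H" for h
  proof -
    obtain x where x: "x \<in> hcarrier cone_module" "u x = h"
      using u_lift[OF h] by blast
    have "\<gamma> x \<in> hcarrier cone_module"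
      using \<gamma>(1) x by (auto simp: adjoint_pair_def)
    then show ?thesis
      using assms(2)[of "\<gamma> x"] assms(2)[OF x(1)] \<gamma>(2)[OF x(1)] x by simp
  qed
  then show ?thesis
    unfolding grading_operator_def using push_adjoint[OF \<gamma>(1) assms(2) assms(2)] by blast
qed

lemma evaluates_to_push:
  assumes "\<And>x. x \<in> hcarrier cone_module \<Longrightarrow> u (F x) = F' (u x)" "\<And>x. x \<in> hcarrier cone_module
      \<Longrightarrow> u (\<gamma> x) = \<gamma>' (u x)"
  shows "evaluates_to t \<lparr>cmod_of = cone_module, crep = hscale cone_module, cop = F, cgrad = \<gamma>\<rparr>
    \<lparr>cmod_of = H, crep = hscale H, cop = F', cgrad = \<gamma>'\<rparr>"
proof -
  have "\<exists>x\<in>hcarrier cone_module. hnorm H (hsub H h (u x)) < e" if h: "h \<in> hcarrier H"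
      and e: "e > 0" for h e
  proof -
    have "hip H (hsub H h h) (hsub H h h) = 0"
      using h by (simp add: ip_sub_left sub_closed)
    then have "hnorm H (hsub H h h) < e"
      using e by (simp add: hnorm_def)
    then show ?thesis
      using u_lift[OF h] by metis
  qed
  then show ?thesis
    unfolding evaluates_to_def Let_def
    by (intro exI[of _ u])
      (auto simp: u_closed u_add u_act u_ip u_scale assms simp del: cone_module_simps)
qed

text \<open>Every cycle condition descends along \<open>u\<close>, which serves for both end points
  of the homotopy. Self-adjointness of \<open>F\<close> makes \<open>F'\<close> its own adjoint and
  reduces the last compactness condition to the zero operator.\<close>

lemma kasparov_cycle_push:
  assumes cyc: "kasparov_cycle \<lparr>cmod_of = cone_module, crep = hscale cone_module, cop = F, cgrad
      = \<gamma>\<rparr>"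
    and FF: "adjoint_pair cone_module F F"
    and F: "\<And>x. x \<in> hcarrier cone_module \<Longrightarrow> u (F x) = F' (u x)"
    and G: "\<And>x. x \<in> hcarrier cone_module \<Longrightarrow> u (\<gamma> x) = \<gamma>' (u x)"
  shows "kasparov_cycle \<lparr>cmod_of = H, crep = hscale H, cop = F', cgrad = \<gamma>'\<rparr>"
proof -
  have \<gamma>: "grading_operator cone_module \<gamma>"
    and odd: "\<And>x. x \<in> hcarrier cone_module \<Longrightarrow> F (\<gamma> x) = hscale cone_module (- 1) (\<gamma> (F x))"
    and 1: "\<And>a. compact_operator cone_module (\<lambda>x. hsub cone_module (F (hscale cone_module a x))
        (hscale cone_module a (F x)))"
    and 2: "\<And>a. compact_operator cone_module (\<lambda>x. hsub cone_module (F (F (hscale cone_module a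
        x))) (hscale cone_module a x))"
    using cyc unfolding kasparov_cycle_def Let_def by (simp_all del: cone_module_simps)
  have Fc: "F x \<in> hcarrier cone_module" and \<gamma>c: "\<gamma> x \<in> hcarrier cone_module"
      if "x \<in> hcarrier cone_module" for x
    using FF \<gamma> that by (auto simp: adjoint_pair_def grading_operator_def)
  have sc: "hscale cone_module a x \<in> hcarrier cone_module" if "x \<in> hcarrier cone_module" for a x
    unfolding hscale_def by (rule E.act_closed[OF that])
  note FF' = push_adjoint[OF FF F F]
  note \<gamma>' = push_grading[OF \<gamma> G]
  have "F' (\<gamma>' h) = hscale H (- 1) (\<gamma>' (F' h))" if h: "h \<in> hcarrier H" for h
  proof -
    obtain x where x: "x \<in> hcarrier cone_module" "u x = h"
      using u_lift[OF h] by blast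
    show ?thesis
      using odd[OF x(1)] F[OF \<gamma>c[OF x(1)]] G[OF Fc[OF x(1)]] F[OF x(1)] G[OF x(1)]
        u_scale[OF \<gamma>c[OF Fc[OF x(1)]], of "- 1"] x(2) by simp
  qed
  moreover have "compact_operator H (\<lambda>h. hsub H (F' (hscale H a h)) (hscale H a (F' h)))" for a
    by (rule push_compact[OF 1[of a]])
      (simp add: u_sub F Fc sc u_scale del: cone_module_simps)
  moreover have "compact_operator H (\<lambda>h. hsub H (F' (F' (hscale H a h))) (hscale H a h))" for a
    by (rule push_compact[OF 2[of a]])
      (simp add: u_sub F Fc sc u_scale del: cone_module_simps)
  moreover have "compact_operator H (\<lambda>h. hsub H (F' (hscale H a h)) (F' (hscale H a h)))" for a
  proof (rule push_compact[OF compact_operator_cong])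
    \<comment> \<open>Zero is the weighted permutation with weight 0, to which the general
      compactness lemma applies.\<close>
    show "compact_operator cone_module (wperm (\<lambda>_. 0) (\<lambda>n. n))"
      by (rule wperm_compact[where s = "\<lambda>_. 0" and r = "\<lambda>_. 0"])
          (simp_all add: adjacent_involution_id c01_rep_eq)
    show "hsub cone_module (F (hscale cone_module a x)) (F (hscale cone_module a x))
        = wperm (\<lambda>_. 0) (\<lambda>n. n) x" for x
      by (simp add: wperm_def)
    show "u (hsub cone_module (F (hscale cone_module a x)) (F (hscale cone_module a x)))
        = hsub H (F' (hscale H a (u x))) (F' (hscale H a (u x)))"
      if "x \<in> hcarrier cone_module" for x
      using that by (simp add: u_sub F Fc sc u_scale del: cone_module_simps)
  qed
  ultimately show ?thesis
    unfolding kasparov_cycle_def Let_def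
    using FF' \<gamma>' even_representation_scale[OF \<gamma>'] countably_generated hilbert_module_axioms by auto
qed

end

section \<open>Diagonal operators with a one-dimensional even kernel\<close>

lemma cone_norm_le_1: "norm cone_fun \<le> 1"
  by (rule norm_c01_le) (simp add: cone_apply del: of_real_diff)

lemma norm_scaleC_1: "norm (scaleC c (1 :: 'a :: cstar_algebra)) = cmod c"
  by (simp add: norm_scaleC)

text \<open>\<open>T\<close> is given by its matrix in the basis: \<open>lam\<close> holds the
  singular values, \<open>sg\<close> the parities and \<open>\<sigma>\<close> the exchange of
  parities. A zero of \<open>lam\<close> at a positive index comes with one of opposite parity, so
  only index 0 contributes to the Fredholm index.\<close>

locale diagonal_operator = orthonormal_basis H b for H :: "('v, complex) hmod" and b +
  fixes \<sigma> :: "nat \<Rightarrow> nat" and lam :: "nat \<Rightarrow> real" and sg :: "nat \<Rightarrow> real" and \<gamma> :: "'v \<Rightarrow> 'v"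
    and T :: "('v \<times> 'v) set"
  assumes \<sigma>: "adjacent_involution \<sigma>"
    and lam_nonneg: "lam n \<ge> 0" and lam_0: "lam 0 = 0" and lam_\<sigma>: "lam (\<sigma> n) = lam n"
    and lam_at_top: "filterlim lam at_top sequentially"
    and sg_cases: "sg n = 1 \<or> sg n = - 1" and sg_0: "sg 0 = 1" and sg_\<sigma>: "n > 0 \<Longrightarrow> sg (\<sigma> n) = - sg n"
    and \<gamma>_closed: "x \<in> hcarrier H \<Longrightarrow> \<gamma> x \<in> hcarrier H"
    and coef_\<gamma>: "x \<in> hcarrier H \<Longrightarrow> coef (\<gamma> x) n = sg n * coef x n"
    and T: "T = {(x, y) \<in> hcarrier H \<times> hcarrier H. \<forall>n. coef y n = lam n * coef x (\<sigma> n)}"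
begin

section \<open>Eigenvalues of the resolvent \<open>(1 + T^2)^(-1)\<close> and weights of the bounded
  transform\<close>

definition res_coef :: "nat \<Rightarrow> real" where "res_coef n = 1 / (1 + (lam n)\<^sup>2)"

definition bt_coef :: "nat \<Rightarrow> real" where "bt_coef n = lam n / sqrt (1 + (lam n)\<^sup>2)"

lemma one_plus_pos: "1 + (lam n)\<^sup>2 > 0"
  by (simp add: add_pos_nonneg)

lemma res_coef_bounds: "0 < res_coef n" "res_coef n \<le> 1"
  unfolding res_coef_def using one_plus_pos[of n] by (simp_all add: divide_le_eq)

lemma res_coef_\<sigma>: "res_coef (\<sigma> n) = res_coef n"
  by (simp add: res_coef_def lam_\<sigma>)

lemma bt_coef_\<sigma>: "bt_coef (\<sigma> n) = bt_coef n"
  by (simp add: bt_coef_def lam_\<sigma>)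

lemma bt_coef_0: "bt_coef 0 = 0"
  by (simp add: bt_coef_def lam_0)

lemma bt_coef_sq: "1 - (bt_coef n)\<^sup>2 = res_coef n"
  unfolding bt_coef_def res_coef_def power_divide using one_plus_pos[of n] by
      (simp add: field_simps)

text \<open>The third bound feeds the homotopy, whose defect is proportional to
  \<open>1 - bt_coef n\<close>; it follows from b^2 \<le> b for b in [0, 1] together with
  \<open>bt_coef_sq\<close>.\<close>

lemma bt_coef_bounds: "0 \<le> bt_coef n" "bt_coef n \<le> 1" "1 - bt_coef n \<le> res_coef n"
proof -
  show 0: "0 \<le> bt_coef n"
    unfolding bt_coef_def using lam_nonneg one_plus_pos[of n] by simp
  have "(bt_coef n)\<^sup>2 \<le> 1"
    using bt_coef_sq[of n] res_coef_bounds[of n] by linarith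
  then show 1: "bt_coef n \<le> 1"
    by (simp add: power_le_one_iff 0 abs_square_le_1)
  have "(bt_coef n)\<^sup>2 \<le> bt_coef n"
    using 0 1 by (simp add: power2_eq_square mult_left_le)
  then show "1 - bt_coef n \<le> res_coef n"
    using bt_coef_sq[of n] by linarith
qed

lemma res_coef_tendsto: "res_coef \<longlonglongrightarrow> 0"
proof -
  have "filterlim (\<lambda>n. 1 + (lam n)\<^sup>2) at_top sequentially"
  proof (rule filterlim_at_top_mono[OF lam_at_top always_eventually], rule allI)
    show "lam n \<le> 1 + (lam n)\<^sup>2" for n
      using sum_squares_bound[of "lam n" 1] lam_nonneg[of n] by (simp only: power_one mult_1_right)
  qed
  then show ?thesis
    unfolding res_coef_def[abs_def] by
        (intro tendsto_divide_0[OF tendsto_const] filterlim_at_top_imp_at_infinity)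
qed

definition u0 :: "(nat \<Rightarrow> c01) \<Rightarrow> 'v" where
  "u0 x = vec (\<lambda>n. c01_apply (x n) 0)"

lemma u0:
  assumes "x \<in> hcarrier cone_module"
  shows u0_closed: "u0 x \<in> hcarrier H" and coef_u0: "coef (u0 x) n = c01_apply (x n) 0"
  using vec[OF sums_summable[OF cone_sq_sums[OF assms, of 0]]] by (simp_all add: u0_def)

lemma u0_lift:
  assumes h: "h \<in> hcarrier H"
  shows "\<exists>x\<in>hcarrier cone_module. u0 x = h \<and> hnorm cone_module x \<le> hnorm H h"
proof -
  \<comment> \<open>The factor 1 - t gives one formula for all indices: it meets the boundary
    condition at 1, has the right value at 0 and does not increase the modulus.\<close>
  define x where "x n = scaleC (coef h n) cone_fun" for n
  have x: "c01_apply (x n) t = coef h n * (1 - t)" if "t \<in> {0..1}" for n t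
    using that by (simp add: x_def c01_rep_eq cone_apply)
  have le: "(cmod (c01_apply (x n) t))\<^sup>2 \<le> (cmod (coef h n))\<^sup>2" if t: "t \<in> {0..1}" for n t
  proof -
    have "cmod (1 - complex_of_real t) = 1 - t"
      using t by (metis abs_of_nonneg atLeastAtMost_iff diff_ge_0_iff_ge norm_of_real of_real_1
          of_real_diff)
    then have "cmod (c01_apply (x n) t) \<le> cmod (coef h n)"
      unfolding x[OF t] norm_mult using t by (simp add: mult_left_le)
    then show ?thesis
      by (simp add: power_mono)
  qed
  have xE: "x \<in> hcarrier cone_module"
  proof (rule cone_carrierI)
    show "summable (\<lambda>n. (cmod (coef h n))\<^sup>2 *\<^sub>R (1 :: c01))"
      by (rule bounded_linear.summable[OF bounded_linear_scaleR_left coef_square_summable[OF h]])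
    show "(cmod (c01_apply (x n) t))\<^sup>2 \<le> Re (c01_apply ((cmod (coef h n))\<^sup>2 *\<^sub>R 1) t)"
        if "t \<in> {0..1}" for n t
      using le[OF that] that by (simp add: c01_rep_eq)
  qed (simp add: x)
  have "u0 x = h"
    by (rule coef_eqI[OF u0_closed[OF xE] h]) (simp add: coef_u0[OF xE] x)
  moreover have "hnorm cone_module x \<le> hnorm H h"
  proof (rule cone_norm_le[OF xE norm_nonneg])
    fix t :: real
    assume t: "t \<in> {0..1}"
    have "(\<Sum>n. (cmod (c01_apply (x n) t))\<^sup>2) \<le> (\<Sum>n. (cmod (coef h n))\<^sup>2)"
      by (intro suminf_le le t coef_square_summable[OF h] sums_summable[OF cone_sq_sums[OF xE]])
    then show "(\<Sum>n. (cmod (c01_apply (x n) t))\<^sup>2) \<le> (hnorm H h)\<^sup>2"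
      using sums_unique[OF parseval_norm[OF h]] by simp
  qed
  ultimately show ?thesis
    using xE by blast
qed

sublocale ev0: evaluation_map H 0 u0
proof
  interpret E: hilbert_module cone_module
    by (rule hilbert_module_cone)
  show "u0 (hadd cone_module x y) = hadd H (u0 x) (u0 y)"
      if "x \<in> hcarrier cone_module" "y \<in> hcarrier cone_module" for x y
  proof (rule coef_eqI)
    show "u0 (hadd cone_module x y) \<in> hcarrier H" "hadd H (u0 x) (u0 y) \<in> hcarrier H"
      by (intro u0_closed E.add_closed add_closed that)+
    show "coef (u0 (hadd cone_module x y)) n = coef (hadd H (u0 x) (u0 y)) n" for n
      using coef_u0[OF E.add_closed[OF that]] that
      by (simp add: coef_add u0_closed coef_u0 c01_rep_eq)
  qed
  show "u0 (hact cone_module x c) = hact H (u0 x) (c01_apply c 0)" if "x \<in> hcarrier cone_module"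
      for x c
  proof (rule coef_eqI)
    show "u0 (hact cone_module x c) \<in> hcarrier H" "hact H (u0 x) (c01_apply c 0) \<in> hcarrier H"
      by (intro u0_closed E.act_closed act_closed that)+
    show "coef (u0 (hact cone_module x c)) n = coef (hact H (u0 x) (c01_apply c 0)) n" for n
      using coef_u0[OF E.act_closed[OF that]] that
      by (simp add: coef_act u0_closed coef_u0 c01_rep_eq)
  qed
  show "hip H (u0 x) (u0 y) = c01_apply (hip cone_module x y) 0"
      if "x \<in> hcarrier cone_module" "y \<in> hcarrier cone_module" for x y
    using parseval[OF u0_closed[OF that(1)] u0_closed[OF that(2)]] cone_ip_sums[OF that, of 0]
    by (simp only: coef_u0[OF that(1)] coef_u0[OF that(2)] sums_iff)
qed (auto simp: u0_closed u0_lift)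

definition hwperm :: "(nat \<Rightarrow> complex) \<Rightarrow> (nat \<Rightarrow> nat) \<Rightarrow> 'v \<Rightarrow> 'v" where
  "hwperm m \<tau> x = vec (\<lambda>n. m n * coef x (\<tau> n))"

lemma u0_wop:
  assumes "x \<in> hcarrier cone_module"
  shows "u0 (wperm m \<tau> x) = hwperm (\<lambda>n. c01_apply (m n) 0) \<tau> (u0 x)"
  unfolding u0_def[of "wperm m \<tau> x"] hwperm_def coef_u0[OF assms] by
      (simp add: wperm_def c01_rep_eq)

text \<open>Constant weights extend to the homotopy module, so boundedness on \<open>H\<close> is
  read off from \<open>wperm_closed\<close> in the fibre at 0.\<close>

lemma hwperm:
  assumes \<tau>: "adjacent_involution \<tau>" and m: "\<And>n. cmod (m n) \<le> C" and h: "h \<in> hcarrier H"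
  shows hwperm_closed: "hwperm m \<tau> h \<in> hcarrier H"
      and coef_hop: "coef (hwperm m \<tau> h) n = m n * coef h (\<tau> n)"
proof -
  let ?M = "\<lambda>n. scaleC (m n) (1 :: c01)"
  obtain x where x: "x \<in> hcarrier cone_module" "u0 x = h"
    using u0_lift[OF h] by blast
  have w: "wperm ?M \<tau> x \<in> hcarrier cone_module"
    by (rule wperm_closed[OF \<tau> _ x(1), where C = C]) (simp add: norm_scaleC_1 m)
  have "hwperm m \<tau> h = u0 (wperm ?M \<tau> x)"
    using u0_wop[OF x(1), of ?M \<tau>] x(2) by (simp add: c01_rep_eq)
  then show "hwperm m \<tau> h \<in> hcarrier H" "coef (hwperm m \<tau> h) n = m n * coef h (\<tau> n)"
    using u0_closed[OF w] coef_u0[OF w] coef_u0[OF x(1)] x(2)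
    by (simp_all add: wperm_def c01_rep_eq)
qed

lemma hwperm_real_self_adjoint:
  assumes \<tau>: "adjacent_involution \<tau>" and m: "\<And>n. \<bar>m n\<bar> \<le> C" and m\<tau>: "\<And>n. m (\<tau> n) = m n"
  shows "adjoint_pair H (hwperm (\<lambda>n. of_real (m n)) \<tau>) (hwperm (\<lambda>n. of_real (m n)) \<tau>)"
proof -
  let ?M = "\<lambda>n. scaleC (of_real (m n)) (1 :: c01)"
  have "adjoint_pair cone_module (wperm ?M \<tau>) (wperm (\<lambda>n. star (?M (\<tau> n))) \<tau>)"
    by (rule wperm_adjoint[OF \<tau>, of ?M C]) (simp add: norm_scaleC_1 m)
  moreover have "star (?M (\<tau> n)) = ?M n" for n
    by (rule c01_eqI) (simp add: c01_rep_eq m\<tau>)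
  ultimately have "adjoint_pair cone_module (wperm ?M \<tau>) (wperm ?M \<tau>)"
    by simp
  then show ?thesis
    by (rule ev0.push_adjoint) (simp_all add: u0_wop c01_rep_eq)
qed

section \<open>The graph of \<open>T\<close>: self-adjointness and compact resolvent\<close>

lemma T_closed: "(x, y) \<in> T \<Longrightarrow> x \<in> hcarrier H" "(x, y) \<in> T \<Longrightarrow> y \<in> hcarrier H"
  by (auto simp: T)

lemma T_iff: "(x, y) \<in> T \<longleftrightarrow> x \<in> hcarrier H \<and> y \<in> hcarrier H \<and> (\<forall>n. coef y n = lam n * coef x (\<sigma> n))"
  by (auto simp: T)

lemma linear_graph_T: "linear_graph H T"
  unfolding linear_graph_def
proof (intro conjI)
  show "single_valued T"
    by (auto simp: single_valued_def T_iff intro!: coef_eqI)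
qed (auto simp: T_iff zero_closed coef_zero add_closed coef_add scale_closed coef_scale
    algebra_simps)

lemma T_add: "\<lbrakk>(x, y) \<in> T; (x', y') \<in> T\<rbrakk> \<Longrightarrow> (hadd H x x', hadd H y y') \<in> T"
  by (simp add: T_iff add_closed coef_add algebra_simps)

lemma T_scale: "(x, y) \<in> T \<Longrightarrow> (hscale H c x, hscale H c y) \<in> T"
  by (simp add: T_iff scale_closed coef_scale)

lemma b_in_T: "(b n, hact H (b (\<sigma> n)) (of_real (lam n))) \<in> T"
  using adjacent_involution_invol[OF \<sigma>] lam_\<sigma>[of n]
  by (auto simp: T_iff b_closed act_closed coef_act coef_b)

lemma psum_in_T:
  assumes x: "x \<in> hcarrier H"
  shows "\<exists>y. (psum (coef x) N, y) \<in> T"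
proof (induction N)
  case 0
  then show ?case
    using linear_graph_T by (auto simp: linear_graph_def)
next
  case (Suc N)
  then obtain y where y: "(psum (coef x) N, y) \<in> T"
    by blast
  have "(hscale H (coef x N) (b N), hscale H (coef x N) (hact H (b (\<sigma> N)) (of_real (lam N)))) \<in> T"
    by (rule T_scale[OF b_in_T])
  then have "(hact H (b N) (coef x N), hscale H (coef x N) (hact H (b (\<sigma> N)) (of_real (lam N)))) \<in>
      T"
    by (simp add: hscale_def scaleC_complex_def)
  then show ?case
    using T_add[OF y] by auto
qed

lemma densely_defined_T: "densely_defined H T"
  unfolding densely_defined_def
proof (intro ballI allI impI)
  fix h and e :: real
  assume h: "h \<in> hcarrier H" and e: "e > 0"
  obtain N where "hnorm H (hsub H (psum (coef h) N) h) < e"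
    using LIMSEQ_D[OF psum_tendsto[OF h] e] by auto
  then show "\<exists>x\<in>Domain T. hnorm H (hsub H h x) < e"
    using psum_in_T[OF h, of N] norm_sub_commute[OF h psum_closed, of "coef h" N]
    by (intro bexI[of _ "psum (coef h) N"]) auto
qed

text \<open>Testing on basis vectors alone already forces the coefficient relation on an element of
  the adjoint. The converse is Parseval's identity reindexed by \<open>\<sigma>\<close>, where
  absolute convergence permits the rearrangement.\<close>

lemma adjoint_graph_T: "adjoint_graph H T = T"
proof (intro subset_antisym subrelI)
  fix y z
  assume yz: "(y, z) \<in> adjoint_graph H T"
  then have c: "y \<in> hcarrier H" "z \<in> hcarrier H"
    and eq: "\<And>x w. (x, w) \<in> T \<Longrightarrow> hip H y w = hip H z x"
    by (auto simp: adjoint_graph_def)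
  have "coef z n = lam n * coef y (\<sigma> n)" for n
  proof -
    have "cnj (hip H y (hact H (b (\<sigma> n)) (of_real (lam n)))) = cnj (hip H z (b n))"
      using eq[OF b_in_T] by simp
    then show ?thesis
      using ip_commute[OF c(1) b_closed, of "\<sigma> n"] ip_commute[OF c(2) b_closed, of n] c
      by (simp add: coef_def ip_act_right b_closed mult.commute)
  qed
  then show "(y, z) \<in> T"
    using c by (simp add: T_iff)
next
  fix y z
  assume yz: "(y, z) \<in> T"
  have "hip H y w = hip H z x" if xw: "(x, w) \<in> T" for x w
  proof -
    have c: "x \<in> hcarrier H" "w \<in> hcarrier H" "y \<in> hcarrier H" "z \<in> hcarrier H"
      using yz xw by (auto simp: T_iff)
    have "(\<lambda>n. cnj (coef y n) * coef w n) sums hip H y w"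
      by (rule parseval[OF c(3,2)])
    moreover have "summable (\<lambda>n. norm (cnj (coef y n) * coef w n))"
    proof (rule summable_comparison_test')
      show "summable (\<lambda>n. (cmod (coef y n))\<^sup>2 + (cmod (coef w n))\<^sup>2)"
        by (intro summable_add coef_square_summable c)
      show "norm (norm (cnj (coef y n) * coef w n)) \<le> (cmod (coef y n))\<^sup>2 + (cmod (coef w n))\<^sup>2"
          for n
        using sum_squares_bound[of "cmod (coef y n)" "cmod (coef w n)"]
          mult_nonneg_nonneg[OF norm_ge_zero norm_ge_zero, of "coef y n" "coef w n"]
        by (simp only: norm_mult complex_mod_cnj abs_norm_cancel real_norm_def abs_mult)
    qed
    ultimately have "(\<lambda>n. cnj (coef y (\<sigma> n)) * coef w (\<sigma> n)) sums hip H y w"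
      by (rule adjacent_involution_sums[OF \<sigma>, rotated])
    also have "(\<lambda>n. cnj (coef y (\<sigma> n)) * coef w (\<sigma> n)) = (\<lambda>n. cnj (coef z n) * coef x n)"
      using yz xw by (simp add: T_iff fun_eq_iff lam_\<sigma> adjacent_involution_invol[OF \<sigma>])
    finally show ?thesis
      using parseval[OF c(4,1)] by (rule sums_unique2)
  qed
  then show "(y, z) \<in> adjoint_graph H T"
    using yz by (auto simp: adjoint_graph_def T_iff)
qed

abbreviation R :: "'v \<Rightarrow> 'v" where
  "R \<equiv> hwperm (\<lambda>n. of_real (res_coef n)) (\<lambda>n. n)"

lemma R: "h \<in> hcarrier H \<Longrightarrow> R h \<in> hcarrier H" "h \<in> hcarrier H \<Longrightarrow> coef (R h) n = res_coef n * coef h n"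
  using hwperm[OF adjacent_involution_id, of "\<lambda>n. of_real (res_coef n)" 1] res_coef_bounds
      less_imp_le by (simp_all add: abs_of_pos)

lemma inverse_one_plus_square_R: "inverse_one_plus_square H T R"
proof -
  have "y \<in> hcarrier H \<and> x = R y" if xz: "(x, z) \<in> T O T" and y: "y = hadd H x z" for x y z
  proof -
    obtain w where w: "(x, w) \<in> T" "(w, z) \<in> T"
      using xz by blast
    then have c: "x \<in> hcarrier H" "z \<in> hcarrier H"
      by (auto simp: T_iff)
    then have yc: "y \<in> hcarrier H"
      by (simp add: y add_closed)
    have "x = R y"
    proof (rule coef_eqI[OF c(1) R(1)[OF yc]])
      fix n
      have "coef z n = (lam n)\<^sup>2 * coef x n"
        using w by (simp add: T_iff lam_\<sigma> adjacent_involution_invol[OF \<sigma>] power2_eq_square)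
      then have "coef y n = of_real (1 + (lam n)\<^sup>2) * coef x n"
        by (simp add: y coef_add c algebra_simps)
      moreover have "of_real (res_coef n) * complex_of_real (1 + (lam n)\<^sup>2) = 1"
        unfolding res_coef_def of_real_mult[symmetric] using one_plus_pos[of n] by simp
      ultimately show "coef x n = coef (R y) n"
        unfolding R(2)[OF yc] by (simp add: mult.assoc[symmetric])
    qed
    then show ?thesis
      using yc by simp
  qed
  moreover have "\<exists>z. y = hadd H (R y) z \<and> (R y, z) \<in> T O T" if y: "y \<in> hcarrier H" for y
  proof -
    \<comment> \<open>\<open>?m1\<close> and \<open>?m2\<close> are the weights of T R and T^2 R.
      Both are at most 1, the second because T^2 R = 1 - R, so \<open>R y\<close> lies in the domain
      of T^2.\<close>
    let ?m1 = "\<lambda>n. complex_of_real (lam n * res_coef n)"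
        and ?m2 = "\<lambda>n. complex_of_real ((lam n)\<^sup>2 * res_coef n)"
    have m2: "(lam n)\<^sup>2 * res_coef n = 1 - res_coef n" for n
      using one_plus_pos[of n] by (simp add: res_coef_def field_simps)
    have "lam n \<le> 1 + (lam n)\<^sup>2" for n
      using sum_squares_bound[of "lam n" 1] lam_nonneg[of n] by (simp only: power_one mult_1_right)
    then have m1: "lam n * res_coef n \<le> 1" for n
      using one_plus_pos[of n] by (simp add: res_coef_def)
    have "cmod (?m1 n) \<le> 1" for n
      unfolding norm_of_real using m1[of n] lam_nonneg[of n] res_coef_bounds(1)[of n] by simp
    note h1 = hwperm[OF \<sigma>, of ?m1, OF this y]
    have "cmod (?m2 n) \<le> 1" for n
      unfolding norm_of_real m2 using res_coef_bounds[of n] by simp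
    note h2 = hwperm[OF adjacent_involution_id, of ?m2, OF this y]
    have "(R y, hwperm ?m1 \<sigma> y) \<in> T"
      using R[OF y] h1 by (simp add: T_iff res_coef_\<sigma>)
    moreover have "(hwperm ?m1 \<sigma> y, hwperm ?m2 (\<lambda>n. n) y) \<in> T"
      using h1 h2 by (simp add: T_iff lam_\<sigma> res_coef_\<sigma> adjacent_involution_invol[OF \<sigma>]
          power2_eq_square)
    moreover have "y = hadd H (R y) (hwperm ?m2 (\<lambda>n. n) y)"
    proof (rule coef_eqI[OF y add_closed[OF R(1)[OF y] h2(1)]])
      fix n
      show "coef y n = coef (hadd H (R y) (hwperm ?m2 (\<lambda>n. n) y)) n"
        unfolding coef_add[OF R(1)[OF y] h2(1)] R(2)[OF y] h2(2) unfolding m2 by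
            (simp add: algebra_simps)
    qed
    ultimately show ?thesis
      by blast
  qed
  ultimately show ?thesis
    unfolding inverse_one_plus_square_def by fastforce
qed

text \<open>Two factors \<open>cone_fun\<close> are inserted to meet the boundary condition of
  \<open>wperm_compact\<close>; they equal 1 at t = 0, so the fibre there is the operator in
  question.\<close>

lemma res_coef_compact: "compact_operator H (\<lambda>x. hscale H a (R x))"
proof (rule ev0.push_compact)
  let ?M = "\<lambda>n. scaleC (a * of_real (res_coef n)) cone_fun * cone_fun"
  let ?M' = "\<lambda>n. scaleC (of_real (res_coef n)) cone_fun * cone_fun"
  have nM: "norm (?M n) \<le> cmod a * res_coef n" for n
  proof -
    have "norm (?M n) \<le> norm (scaleC (a * of_real (res_coef n)) cone_fun) * norm cone_fun"
      by (rule norm_mult_ineq)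
    also have "\<dots> \<le> (cmod a * res_coef n * 1) * 1"
      unfolding norm_scaleC norm_mult norm_of_real
      using res_coef_bounds(1)[of n] cone_norm_le_1 by (intro mult_mono) auto
    finally show ?thesis
      by simp
  qed
  show "compact_operator cone_module (wperm ?M (\<lambda>n. n))"
  proof (rule wperm_compact[OF adjacent_involution_id refl])
    show "(\<lambda>n. norm (?M n)) \<longlonglongrightarrow> 0"
    proof (rule Lim_null_comparison)
      show "(\<lambda>n. cmod a * res_coef n) \<longlonglongrightarrow> 0"
        using tendsto_mult_right_zero[OF res_coef_tendsto] .
    qed (simp add: nM)
  qed (simp_all add: c01_rep_eq cone_apply)
  fix x
  assume x: "x \<in> hcarrier cone_module"
  note ux = u0_closed[OF x]
  have "u0 (wperm ?M (\<lambda>n. n) x) = hwperm (\<lambda>n. a * of_real (res_coef n)) (\<lambda>n. n) (u0 x)"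
    by (simp add: u0_wop[OF x] c01_rep_eq cone_apply)
  also have "\<dots> = hscale H a (R (u0 x))"
  proof (rule coef_eqI)
    have b: "cmod (a * of_real (res_coef n)) \<le> cmod a" for n
      using res_coef_bounds[of n] by (simp add: norm_mult mult_left_le)
    show "hwperm (\<lambda>n. a * of_real (res_coef n)) (\<lambda>n. n) (u0 x) \<in> hcarrier H"
      by (rule hwperm_closed[OF adjacent_involution_id b ux])
    show "hscale H a (R (u0 x)) \<in> hcarrier H"
      by (rule scale_closed[OF R(1)[OF ux]])
    show "coef (hwperm (\<lambda>n. a * of_real (res_coef n)) (\<lambda>n. n) (u0 x)) n
        = coef (hscale H a (R (u0 x))) n" for n
      by (simp add: coef_hop[OF adjacent_involution_id b ux] coef_scale R ux)
  qed
  finally show "u0 (wperm ?M (\<lambda>n. n) x) = hscale H a (R (u0 x))" .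
qed

lemma hwperm_sg: "x \<in> hcarrier H \<Longrightarrow> \<gamma> x = hwperm (\<lambda>n. of_real (sg n)) (\<lambda>n. n) x"
proof (rule coef_eqI)
  assume x: "x \<in> hcarrier H"
  have b: "cmod (of_real (sg n)) \<le> 1" for n
    using sg_cases[of n] by auto
  show "\<gamma> x \<in> hcarrier H" "hwperm (\<lambda>n. of_real (sg n)) (\<lambda>n. n) x \<in> hcarrier H"
    by (rule \<gamma>_closed[OF x], rule hwperm_closed[OF adjacent_involution_id b x])
  show "coef (\<gamma> x) n = coef (hwperm (\<lambda>n. of_real (sg n)) (\<lambda>n. n) x) n" for n
    by (simp add: coef_\<gamma>[OF x] coef_hop[OF adjacent_involution_id b x])
qed

abbreviation \<Gamma> :: "(nat \<Rightarrow> c01) \<Rightarrow> nat \<Rightarrow> c01" where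
  "\<Gamma> \<equiv> wperm (\<lambda>n. scaleC (of_real (sg n)) 1) (\<lambda>n. n)"

lemma u0_\<Gamma>: "x \<in> hcarrier cone_module \<Longrightarrow> u0 (\<Gamma> x) = \<gamma> (u0 x)"
  by (simp add: u0_wop hwperm_sg u0_closed c01_rep_eq)

lemma grading_\<Gamma>: "grading_operator cone_module \<Gamma>"
  unfolding grading_operator_def
proof (intro conjI ballI)
  let ?M = "\<lambda>n. scaleC (of_real (sg n)) (1 :: c01)"
  have "cmod (of_real (sg n)) \<le> 1" for n
    using sg_cases[of n] by auto
  then have "adjoint_pair cone_module \<Gamma> (wperm (\<lambda>n. star (?M n)) (\<lambda>n. n))"
    by (intro wperm_adjoint[OF adjacent_involution_id, of ?M 1]) (simp add: norm_scaleC_1)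
  moreover have "star (?M n) = ?M n" for n
    by (rule c01_eqI) (simp add: c01_rep_eq)
  ultimately show "adjoint_pair cone_module \<Gamma> \<Gamma>"
    by simp
  show "\<Gamma> (\<Gamma> x) = x" for x
  proof
    fix n
    show "\<Gamma> (\<Gamma> x) n = x n"
      using sg_cases[of n] by (intro c01_eqI) (auto simp: wperm_def c01_rep_eq)
  qed
qed

lemma grading_\<gamma>: "grading_operator H \<gamma>"
  by (rule ev0.push_grading[OF grading_\<Gamma> u0_\<Gamma>])

lemma even_spectral_triple: "even_spectral_triple H (hscale H) T \<gamma>"
  unfolding even_spectral_triple_def
proof (intro conjI allI)
  show "self_adjoint H T"
    unfolding self_adjoint_def using linear_graph_T densely_defined_T adjoint_graph_T by blast
  show "\<forall>(x, y)\<in>T. (\<gamma> x, hscale H (- 1) (\<gamma> y)) \<in> T"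
  proof clarify
    fix x y
    assume xy: "(x, y) \<in> T"
    note c = T_closed[OF xy]
    \<comment> \<open>At index 0 the sign rule for \<open>sg\<close> fails, but both sides vanish
      with \<open>lam 0\<close>.\<close>
    have "- (of_real (sg n) * coef y n) = of_real (lam n) * (of_real (sg (\<sigma> n)) * coef x (\<sigma> n))"
        for n
      using xy sg_\<sigma>[of n] lam_0 by (cases "n = 0") (auto simp: T_iff)
    then show "(\<gamma> x, hscale H (- 1) (\<gamma> y)) \<in> T"
      using c by (simp add: T_iff \<gamma>_closed scale_closed coef_scale coef_\<gamma>)
  qed
  show "\<exists>c. \<forall>(x, y)\<in>T. \<exists>z. (hscale H a x, z) \<in> T \<and> hnorm H (hsub H z (hscale H a y))
      \<le> c * hnorm H x" for a
  \<comment> \<open>Scalars commute with \<open>T\<close>, so the commutator bound holds with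
    constant 0.\<close>
  proof (intro exI[of _ 0] ballI, clarify)
    fix x y
    assume xy: "(x, y) \<in> T"
    have "hip H (hsub H z z) (hsub H z z) = 0" if "z \<in> hcarrier H" for z
      using that by (simp add: ip_sub_left sub_closed)
    then have "hnorm H (hsub H (hscale H a y) (hscale H a y)) = 0"
      using T_closed[OF xy] by (simp add: hnorm_def scale_closed)
    moreover have "(hscale H a x, hscale H a y) \<in> T"
      by (rule T_scale[OF xy])
    ultimately show "\<exists>z. (hscale H a x, z) \<in> T \<and> hnorm H (hsub H z (hscale H a y)) \<le> 0 * hnorm H x"
      by force
  qed
qed (use hilbert_module_axioms ev0.countably_generated grading_\<gamma> even_representation_scale
    inverse_one_plus_square_R res_coef_compact in blast)+

abbreviation F :: "'v \<Rightarrow> 'v" where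
  "F \<equiv> hwperm (\<lambda>n. of_real (bt_coef n)) \<sigma>"

lemma bounded_transform_F: "bounded_transform H T F"
  unfolding bounded_transform_def
proof (intro exI conjI ballI)
  \<comment> \<open>\<open>?q\<close> is the fourth root of the resolvent weight. The operator
    \<open>?C\<close> is self-adjoint with square \<open>?B\<close>, which makes the quadratic form
    of \<open>?B\<close> positive.\<close>
  let ?s = "\<lambda>n. sqrt (res_coef n)" and ?q = "\<lambda>n. sqrt (sqrt (res_coef n))"
  let ?B = "hwperm (\<lambda>n. of_real (?s n)) (\<lambda>n. n)" and ?C = "hwperm (\<lambda>n. of_real (?q n)) (\<lambda>n. n)"
  have s: "0 \<le> ?s n" "?s n \<le> 1" "0 \<le> ?q n" "?q n \<le> 1" for n
    using res_coef_bounds[of n] by auto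
  have b: "cmod (of_real (?s n)) \<le> 1" "cmod (of_real (?q n)) \<le> 1" for n
    using s[of n] by (simp_all del: real_sqrt_ge_0_iff real_sqrt_le_1_iff)
  note B = hwperm[OF adjacent_involution_id b(1)] and C = hwperm[OF adjacent_involution_id b(2)]
  show "adjoint_pair H ?B ?B"
    by (rule hwperm_real_self_adjoint[OF adjacent_involution_id, of _ 1]) (use s in auto)
  have C_adj: "adjoint_pair H ?C ?C"
    by (rule hwperm_real_self_adjoint[OF adjacent_involution_id, of _ 1]) (use s in auto)
  fix x
  assume x: "x \<in> hcarrier H"
  have "?B x = ?C (?C x)"
  proof (rule coef_eqI[OF B(1)[OF x] C(1)[OF C(1)[OF x]]])
    fix n
    have "complex_of_real (?s n) = of_real (?q n) * of_real (?q n)"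
      unfolding of_real_mult[symmetric] using res_coef_bounds(1)[of n] by simp
    then show "coef (?B x) n = coef (?C (?C x)) n"
      unfolding B(2)[OF x] C(2)[OF C(1)[OF x]] C(2)[OF x] by simp
  qed
  moreover have "hip H (?C x) (?C x) = hip H x (?C (?C x))"
    using C_adj x C(1)[OF x] unfolding adjoint_pair_def by blast
  moreover have "?C x \<in> hcarrier H"
    by (rule C(1)[OF x])
  ultimately show "positive_elem (hip H x (?B x))"
    using ip_positive[of "?C x"] by simp
  have F: "F x \<in> hcarrier H" "coef (F x) n = bt_coef n * coef x (\<sigma> n)" for n
    by (rule hwperm[OF \<sigma> _ x, of _ 1], use bt_coef_bounds in simp)+
  show "(?B x, F x) \<in> T"
    unfolding T_iff using F B[OF x]
    by (simp add: res_coef_\<sigma>) (simp add: bt_coef_def res_coef_def real_sqrt_divide)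
next
  let ?s = "\<lambda>n. sqrt (res_coef n)"
  let ?B = "hwperm (\<lambda>n. of_real (?s n)) (\<lambda>n. n)"
  have b: "cmod (of_real (?s n)) \<le> 1" for n
    using res_coef_bounds[of n] by simp
  note B = hwperm[OF adjacent_involution_id b]
  have "?B (?B y) = R y" if y: "y \<in> hcarrier H" for y
  proof (rule coef_eqI[OF B(1)[OF B(1)[OF y]] R(1)[OF y]])
    fix n
    have "of_real (?s n) * complex_of_real (?s n) = res_coef n"
      unfolding of_real_mult[symmetric] using res_coef_bounds(1)[of n] by simp
    then show "coef (?B (?B y)) n = coef (R y) n"
      unfolding B(2)[OF B(1)[OF y]] B(2)[OF y] R(2)[OF y] by (simp add: mult.assoc[symmetric])
  qed
  then have "{(y, ?B (?B y)) |y. y \<in> hcarrier H} = {(y, R y) |y. y \<in> hcarrier H}"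
    by auto
  then show "inverse_one_plus_square H T (\<lambda>x. ?B (?B x))"
    using inverse_one_plus_square_R unfolding inverse_one_plus_square_def by simp
qed

text \<open>At n > 0 the weight runs from \<open>bt_coef n\<close> at t = 0 to 1 at t = 1. The
  interpolation is by (1 - t)^2 so that \<open>1 - path n\<close> splits into two factors vanishing
  at 1, as compactness in the module demands. Index 0 keeps weight 0 throughout.\<close>

definition path :: "nat \<Rightarrow> c01" where
  "path n = (if n = 0 then 0 else 1 - scaleC (of_real (1 - bt_coef n)) (cone_fun * cone_fun))"

lemma path_apply: "t \<in> {0..1} \<Longrightarrow>
    c01_apply (path n) t = of_real (if n = 0 then 0 else 1 - (1 - bt_coef n) * (1 - t)\<^sup>2)"
  by (simp add: path_def c01_rep_eq cone_apply power2_eq_square)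

lemma path_bounded: "norm (path n) \<le> 1"
proof (rule norm_c01_le)
  fix t :: real
  assume t: "t \<in> {0..1}"
  have "0 \<le> (1 - bt_coef n) * (1 - t)\<^sup>2" "(1 - bt_coef n) * (1 - t)\<^sup>2 \<le> 1 * 1"
    using bt_coef_bounds[of n] t by (simp, intro mult_mono) (auto simp: power_le_one)
  then show "cmod (c01_apply (path n) t) \<le> 1"
    unfolding path_apply[OF t] norm_of_real by auto
qed

lemma path_\<sigma>: "path (\<sigma> n) = path n"
  using adjacent_involution_pos[OF \<sigma>, of n] by (cases "n = 0") (auto simp: path_def bt_coef_\<sigma>)

abbreviation \<Phi> :: "(nat \<Rightarrow> c01) \<Rightarrow> nat \<Rightarrow> c01" where
  "\<Phi> \<equiv> wperm path \<sigma>"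

lemma \<Phi>_self_adjoint: "adjoint_pair cone_module \<Phi> \<Phi>"
proof -
  have "star (path (\<sigma> n)) = path n" for n
    unfolding path_\<sigma> by (rule c01_eqI) (simp add: star_c01.rep_eq path_apply)
  then show ?thesis
    using wperm_adjoint[OF \<sigma>, of path 1, OF path_bounded] by simp
qed

lemma u0_\<Phi>: "x \<in> hcarrier cone_module \<Longrightarrow> u0 (\<Phi> x) = F (u0 x)"
proof -
  have "(\<lambda>n. c01_apply (path n) 0) = (\<lambda>n. of_real (bt_coef n))"
    by (auto simp: path_apply fun_eq_iff bt_coef_0)
  then show "x \<in> hcarrier cone_module \<Longrightarrow> u0 (\<Phi> x) = F (u0 x)"
    by (simp add: u0_wop)
qed

text \<open>The weight of \<open>\<Phi>\<close> squared minus 1 is a difference of squares: at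
  positive index the factor \<open>1 - path n\<close> brings the null sequence
  \<open>res_coef n\<close>, and \<open>1 + path n\<close> has norm at most 2.\<close>

lemma path_sq_compact:
  "compact_operator cone_module (\<lambda>x. hsub cone_module (\<Phi> (\<Phi> (hscale cone_module a x))) (hscale
      cone_module a x))"
proof (rule compact_operator_cong)
  \<comment> \<open>At index 0 the defect is the constant - a, which does not vanish at t = 1; it is
    still of rank one because coordinate 0 ranges over all of \<open>C([0,1])\<close>.\<close>
  let ?s = "\<lambda>n. if n = 0 then scaleC (- a) 1 else scaleC (- a * of_real (1 - bt_coef n)) cone_fun"
  let ?r = "\<lambda>n. if n = 0 then 1 else cone_fun * (1 + path n)"
  let ?M = "\<lambda>n. ?s n * ?r n"
  have two: "c01_apply 2 t = 2" if "t \<in> {0..1}" for t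
    unfolding one_add_one[symmetric] plus_c01.rep_eq one_c01.rep_eq using that by simp
  have M: "?M n = scaleC a (path n * path n - 1)" for n
    by (rule c01_eqI)
      (auto simp: path_def c01_rep_eq cone_apply algebra_simps two)
  have nM: "norm (?M n) \<le> 2 * cmod a * res_coef n" if "n > 0" for n
  proof -
    have "norm (?s n) \<le> cmod a * (1 - bt_coef n)"
      using that cone_norm_le_1 bt_coef_bounds[of n]
      by (simp add: norm_scaleC norm_mult mult_left_le del: of_real_diff)
    also have "\<dots> \<le> cmod a * res_coef n"
      by (rule mult_left_mono[OF bt_coef_bounds(3)]) simp
    finally have 1: "norm (?s n) \<le> cmod a * res_coef n" .
    have "norm (?r n) \<le> norm cone_fun * norm (1 + path n)"
      using that by (simp add: norm_mult_ineq)
    also have "\<dots> \<le> 1 * (norm (1 :: c01) + norm (path n))"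
      by (intro mult_mono cone_norm_le_1 norm_triangle_ineq) auto
    also have "\<dots> \<le> 2"
      using path_bounded[of n] by simp
    finally have 2: "norm (?r n) \<le> 2" .
    have "norm (?M n) \<le> norm (?s n) * norm (?r n)"
      by (rule norm_mult_ineq)
    also have "\<dots> \<le> (cmod a * res_coef n) * 2"
      using res_coef_bounds[of n] by (intro mult_mono 1 2) auto
    finally show ?thesis
      by simp
  qed
  show "compact_operator cone_module (wperm ?M (\<lambda>n. n))"
  proof (rule wperm_compact[OF adjacent_involution_id refl])
    show "(\<lambda>n. norm (?M n)) \<longlonglongrightarrow> 0"
    proof (rule Lim_null_comparison)
      show "\<forall>\<^sub>F n in sequentially. norm (norm (?M n)) \<le> 2 * cmod a * res_coef n"
        using eventually_gt_at_top[of 0] by eventually_elim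
            (use nM in \<open>simp only: real_norm_def abs_norm_cancel\<close>)
      show "(\<lambda>n. 2 * cmod a * res_coef n) \<longlonglongrightarrow> 0"
        using tendsto_mult_right_zero[OF res_coef_tendsto] .
    qed
  qed (simp_all add: c01_rep_eq cone_apply)
  show "hsub cone_module (\<Phi> (\<Phi> (hscale cone_module a x))) (hscale cone_module a x)
      = wperm ?M (\<lambda>n. n) x" for x
  proof
    fix n
    have "wperm ?M (\<lambda>n. n) x n = scaleC a (path n * path n - 1) * x n"
      unfolding wperm_def M ..
    also have "\<dots> = hsub cone_module (\<Phi> (\<Phi> (hscale cone_module a x))) (hscale cone_module a x) n"
      by (rule c01_eqI) (simp add: wperm_def path_\<sigma> adjacent_involution_invol[OF \<sigma>] c01_rep_eq
          algebra_simps)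
    finally show "hsub cone_module (\<Phi> (\<Phi> (hscale cone_module a x))) (hscale cone_module a x) n
        = wperm ?M (\<lambda>n. n) x n"
      by simp
  qed
qed

lemma homotopy_cycle: "kasparov_cycle \<lparr>cmod_of = cone_module, crep = hscale cone_module, cop
  = \<Phi>, cgrad = \<Gamma>\<rparr>"
proof -
  interpret E: hilbert_module cone_module
    by (rule hilbert_module_cone)
  have zero: "compact_operator cone_module K" if "\<And>x. x \<in> hcarrier cone_module \<Longrightarrow> K x = (\<lambda>_. 0)"
      for K
  proof (rule compact_operator_cong)
    show "compact_operator cone_module (wperm (\<lambda>_. 0) (\<lambda>n. n))"
      by (rule wperm_compact[where s = "\<lambda>_. 0" and r = "\<lambda>_. 0"])
          (simp_all add: adjacent_involution_id c01_rep_eq)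
  qed (simp add: that wperm_def)
  have "adjoint_pair cone_module (hscale cone_module a) (hscale cone_module (cnj a))" for a
  proof -
    have "star (scaleC a (1 :: c01)) = scaleC (cnj a) 1"
      by (rule c01_eqI) (simp add: c01_rep_eq)
    moreover have "hscale cone_module a = wperm (\<lambda>_. scaleC a 1) (\<lambda>n. n)" for a
      by (simp add: wperm_def fun_eq_iff mult_scaleC_left)
    ultimately show ?thesis
      using wperm_adjoint[OF adjacent_involution_id, of "\<lambda>_. scaleC a 1" "cmod a"] by
          (simp add: norm_scaleC_1)
  qed
  then have "even_representation cone_module (hscale cone_module) \<Gamma>"
    unfolding even_representation_def
    by (simp add: fun_eq_iff scaleC_add_left scaleC_scaleC wperm_def mult_scaleC_right)
  moreover have "\<Phi> (\<Gamma> x) = hscale cone_module (- 1) (\<Gamma> (\<Phi> x))" for x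
  proof
    fix n
    show "\<Phi> (\<Gamma> x) n = hscale cone_module (- 1) (\<Gamma> (\<Phi> x)) n"
    \<comment> \<open>The rule \<open>sg (\<sigma> n) = - sg n\<close> is available for n > 0 only;
      at n = 0 both sides vanish because \<open>path 0 = 0\<close>.\<close>
    proof (cases "n = 0")
      case True
      then show ?thesis
        by (intro c01_eqI) (simp add: wperm_def path_def c01_rep_eq)
    next
      case False
      then show ?thesis
        by (intro c01_eqI) (simp add: wperm_def sg_\<sigma> c01_rep_eq)
    qed
  qed
  moreover have "compact_operator cone_module (\<lambda>x. hsub cone_module (\<Phi> (hscale cone_module a x))
      (hscale cone_module a (\<Phi> x)))" for a
    by (rule zero) (simp add: wperm_def mult_scaleC_right)
  moreover have "compact_operator cone_module (\<lambda>x. hsub cone_module (\<Phi> (hscale cone_module a x))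
      (\<Phi> (hscale cone_module a x)))" for a
    by (rule zero) simp
  ultimately show ?thesis
    unfolding kasparov_cycle_def Let_def
    using hilbert_module_cone countably_generated_cone grading_\<Gamma> \<Phi>_self_adjoint path_sq_compact
    by (auto simp del: cone_module_simps)
qed

end

section \<open>The cycle of the unit as the fibre at t = 1\<close>

definition scalar_module :: "(complex, complex) hmod" where
  "scalar_module = \<lparr>hcarrier = UNIV, hadd = (+), hzero = 0, hact = (*), hip = (\<lambda>x y. cnj x * y)\<rparr>"

lemma scalar_module_simps:
  "hcarrier scalar_module = UNIV" "hadd scalar_module = (+)" "hzero scalar_module = 0"
  "hact scalar_module = (*)" "hip scalar_module = (\<lambda>x y. cnj x * y)"
  "hsub scalar_module = (-)" "hscale scalar_module = (*)"
  by (simp_all add: scalar_module_def hsub_def hscale_def scaleC_complex_def fun_eq_iff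
      mult.commute)

lemma hnorm_scalar_module: "hnorm scalar_module x = cmod x"
  by (simp add: hnorm_def scalar_module_simps norm_mult)

lemma hilbert_module_scalar: "hilbert_module scalar_module"
proof
  fix X :: "nat \<Rightarrow> complex"
  assume "\<And>e. e > 0 \<Longrightarrow> \<exists>N. \<forall>m\<ge>N. \<forall>n\<ge>N. hnorm scalar_module (hsub scalar_module (X m) (X n)) < e"
  then have "Cauchy X"
    by (intro CauchyI) (simp add: hnorm_scalar_module scalar_module_simps)
  then obtain x where "X \<longlonglongrightarrow> x"
    using Cauchy_convergent convergent_def by blast
  then have "(\<lambda>n. cmod (X n - x)) \<longlonglongrightarrow> 0"
    using LIM_zero tendsto_norm_zero by blast
  then show "\<exists>x\<in>hcarrier scalar_module. (\<lambda>n. hnorm scalar_module (hsub scalar_module (X n) x)) \<longlonglongrightarrow> 0"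
    by (auto simp: hnorm_scalar_module scalar_module_simps)
qed (auto simp: scalar_module_simps algebra_simps star_complex_def positive_elem_def
    intro: exI[of _ "- _"])

text \<open>In the inner product at t = 1 only the summand of index 0 survives, so evaluating
  coordinate 0 preserves inner products. Scalars lift to constant functions in coordinate 0.\<close>

lemma evaluation_map_scalar: "evaluation_map scalar_module 1 (\<lambda>x. c01_apply (x 0) 1)"
proof (intro evaluation_map.intro complex_hilbert.intro hilbert_module_scalar
    evaluation_map_axioms.intro)
  fix x y
  assume x: "x \<in> hcarrier cone_module" and y: "y \<in> hcarrier cone_module"
  have "(\<lambda>n. cnj (c01_apply (x n) 1) * c01_apply (y n) 1)
      = (\<lambda>n. if n = 0 then cnj (c01_apply (x n) 1) * c01_apply (y n) 1 else 0)"
    using cone_carrierD(2)[OF x] by auto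
  then have "(\<lambda>n. if n = 0 then cnj (c01_apply (x n) 1) * c01_apply (y n) 1
      else 0) sums c01_apply (hip cone_module x y) 1"
    using cone_ip_sums[OF x y, of 1] by simp
  then show "hip scalar_module (c01_apply (x 0) 1) (c01_apply (y 0) 1)
      = c01_apply (hip cone_module x y) 1"
    using sums_single[of 0 "\<lambda>n. cnj (c01_apply (x n) 1) * c01_apply (y n) 1"]
    unfolding scalar_module_simps by (metis (no_types, lifting) sums_unique2)
next
  fix h
  let ?x = "\<lambda>n :: nat. if n = 0 then scaleC h 1 else 0 :: c01"
  have x: "?x \<in> hcarrier cone_module"
    by (rule cone_finite_support[of "{0}"]) (auto simp: c01_rep_eq)
  have "hnorm cone_module ?x \<le> cmod h"
  proof (rule cone_norm_le[OF x])
    fix t :: real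
    assume t: "t \<in> {0..1}"
    have "(\<Sum>n. (cmod (c01_apply (?x n) t))\<^sup>2) = (\<Sum>n\<in>{0}. (cmod (c01_apply (?x n) t))\<^sup>2)"
      by (rule suminf_finite) (auto simp: c01_rep_eq)
    then show "(\<Sum>n. (cmod (c01_apply (?x n) t))\<^sup>2) \<le> (cmod h)\<^sup>2"
      using t by (simp add: c01_rep_eq)
  qed simp
  then show "\<exists>x\<in>hcarrier cone_module. c01_apply (x 0) 1 = h \<and> hnorm cone_module x
      \<le> hnorm scalar_module h"
    by (intro bexI[OF _ x]) (simp add: c01_rep_eq hnorm_scalar_module)
qed (simp_all add: scalar_module_simps c01_rep_eq)

context diagonal_operator
begin

interpretation ev1: evaluation_map scalar_module 1 "\<lambda>x. c01_apply (x 0) 1"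
  by (rule evaluation_map_scalar)

lemma represents_kk_unit: "represents_kk_unit H (hscale H) T \<gamma>"
proof -
  let ?C = "\<lparr>cmod_of = cone_module, crep = hscale cone_module, cop = \<Phi>, cgrad = \<Gamma>\<rparr>"
  have unit: "kk_unit = \<lparr>cmod_of = scalar_module, crep = hscale scalar_module, cop = \<lambda>_. 0, cgrad
      = \<lambda>x. x\<rparr>"
    unfolding kk_unit_def scalar_module_simps by (simp add: scalar_module_def)
  \<comment> \<open>In the fibre at 1 the operator is 0 and the grading is trivial, which is the
    cycle of the unit.\<close>
  have 1: "c01_apply (\<Phi> x 0) 1 = 0" "c01_apply (\<Gamma> x 0) 1 = c01_apply (x 0) 1" for x
    by (simp_all add: wperm_def path_def c01_rep_eq sg_0)
  have "kasparov_cycle kk_unit" "evaluates_to 1 ?C kk_unit"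
    unfolding unit
    by (rule ev1.kasparov_cycle_push[OF homotopy_cycle \<Phi>_self_adjoint] ev1.evaluates_to_push; simp
        only: 1)+
  moreover have "kasparov_cycle \<lparr>cmod_of = H, crep = hscale H, cop = F, cgrad = \<gamma>\<rparr>"
    by (rule ev0.kasparov_cycle_push[OF homotopy_cycle \<Phi>_self_adjoint u0_\<Phi> u0_\<Gamma>])
  moreover have "evaluates_to 0 ?C \<lparr>cmod_of = H, crep = hscale H, cop = F, cgrad = \<gamma>\<rparr>"
    by (rule ev0.evaluates_to_push; simp only: u0_\<Phi> u0_\<Gamma>)
  ultimately show ?thesis
    unfolding represents_kk_unit_def kk_equal_def
    using bounded_transform_F homotopy_cycle by blast
qed

end

section \<open>The Hilbert space \<open>L\<^sup>2\<close>\<close>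

lemma (in finite_measure) square_integrable_sub:
  fixes f g :: "'a \<Rightarrow> 'b :: {banach, second_countable_topology}"
  assumes "f \<in> borel_measurable M" "integrable M (\<lambda>x. (norm (f x))\<^sup>2)"
    and "g \<in> borel_measurable M" "integrable M (\<lambda>x. (norm (g x))\<^sup>2)"
  shows "integrable M (\<lambda>x. (norm (f x - g x))\<^sup>2)"
proof (rule Bochner_Integration.integrable_bound)
  show "integrable M (\<lambda>x. 2 * (norm (f x))\<^sup>2 + 2 * (norm (g x))\<^sup>2)"
    using assms by simp
  show "AE x in M. norm ((norm (f x - g x))\<^sup>2) \<le> norm (2 * (norm (f x))\<^sup>2 + 2 * (norm (g x))\<^sup>2)"
  proof (rule AE_I2)
    fix x
    have "(norm (f x - g x))\<^sup>2 \<le> (norm (f x) + norm (g x))\<^sup>2"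
      by (simp add: norm_triangle_ineq4 power_mono)
    also have "\<dots> \<le> 2 * (norm (f x))\<^sup>2 + 2 * (norm (g x))\<^sup>2"
      using sum_squares_bound[of "norm (f x)" "norm (g x)"] by (simp add: power2_sum)
    finally show "norm ((norm (f x - g x))\<^sup>2) \<le> norm (2 * (norm (f x))\<^sup>2 + 2 * (norm (g x))\<^sup>2)"
      by simp
  qed
qed (use assms in measurable)

text \<open>The constant comes from |f| \<le> c |f|^2 + 1 / c. With c = 2^k it turns squared L2
  distances of order 4^(-k) into L1 distances of order 2^(-k).\<close>

lemma (in finite_measure) integral_norm_le_square:
  fixes f :: "'a \<Rightarrow> 'b :: {banach, second_countable_topology}"
  assumes f: "f \<in> borel_measurable M" and sq: "integrable M (\<lambda>x. (norm (f x))\<^sup>2)" and c: "c > 0"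
  shows "integrable M (\<lambda>x. norm (f x))"
    and "(\<integral>x. norm (f x) \<partial>M) \<le> c * (\<integral>x. (norm (f x))\<^sup>2 \<partial>M) + measure M (space M) / c"
proof -
  have le: "norm (f x) \<le> c * (norm (f x))\<^sup>2 + 1 / c" for x
  proof -
    have "2 * (c * norm (f x)) * 1 \<le> (c * norm (f x))\<^sup>2 + 1\<^sup>2"
      by (rule sum_squares_bound)
    moreover have "0 \<le> c * norm (f x)"
      using c by simp
    ultimately have "c * norm (f x) \<le> (c * norm (f x))\<^sup>2 + 1"
      unfolding power_one mult_1_right by linarith
    also have "\<dots> = c * (c * (norm (f x))\<^sup>2 + 1 / c)"
      using c by (simp add: power_mult_distrib algebra_simps power2_eq_square)
    finally have "c * norm (f x) \<le> c * (c * (norm (f x))\<^sup>2 + 1 / c)" .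
    then show ?thesis
      using c by (simp add: mult_le_cancel_left)
  qed
  have int: "integrable M (\<lambda>x. c * (norm (f x))\<^sup>2 + 1 / c)"
    using sq by simp
  show 1: "integrable M (\<lambda>x. norm (f x))"
  proof (rule Bochner_Integration.integrable_bound[OF int])
    show "AE x in M. norm (norm (f x)) \<le> norm (c * (norm (f x))\<^sup>2 + 1 / c)"
    proof (rule AE_I2)
      fix x
      have "0 \<le> c * (norm (f x))\<^sup>2 + 1 / c"
        using c by simp
      then show "norm (norm (f x)) \<le> norm (c * (norm (f x))\<^sup>2 + 1 / c)"
        using le[of x] by simp
    qed
  qed (use f in measurable)
  have "(\<integral>x. norm (f x) \<partial>M) \<le> (\<integral>x. c * (norm (f x))\<^sup>2 + 1 / c \<partial>M)"
    by (rule integral_mono[OF 1 int le])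
  also have "\<dots> = c * (\<integral>x. (norm (f x))\<^sup>2 \<partial>M) + measure M (space M) / c"
    using sq by (simp add: Bochner_Integration.integral_add)
  finally show "(\<integral>x. norm (f x) \<partial>M) \<le> c * (\<integral>x. (norm (f x))\<^sup>2 \<partial>M) + measure M (space M) / c" .
qed

text \<open>Monotone convergence: the sum of the functions has finite integral, hence is finite
  almost everywhere.\<close>

lemma AE_summable_of_summable_integral:
  fixes g :: "nat \<Rightarrow> 'a \<Rightarrow> real"
  assumes g: "\<And>k. integrable M (g k)" "\<And>k x. g k x \<ge> 0" and s: "summable (\<lambda>k. \<integral>x. g k x \<partial>M)"
  shows "AE x in M. summable (\<lambda>k. g k x)"
proof -
  have [measurable]: "g k \<in> borel_measurable M" for k
    using g(1) by simp
  have "(\<integral>\<^sup>+x. (\<Sum>k. ennreal (g k x)) \<partial>M) = (\<Sum>k. \<integral>\<^sup>+x. ennreal (g k x) \<partial>M)"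
    by (rule nn_integral_suminf) measurable
  also have "\<dots> = (\<Sum>k. ennreal (\<integral>x. g k x \<partial>M))"
    by (simp add: nn_integral_eq_integral g)
  also have "\<dots> \<noteq> \<infinity>"
  proof -
    have "0 \<le> (\<integral>x. g k x \<partial>M)" for k
      by (rule integral_nonneg_AE) (simp add: g(2))
    then show ?thesis
      by (subst suminf_ennreal2[OF _ s]) auto
  qed
  finally have "AE x in M. (\<Sum>k. ennreal (g k x)) \<noteq> \<infinity>"
    by (intro nn_integral_noteq_infinite) measurable
  then show ?thesis
    by eventually_elim (rule summable_suminf_not_top, use g(2) in auto)
qed

text \<open>A fast subsequence has summable increments almost everywhere. Fatou's lemma along it
  transfers the Cauchy estimate to the pointwise limit, which also gives its square
  integrability.\<close>

lemma (in finite_measure) L2_complete: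
  fixes f :: "nat \<Rightarrow> 'a \<Rightarrow> 'b :: {banach, second_countable_topology}"
  assumes f [measurable]: "\<And>n. f n \<in> borel_measurable M"
    and sq: "\<And>n. integrable M (\<lambda>x. (norm (f n x))\<^sup>2)"
    and C: "\<And>e. e > 0 \<Longrightarrow> \<exists>N. \<forall>m\<ge>N. \<forall>n\<ge>N. (\<integral>x. (norm (f m x - f n x))\<^sup>2 \<partial>M) < e"
  shows "\<exists>g\<in>borel_measurable M. integrable M (\<lambda>x. (norm (g x))\<^sup>2) \<and>
    (\<lambda>n. \<integral>x. (norm (f n x - g x))\<^sup>2 \<partial>M) \<longlonglongrightarrow> 0"
proof -
  note sqd = square_integrable_sub[OF f sq f sq]
  have "\<exists>N. \<forall>m\<ge>N. \<forall>n\<ge>N. (\<integral>x. (norm (f m x - f n x))\<^sup>2 \<partial>M) < (1 / 4) ^ k" for k :: nat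
    by (rule C) simp
  then obtain N where N: "\<And>k m n. m \<ge> N k \<Longrightarrow> n \<ge> N k \<Longrightarrow> (\<integral>x. (norm (f m x - f n x))\<^sup>2 \<partial>M)
      < (1 / 4) ^ k"
    by metis
  \<comment> \<open>Adding up the thresholds makes both \<open>r k\<close> and
    \<open>r (Suc k)\<close> at least \<open>N k\<close>; the summand k makes r unbounded.\<close>
  define r where "r k = k + (\<Sum>i\<le>k. N i)" for k
  have r: "r k \<ge> N k" "r (Suc k) \<ge> N k" "r k \<ge> k" for k
    using member_le_sum[of k "{..k}" N] by (simp_all add: r_def)
  define h where "h k x = f (r (Suc k)) x - f (r k) x" for k x
  have [measurable]: "h k \<in> borel_measurable M" for k
    unfolding h_def by measurable
  have h_sq: "integrable M (\<lambda>x. (norm (h k x))\<^sup>2)" for k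
    unfolding h_def by (rule sqd)
  have h_int: "integrable M (\<lambda>x. norm (h k x))" for k
    by (rule integral_norm_le_square(1)[OF _ h_sq zero_less_one]) measurable
  let ?\<mu> = "measure M (space M)"
  have h_le: "(\<integral>x. norm (h k x) \<partial>M) \<le> (1 + ?\<mu>) * (1 / 2) ^ k" for k
  proof -
    have "(\<integral>x. norm (h k x) \<partial>M) \<le> 2 ^ k * (\<integral>x. (norm (h k x))\<^sup>2 \<partial>M) + ?\<mu> / 2 ^ k"
      by (rule integral_norm_le_square(2)[OF _ h_sq]) auto
    also have "\<dots> \<le> 2 ^ k * (1 / 4) ^ k + ?\<mu> / 2 ^ k"
      unfolding h_def by (intro add_right_mono mult_left_mono less_imp_le[OF N[OF r(2,1)]]) simp
    also have "2 ^ k * (1 / 4) ^ k = (1 / 2 :: real) ^ k"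
      by (simp only: power_mult_distrib[symmetric]) simp
    also have "(1 / 2) ^ k + ?\<mu> / 2 ^ k = (1 + ?\<mu>) * (1 / 2) ^ k"
      by (simp add: add_divide_distrib power_one_over)
    finally show ?thesis .
  qed
  have "summable (\<lambda>k. \<integral>x. norm (h k x) \<partial>M)"
  proof (rule summable_comparison_test')
    show "summable (\<lambda>k. (1 + ?\<mu>) * (1 / 2) ^ k)"
      by (intro summable_mult summable_geometric) simp
  qed (use h_le in simp)
  then have "AE x in M. summable (\<lambda>k. norm (h k x))"
    by (intro AE_summable_of_summable_integral h_int) auto
  then have conv: "AE x in M. (\<lambda>k. f (r k) x) \<longlonglongrightarrow> lim (\<lambda>k. f (r k) x)"
  proof eventually_elim
    fix x
    assume "summable (\<lambda>k. norm (h k x))"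
    then have "summable (\<lambda>k. h k x)"
      by (rule summable_norm_cancel)
    then have "convergent (\<lambda>k. \<Sum>i<k. h i x)"
      by (simp add: summable_iff_convergent)
    moreover have "(\<Sum>i<k. h i x) = f (r k) x - f (r 0) x" for k
      unfolding h_def by (rule sum_lessThan_telescope)
    ultimately have "convergent (\<lambda>k. f (r k) x - f (r 0) x)"
      by simp
    then have "convergent (\<lambda>k. f (r k) x)"
      by (simp add: convergent_diff_const_right_iff)
    then show "(\<lambda>k. f (r k) x) \<longlonglongrightarrow> lim (\<lambda>k. f (r k) x)"
      by (simp add: convergent_LIMSEQ_iff)
  qed
  define g where "g x = lim (\<lambda>k. f (r k) x)" for x
  have g [measurable]: "g \<in> borel_measurable M"
    unfolding g_def by measurable
  have fatou: "\<exists>N. \<forall>m\<ge>N. integrable M (\<lambda>x. (norm (f m x - g x))\<^sup>2)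
      \<and> (\<integral>x. (norm (f m x - g x))\<^sup>2 \<partial>M) \<le> e"
    if e: "e > 0" for e
  proof -
    obtain K where K: "\<And>m n. m \<ge> K \<Longrightarrow> n \<ge> K \<Longrightarrow> (\<integral>x. (norm (f m x - f n x))\<^sup>2 \<partial>M) < e"
      using C[OF e] by blast
    have "integrable M (\<lambda>x. (norm (f m x - g x))\<^sup>2) \<and> (\<integral>x. (norm (f m x - g x))\<^sup>2 \<partial>M) \<le> e"
        if m: "m \<ge> K" for m
    proof -
      have "(\<integral>\<^sup>+x. ennreal ((norm (f m x - g x))\<^sup>2) \<partial>M)
          = (\<integral>\<^sup>+x. liminf (\<lambda>k. ennreal ((norm (f m x - f (r k) x))\<^sup>2)) \<partial>M)"
      proof (rule nn_integral_cong_AE)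
        show "AE x in M. ennreal ((norm (f m x - g x))\<^sup>2)
            = liminf (\<lambda>k. ennreal ((norm (f m x - f (r k) x))\<^sup>2))"
          using conv
        proof eventually_elim
          fix x
          assume "(\<lambda>k. f (r k) x) \<longlonglongrightarrow> lim (\<lambda>k. f (r k) x)"
          then have "(\<lambda>k. ennreal ((norm (f m x - f (r k) x))\<^sup>2))
              \<longlonglongrightarrow> ennreal ((norm (f m x - g x))\<^sup>2)"
            unfolding g_def by (intro tendsto_ennrealI tendsto_intros)
          then show "ennreal ((norm (f m x - g x))\<^sup>2)
              = liminf (\<lambda>k. ennreal ((norm (f m x - f (r k) x))\<^sup>2))"
            by (rule lim_imp_Liminf[OF sequentially_bot, symmetric])
        qed
      qed
      also have "\<dots> \<le> liminf (\<lambda>k. \<integral>\<^sup>+x. ennreal ((norm (f m x - f (r k) x))\<^sup>2) \<partial>M)"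
        by (rule nn_integral_liminf) measurable
      also have "\<dots> \<le> ennreal e"
      proof (rule Liminf_le)
        have "(\<integral>\<^sup>+x. ennreal ((norm (f m x - f (r k) x))\<^sup>2) \<partial>M) \<le> ennreal e" if "k \<ge> K" for k
        proof -
          have "r k \<ge> K"
            using r(3)[of k] that by simp
          then show ?thesis
            using K[OF m] by (simp add: nn_integral_eq_integral[OF sqd] less_imp_le ennreal_leI)
        qed
        then show "\<forall>\<^sub>F k in sequentially. (\<integral>\<^sup>+x. ennreal ((norm (f m x - f (r k) x))\<^sup>2) \<partial>M)
            \<le> ennreal e"
          unfolding eventually_sequentially by blast
      qed simp
      finally have le: "(\<integral>\<^sup>+x. ennreal ((norm (f m x - g x))\<^sup>2) \<partial>M) \<le> ennreal e" .
      have int: "integrable M (\<lambda>x. (norm (f m x - g x))\<^sup>2)"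
      proof (rule integrableI_bounded)
        show "(\<integral>\<^sup>+x. ennreal (norm ((norm (f m x - g x))\<^sup>2)) \<partial>M) < \<infinity>"
          using le_less_trans[OF le ennreal_less_top] by simp
      qed measurable
      then show ?thesis
        using le e by (simp add: nn_integral_eq_integral)
    qed
    then show ?thesis
      by blast
  qed
  obtain m where m: "integrable M (\<lambda>x. (norm (f m x - g x))\<^sup>2)"
    using fatou[OF zero_less_one] by blast
  have "integrable M (\<lambda>x. (norm (f m x - (f m x - g x)))\<^sup>2)"
    by (rule square_integrable_sub[OF f sq _ m]) measurable
  then have "integrable M (\<lambda>x. (norm (g x))\<^sup>2)"
    by simp
  moreover have "(\<lambda>n. \<integral>x. (norm (f n x - g x))\<^sup>2 \<partial>M) \<longlonglongrightarrow> 0"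
  proof (rule LIMSEQ_I)
    fix e :: real
    assume e: "e > 0"
    then obtain K where "\<forall>m\<ge>K. (\<integral>x. (norm (f m x - g x))\<^sup>2 \<partial>M) \<le> e / 2"
      using fatou[of "e / 2"] by auto
    then have "\<forall>m\<ge>K. norm ((\<integral>x. (norm (f m x - g x))\<^sup>2 \<partial>M) - 0) < e"
      using e by fastforce
    then show "\<exists>K. \<forall>m\<ge>K. norm ((\<integral>x. (norm (f m x - g x))\<^sup>2 \<partial>M) - 0) < e"
      by blast
  qed
  ultimately show ?thesis
    using g by blast
qed

section \<open>Square integrable functions with values in \<open>\<complex>^2\<close>, modulo null
  sets\<close>

lemma finite_measure_interval: "finite_measure (interval_measure \<epsilon>)"
  by (rule finite_measure_lebesgue_on) auto

lemma norm_vec2_sq: "(norm (w :: complex ^ 2))\<^sup>2 = (cmod (w $ 1))\<^sup>2 + (cmod (w $ 2))\<^sup>2"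
  by (simp add: norm_vec_def L2_set_def sum_2)

lemma norm_smult_vec2: "norm (c *s (w :: complex ^ 2)) = cmod c * norm w"
proof -
  have "(norm (c *s w))\<^sup>2 = (cmod c * norm w)\<^sup>2"
    by (simp add: norm_vec2_sq norm_mult power_mult_distrib algebra_simps)
  then show ?thesis
    by simp
qed

definition ipv :: "complex ^ 2 \<Rightarrow> complex ^ 2 \<Rightarrow> complex" where
  "ipv v w = cnj (v $ 1) * w $ 1 + cnj (v $ 2) * w $ 2"

lemma ipv_sum: "(\<Sum>j\<in>UNIV. cnj (v $ j) * w $ j) = ipv v w"
  by (simp add: ipv_def sum_2)

lemma ipv_self: "ipv w w = of_real ((norm w)\<^sup>2)"
  unfolding ipv_def norm_vec2_sq of_real_add complex_norm_square by (simp add: mult.commute)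

lemma norm_ipv_le: "cmod (ipv v w) \<le> (norm v)\<^sup>2 + (norm w)\<^sup>2"
proof -
  have *: "cmod a * cmod b \<le> (cmod a)\<^sup>2 + (cmod b)\<^sup>2" for a b
    using sum_squares_bound[of "cmod a" "cmod b"] mult_nonneg_nonneg[OF norm_ge_zero norm_ge_zero,
        of a b] by linarith
  have "cmod (ipv v w) \<le> cmod (v $ 1) * cmod (w $ 1) + cmod (v $ 2) * cmod (w $ 2)"
    unfolding ipv_def by (rule norm_triangle_le) (simp add: norm_mult)
  then show ?thesis
    using *[of "v $ 1" "w $ 1"] *[of "v $ 2" "w $ 2"] by (simp add: norm_vec2_sq)
qed

lemma measurable_vec_nth: "f \<in> borel_measurable M
  \<Longrightarrow> (\<lambda>x. f x $ (j :: 2) :: complex) \<in> borel_measurable M"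
  by (erule measurable_compose) (intro borel_measurable_continuous_onI continuous_intros)

lemma measurable_smult: "f \<in> borel_measurable M
  \<Longrightarrow> (\<lambda>x. c *s f x :: complex ^ 2) \<in> borel_measurable M"
proof (erule measurable_compose)
  show "(\<lambda>x. c *s x :: complex ^ 2) \<in> borel_measurable borel"
    unfolding vector_scalar_mult_def
    by (intro borel_measurable_continuous_onI continuous_intros)
qed

lemma measurable_ipv:
  "\<lbrakk>f \<in> borel_measurable M; g \<in> borel_measurable M\<rbrakk> \<Longrightarrow> (\<lambda>x. ipv (f x) (g x)) \<in> borel_measurable M"
  unfolding ipv_def
  by (intro borel_measurable_add borel_measurable_times measurable_vec_nth
      measurable_compose[OF measurable_vec_nth borel_measurable_continuous_onI] continuous_intros)

locale real_interval =
  fixes \<epsilon> :: real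
begin

sublocale finite_measure "interval_measure \<epsilon>"
  by (rule finite_measure_interval)

abbreviation "S \<equiv> square_integrable \<epsilon>"
abbreviation "M \<equiv> interval_measure \<epsilon>"
abbreviation "cl \<equiv> ae_class \<epsilon>"
abbreviation "L2 \<equiv> L2_space \<epsilon>"

lemma S_iff: "\<psi> \<in> S \<longleftrightarrow> \<psi> \<in> borel_measurable M \<and> integrable M (\<lambda>s. (norm (\<psi> s))\<^sup>2)"
  by (simp add: square_integrable_def)

lemma S_measurable: "\<psi> \<in> S \<Longrightarrow> \<psi> \<in> borel_measurable M"
  by (simp add: S_iff)

lemma S_sub: "\<lbrakk>\<psi> \<in> S; \<xi> \<in> S\<rbrakk> \<Longrightarrow> (\<lambda>s. \<psi> s - \<xi> s) \<in> S"
  using square_integrable_sub[of \<psi> \<xi>] by (simp add: S_iff borel_measurable_diff)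

lemma S_zero: "(\<lambda>_. 0) \<in> S"
  by (simp add: S_iff)

lemma S_add: "\<lbrakk>\<psi> \<in> S; \<xi> \<in> S\<rbrakk> \<Longrightarrow> (\<lambda>s. \<psi> s + \<xi> s) \<in> S"
  using S_sub[OF _ S_sub[OF S_zero], of \<psi> \<xi>] by simp

lemma S_smult: "\<psi> \<in> S \<Longrightarrow> (\<lambda>s. c *s \<psi> s) \<in> S"
  by (simp add: S_iff norm_smult_vec2 power_mult_distrib measurable_smult)

lemma S_bound:
  assumes "\<psi> \<in> borel_measurable M" "\<And>s. s \<in> {-\<epsilon><..<\<epsilon>} \<Longrightarrow> norm (\<psi> s) \<le> C"
  shows "\<psi> \<in> S"
  unfolding S_iff
proof
  show "integrable M (\<lambda>s. (norm (\<psi> s))\<^sup>2)"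
  proof (rule integrable_const_bound[where B = "C\<^sup>2"])
    show "AE s in M. norm ((norm (\<psi> s))\<^sup>2) \<le> C\<^sup>2"
      by (rule AE_I2) (simp add: assms(2) power_mono)
  qed (use assms(1) in measurable)
qed (fact assms(1))

lemma S_integrable_ipv: "\<lbrakk>\<psi> \<in> S; \<xi> \<in> S\<rbrakk> \<Longrightarrow> integrable M (\<lambda>s. ipv (\<psi> s) (\<xi> s))"
proof (rule Bochner_Integration.integrable_bound)
  assume "\<psi> \<in> S" "\<xi> \<in> S"
  then show "integrable M (\<lambda>s. (norm (\<psi> s))\<^sup>2 + (norm (\<xi> s))\<^sup>2)"
    by (simp add: S_iff)
  show "(\<lambda>s. ipv (\<psi> s) (\<xi> s)) \<in> borel_measurable M"
    using \<open>\<psi> \<in> S\<close> \<open>\<xi> \<in> S\<close> by (simp add: measurable_ipv S_measurable)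
  show "AE s in M. norm (ipv (\<psi> s) (\<xi> s)) \<le> norm ((norm (\<psi> s))\<^sup>2 + (norm (\<xi> s))\<^sup>2)"
    by (rule AE_I2) (use norm_ipv_le in \<open>simp add: abs_of_nonneg\<close>)
qed

lemma equiv_ae: "equiv S (ae_equal \<epsilon>)"
proof (rule equivI)
  show "refl_on S (ae_equal \<epsilon>)"
    by (auto simp: refl_on_def ae_equal_def)
  show "sym (ae_equal \<epsilon>)"
    by (auto simp: sym_def ae_equal_def eq_commute)
  show "trans (ae_equal \<epsilon>)"
    unfolding trans_def ae_equal_def by (auto elim: AE_mp)
  show "ae_equal \<epsilon> \<subseteq> S \<times> S"
    by (auto simp: ae_equal_def)
qed

lemma cl_eqI: "\<lbrakk>\<psi> \<in> S; \<xi> \<in> S; AE s in M. \<psi> s = \<xi> s\<rbrakk> \<Longrightarrow> cl \<psi> = cl \<xi>"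
  unfolding ae_class_def by (rule equiv_class_eq[OF equiv_ae]) (simp add: ae_equal_def)

lemma cl_in: "\<psi> \<in> S \<Longrightarrow> cl \<psi> \<in> hcarrier L2"
  by (simp add: L2_space_def ae_class_def quotientI)

lemma cl_cases:
  assumes "X \<in> hcarrier L2"
  obtains \<psi> where "\<psi> \<in> S" "X = cl \<psi>"
  using assms by (auto simp: L2_space_def ae_class_def elim: quotientE)

lemma rep_cl:
  assumes "\<psi> \<in> S"
  shows "ae_rep (cl \<psi>) \<in> S" "AE s in M. ae_rep (cl \<psi>) s = \<psi> s"
proof -
  have "ae_rep (cl \<psi>) \<in> cl \<psi>"
    unfolding ae_rep_def by (rule someI[of _ \<psi>])
        (use assms in \<open>simp add: ae_class_def ae_equal_def\<close>)
  then show "ae_rep (cl \<psi>) \<in> S" "AE s in M. ae_rep (cl \<psi>) s = \<psi> s"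
    by (auto simp: ae_class_def ae_equal_def eq_commute)
qed

lemma hadd_cl: "\<lbrakk>\<psi> \<in> S; \<xi> \<in> S\<rbrakk> \<Longrightarrow> hadd L2 (cl \<psi>) (cl \<xi>) = cl (\<lambda>s. \<psi> s + \<xi> s)"
proof -
  assume *: "\<psi> \<in> S" "\<xi> \<in> S"
  have "cl (\<lambda>s. ae_rep (cl \<psi>) s + ae_rep (cl \<xi>) s) = cl (\<lambda>s. \<psi> s + \<xi> s)"
  proof (rule cl_eqI)
    show "AE s in M. ae_rep (cl \<psi>) s + ae_rep (cl \<xi>) s = \<psi> s + \<xi> s"
      using rep_cl(2)[OF *(1)] rep_cl(2)[OF *(2)] by eventually_elim simp
  qed (intro S_add rep_cl *)+
  then show ?thesis
    by (simp add: L2_space_def)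
qed

lemma hact_cl: "\<psi> \<in> S \<Longrightarrow> hact L2 (cl \<psi>) c = cl (\<lambda>s. c *s \<psi> s)"
proof -
  assume *: "\<psi> \<in> S"
  have "cl (\<lambda>s. c *s ae_rep (cl \<psi>) s) = cl (\<lambda>s. c *s \<psi> s)"
  proof (rule cl_eqI)
    show "AE s in M. c *s ae_rep (cl \<psi>) s = c *s \<psi> s"
      using rep_cl(2)[OF *] by eventually_elim simp
  qed (intro S_smult rep_cl *)+
  then show ?thesis
    by (simp add: L2_space_def)
qed

lemma hzero_cl: "hzero L2 = cl (\<lambda>_. 0)"
  by (simp add: L2_space_def)

lemma hip_cl:
  assumes "\<psi> \<in> S" "\<xi> \<in> S"
  shows "hip L2 (cl \<psi>) (cl \<xi>) = (\<integral>s. ipv (\<psi> s) (\<xi> s) \<partial>M)"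
proof -
  have "hip L2 (cl \<psi>) (cl \<xi>) = (\<integral>s. ipv (ae_rep (cl \<psi>) s) (ae_rep (cl \<xi>) s) \<partial>M)"
    by (simp add: L2_space_def ipv_sum)
  also have "\<dots> = (\<integral>s. ipv (\<psi> s) (\<xi> s) \<partial>M)"
    by (rule integral_cong_AE)
        (use rep_cl[OF assms(1)] rep_cl[OF assms(2)] assms in
        \<open>auto simp: measurable_ipv S_measurable\<close>)
  finally show ?thesis .
qed

lemma hsub_cl: "\<lbrakk>\<psi> \<in> S; \<xi> \<in> S\<rbrakk> \<Longrightarrow> hsub L2 (cl \<psi>) (cl \<xi>) = cl (\<lambda>s. \<psi> s - \<xi> s)"
  using hadd_cl[OF _ S_smult, of \<psi> \<xi> "- 1"] by (simp add: hsub_def hact_cl)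

lemma hnorm_cl: "\<psi> \<in> S \<Longrightarrow> hnorm L2 (cl \<psi>) = sqrt (\<integral>s. (norm (\<psi> s))\<^sup>2 \<partial>M)"
  unfolding hnorm_def by (simp add: hip_cl ipv_self del: of_real_power)

lemma hilbert_module_L2: "hilbert_module L2"
proof
  show "hzero L2 \<in> hcarrier L2"
    by (simp add: hzero_cl cl_in S_zero)
next
  fix X Y Z
  assume "X \<in> hcarrier L2"
  then obtain x where x: "x \<in> S" "X = cl x"
    by (rule cl_cases)
  show "hadd L2 X (hzero L2) = X"
    using x by (simp add: hzero_cl hadd_cl S_zero)
  show "\<exists>Y\<in>hcarrier L2. hadd L2 X Y = hzero L2"
    by (rule bexI[OF _ cl_in[OF S_smult[OF x(1), of "- 1"]]])
      (unfold x(2) hadd_cl[OF x(1) S_smult[OF x(1)]] hzero_cl, simp)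
  show "hact L2 X c \<in> hcarrier L2" "hact L2 X (c + d) = hadd L2 (hact L2 X c) (hact L2 X d)"
    "hact L2 X (c * d) = hact L2 (hact L2 X c) d" "hact L2 X 1 = X" for c d
    using x by (simp_all add: hact_cl hadd_cl S_smult cl_in vector_sadd_rdistrib mult.commute)
  have "(\<integral>s. ipv (x s) (x s) \<partial>M) = of_real (\<integral>s. (norm (x s))\<^sup>2 \<partial>M)"
    by (simp only: ipv_self integral_complex_of_real)
  then have ipxx: "hip L2 X X = of_real (\<integral>s. (norm (x s))\<^sup>2 \<partial>M)"
    using x by (simp add: hip_cl)
  have "hip L2 X X = star c * c" if "c = of_real (sqrt (\<integral>s. (norm (x s))\<^sup>2 \<partial>M))" for c
    unfolding ipxx that star_complex_def by (simp flip: of_real_mult)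
  then show "positive_elem (hip L2 X X)"
    unfolding positive_elem_def by blast
  show "X = hzero L2" if "hip L2 X X = 0"
  proof -
    have "(\<integral>s. (norm (x s))\<^sup>2 \<partial>M) = 0"
      using that ipxx by simp
    then have "AE s in M. (norm (x s))\<^sup>2 = 0"
      using x(1) by (subst (asm) integral_nonneg_eq_0_iff_AE) (auto simp: S_iff)
    then show ?thesis
      unfolding x(2) hzero_cl by (intro cl_eqI x(1) S_zero) simp
  qed
  assume "Y \<in> hcarrier L2"
  then obtain y where y: "y \<in> S" "Y = cl y"
    by (rule cl_cases)
  show "hadd L2 X Y \<in> hcarrier L2" "hadd L2 X Y = hadd L2 Y X"
    using x y by (simp_all add: hadd_cl cl_in S_add add.commute)
  show "hact L2 (hadd L2 X Y) c = hadd L2 (hact L2 X c) (hact L2 Y c)" for c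
    using x y by (simp add: hadd_cl hact_cl S_add S_smult vector_add_ldistrib)
  show "hip L2 X (hact L2 Y c) = hip L2 X Y * c" for c
  proof -
    have "(\<integral>s. ipv (x s) (c *s y s) \<partial>M) = (\<integral>s. ipv (x s) (y s) * c \<partial>M)"
      by (rule Bochner_Integration.integral_cong) (simp_all add: ipv_def algebra_simps)
    then show ?thesis
      using x y by (simp add: hact_cl hip_cl S_smult)
  qed
  show "star (hip L2 X Y) = hip L2 Y X"
  proof -
    have "cnj (\<integral>s. ipv (x s) (y s) \<partial>M) = (\<integral>s. cnj (ipv (x s) (y s)) \<partial>M)"
      by simp
    also have "\<dots> = (\<integral>s. ipv (y s) (x s) \<partial>M)"
      by (rule Bochner_Integration.integral_cong) (simp_all add: ipv_def mult.commute)
    finally show ?thesis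
      using x y by (simp add: hip_cl star_complex_def)
  qed
  assume "Z \<in> hcarrier L2"
  then obtain z where z: "z \<in> S" "Z = cl z"
    by (rule cl_cases)
  show "hadd L2 (hadd L2 X Y) Z = hadd L2 X (hadd L2 Y Z)"
    using x y z by (simp add: hadd_cl S_add add.assoc)
  show "hip L2 X (hadd L2 Y Z) = hip L2 X Y + hip L2 X Z"
  proof -
    have "(\<integral>s. ipv (x s) (y s + z s) \<partial>M) = (\<integral>s. ipv (x s) (y s) + ipv (x s) (z s) \<partial>M)"
      by (rule Bochner_Integration.integral_cong) (simp_all add: ipv_def algebra_simps)
    then show ?thesis
      using x y z by (simp add: hadd_cl hip_cl S_add S_integrable_ipv)
  qed
next
  fix X :: "nat \<Rightarrow> _"
  assume X: "\<And>n. X n \<in> hcarrier L2"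
    and C: "\<And>e. e > 0 \<Longrightarrow> \<exists>N. \<forall>m\<ge>N. \<forall>n\<ge>N. hnorm L2 (hsub L2 (X m) (X n)) < e"
  have "\<exists>x. x \<in> S \<and> X n = cl x" for n
    using X[of n] by (rule cl_cases) blast
  then obtain x where x: "\<And>n. x n \<in> S" "\<And>n. X n = cl (x n)"
    by metis
  have nrm: "hnorm L2 (hsub L2 (cl \<psi>) (cl \<xi>)) = sqrt (\<integral>s. (norm (\<psi> s - \<xi> s))\<^sup>2 \<partial>M)"
      if "\<psi> \<in> S" "\<xi> \<in> S" for \<psi> \<xi>
    using that by (simp add: hsub_cl hnorm_cl S_sub)
  have "\<exists>g\<in>borel_measurable M. integrable M (\<lambda>s. (norm (g s))\<^sup>2) \<and>
    (\<lambda>n. \<integral>s. (norm (x n s - g s))\<^sup>2 \<partial>M) \<longlonglongrightarrow> 0"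
  proof (rule L2_complete)
    fix e :: real
    assume "e > 0"
    then obtain N where N: "\<And>m n. m \<ge> N \<Longrightarrow> n \<ge> N \<Longrightarrow> hnorm L2 (hsub L2 (X m) (X n)) < sqrt e"
      using C[of "sqrt e"] by auto
    have "(\<integral>s. (norm (x m s - x n s))\<^sup>2 \<partial>M) < e" if "m \<ge> N" "n \<ge> N" for m n
      using N[OF that] by (simp add: x nrm)
    then show "\<exists>N. \<forall>m\<ge>N. \<forall>n\<ge>N. (\<integral>s. (norm (x m s - x n s))\<^sup>2 \<partial>M) < e"
      by blast
  qed (use x in \<open>auto simp: S_iff\<close>)
  then obtain g where g: "g \<in> S" "(\<lambda>n. \<integral>s. (norm (x n s - g s))\<^sup>2 \<partial>M) \<longlonglongrightarrow> 0"
    by (auto simp: S_iff)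
  have "(\<lambda>n. hnorm L2 (hsub L2 (X n) (cl g))) \<longlonglongrightarrow> 0"
    using tendsto_real_sqrt[OF g(2)] by (simp add: x nrm g)
  then show "\<exists>x\<in>hcarrier L2. (\<lambda>n. hnorm L2 (hsub L2 (X n) x)) \<longlonglongrightarrow> 0"
    using cl_in[OF g(1)] by blast
qed

end

section \<open>Chebyshev polynomials and moments\<close>

text \<open>These are the Chebyshev polynomials of the second kind.\<close>

fun cheb :: "nat \<Rightarrow> real poly" where
  "cheb 0 = 1"
| "cheb (Suc 0) = [:0, 2:]"
| "cheb (Suc (Suc n)) = [:0, 2:] * cheb (Suc n) - cheb n"

lemma sin_cheb: "sin ((real n + 1) * x) = sin x * poly (cheb n) (cos x)"
proof (induction n rule: cheb.induct)
  case 2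
  then show ?case
    by (simp add: sin_double)
next
  case (3 n)
  have "sin ((real (Suc (Suc n)) + 1) * x) = sin ((real (Suc n) + 1) * x + x)"
    by (simp add: algebra_simps)
  also have "\<dots> = 2 * cos x * sin ((real (Suc n) + 1) * x) - sin ((real (Suc n) + 1) * x - x)"
    by (simp add: sin_add sin_diff)
  also have "(real (Suc n) + 1) * x - x = (real n + 1) * x"
    by (simp add: algebra_simps)
  finally show ?case
    using 3 by (simp add: algebra_simps)
qed simp

lemma degree_cheb: "degree (cheb n) = n \<and> cheb n \<noteq> 0"
proof (induction n rule: cheb.induct)
  case (3 n)
  have "degree ([:0, 2:] * cheb (Suc n)) = Suc (Suc n)"
    using 3 by (subst degree_mult_eq) auto
  then have "degree (cheb (Suc (Suc n))) = Suc (Suc n)"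
    using 3 unfolding cheb.simps diff_conv_add_uminus by (subst degree_add_eq_left) auto
  then show ?case
    by (metis degree_0 nat.distinct(1))
qed auto

text \<open>Induction on the degree: subtracting a multiple of the member of equal degree cancels
  the leading coefficient. The conclusion is phrased through a functional because it is applied to
  integrals that vanish on the family.\<close>

lemma polynomial_spanning:
  fixes q :: "nat \<Rightarrow> real poly" and L :: "real poly \<Rightarrow> complex"
  assumes deg: "\<And>n. degree (q n) = n" "\<And>n. q n \<noteq> 0"
    and L: "\<And>p r. L (p + r) = L p + L r" "\<And>c p. L (smult c p) = of_real c * L p" "\<And>n. L (q n) = 0"
  shows "L p = 0"
proof (induction "degree p" arbitrary: p rule: less_induct)
  case less
  show ?case
  proof (cases "p = 0")
    case True
    then show ?thesis
      using L(2)[of 0 p] by simp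
  next
    case False
    define n where "n = degree p"
    define c where "c = lead_coeff p / lead_coeff (q n)"
    define r where "r = p + smult (- c) (q n)"
    have "coeff (q n) n \<noteq> 0"
      using deg[of n] leading_coeff_neq_0[of "q n"] by simp
    then have "coeff r n = 0"
      using deg(1)[of n] by (simp add: r_def c_def n_def)
    moreover have "degree r \<le> n"
      unfolding r_def n_def by (rule degree_add_le) (simp_all add: deg)
    ultimately have r: "r = 0 \<or> degree r < n"
      by (metis le_neq_implies_less leading_coeff_0_iff)
    have "L r = 0"
    proof (cases "r = 0")
      case True
      then show ?thesis
        using L(2)[of 0 r] by simp
    next
      case False
      then show ?thesis
        using r less.hyps[of r] by (simp add: n_def)
    qed
    moreover have "p = r + smult c (q n)"
      by (simp add: r_def)
    ultimately show ?thesis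
      using L by simp
  qed
qed

lemma real_polynomial_function_poly:
  "real_polynomial_function (f :: real \<Rightarrow> real) \<Longrightarrow> \<exists>p. f = poly p"
proof (induction rule: real_polynomial_function.induct)
  case (linear f)
  then have "f x = poly [:0, f 1:] x" for x
    using linear_scale[OF bounded_linear.linear, of f x 1] by simp
  then show ?case
    by blast
next
  case (const c)
  have "(\<lambda>_. c) = poly [:c:]"
    by auto
  then show ?case
    by blast
next
  case (add f g)
  then obtain p q where "f = poly p" "g = poly q"
    by blast
  then have "(\<lambda>x. f x + g x) = poly (p + q)"
    by auto
  then show ?case
    by blast
next
  case (mult f g)
  then obtain p q where "f = poly p" "g = poly q"
    by blast
  then have "(\<lambda>x. f x * g x) = poly (p * q)"
    by auto
  then show ?case
    by blast
qed

definition vec2 :: "complex \<Rightarrow> complex \<Rightarrow> complex ^ 2" where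
  "vec2 a b = (\<chi> i. if i = 1 then a else b)"

lemma vec2_nth [simp]: "vec2 a b $ 1 = a" "vec2 a b $ 2 = b"
  by (simp_all add: vec2_def)

lemma vec2_eqI: "v $ 1 = w $ 1 \<Longrightarrow> v $ 2 = w $ 2 \<Longrightarrow> v = (w :: complex ^ 2)"
  by (simp add: vec_eq_iff forall_2)

lemma ipv_vec2: "ipv (vec2 a b) w = cnj a * w $ 1 + cnj b * w $ 2"
  by (simp add: ipv_def)

lemma continuous_on_vec2 [continuous_intros]:
  "continuous_on A f \<Longrightarrow> continuous_on A g \<Longrightarrow> continuous_on A (\<lambda>x. vec2 (f x) (g x))"
  unfolding vec2_def
proof (intro continuous_on_vec_lambda)
  assume "continuous_on A f" "continuous_on A g"
  then show "continuous_on A (\<lambda>x. if i = 1 then f x else g x)" for i :: 2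
    by (cases "i = 1") auto
qed

lemma gamma3_mult: "gamma3 *v w = vec2 (w $ 1) (- (w $ 2))"
  by (rule vec2_eqI) (simp_all add: gamma3_def matrix_vector_mult_def sum_2)

section \<open>Integration on the interval and the basis functions in the angle variable\<close>

locale interval = real_interval +
  assumes eps_pos: "0 < \<epsilon>"
begin

abbreviation "\<alpha> \<equiv> alpha \<epsilon>"

definition \<theta> :: "real \<Rightarrow> real" where
  "\<theta> s = \<alpha> * (s + \<epsilon>)"

lemma alpha_pos: "\<alpha> > 0"
  using eps_pos by (simp add: alpha_def)

lemma \<theta>_ends: "\<theta> (- \<epsilon>) = 0" "\<theta> \<epsilon> = pi"
  using eps_pos by (simp_all add: \<theta>_def alpha_def)

lemma \<theta>_range: "s \<in> {-\<epsilon>..\<epsilon>} \<Longrightarrow> 0 \<le> \<theta> s" "s \<in> {-\<epsilon>..\<epsilon>} \<Longrightarrow> \<theta> s \<le> pi"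
proof -
  assume s: "s \<in> {-\<epsilon>..\<epsilon>}"
  show "0 \<le> \<theta> s"
    using s alpha_pos by (simp add: \<theta>_def)
  have "\<theta> s \<le> \<theta> \<epsilon>"
    using s alpha_pos by (simp add: \<theta>_def)
  then show "\<theta> s \<le> pi"
    by (simp add: \<theta>_ends)
qed

lemma sin_\<theta>_pos: "s \<in> {-\<epsilon><..<\<epsilon>} \<Longrightarrow> sin (\<theta> s) > 0"
proof (rule sin_gt_zero)
  assume s: "s \<in> {-\<epsilon><..<\<epsilon>}"
  show "0 < \<theta> s"
    using s alpha_pos by (simp add: \<theta>_def)
  have "\<theta> s < \<theta> \<epsilon>"
    using s alpha_pos by (simp add: \<theta>_def)
  then show "\<theta> s < pi"
    by (simp add: \<theta>_ends)
qed

lemma \<theta>_deriv [derivative_intros]: "(\<theta> has_real_derivative \<alpha>) (at s within A)"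
  unfolding \<theta>_def[abs_def] by (auto intro!: derivative_eq_intros)

lemma continuous_on_\<theta> [continuous_intros]: "continuous_on A \<theta>"
  unfolding \<theta>_def[abs_def] by (intro continuous_intros)

lemma continuous_measurable:
  fixes f :: "real \<Rightarrow> 'b :: euclidean_space"
  shows "continuous_on {-\<epsilon><..<\<epsilon>} f \<Longrightarrow> f \<in> borel_measurable M"
  by (rule continuous_imp_measurable_on_sets_lebesgue) auto

lemma continuous_integrable:
  fixes f :: "real \<Rightarrow> 'b :: euclidean_space"
  assumes f: "continuous_on {-\<epsilon>..\<epsilon>} f"
  shows "integrable M f"
proof -
  have "bounded (f ` {-\<epsilon>..\<epsilon>})"
    by (intro compact_imp_bounded compact_continuous_image f) simp
  then obtain B where B: "\<forall>y\<in>f ` {-\<epsilon>..\<epsilon>}. norm y \<le> B"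
    unfolding bounded_iff by blast
  show ?thesis
  proof (rule integrable_const_bound[where B = B])
    show "AE s in M. norm (f s) \<le> B"
      by (rule AE_I2) (simp add: B)
    show "f \<in> borel_measurable M"
      by (intro continuous_measurable continuous_on_subset[OF f]) auto
  qed
qed

lemma continuous_S:
  assumes f: "continuous_on {-\<epsilon>..\<epsilon>} f"
  shows "f \<in> S"
  unfolding S_iff
proof
  show "f \<in> borel_measurable M"
    by (rule continuous_measurable[OF continuous_on_subset[OF f]]) auto
  show "integrable M (\<lambda>s. (norm (f s))\<^sup>2)"
    by (rule continuous_integrable) (intro continuous_intros f)
qed

lemma FTC:
  fixes f :: "real \<Rightarrow> 'b :: euclidean_space"
  assumes f: "\<And>s. (f has_vector_derivative f' s) (at s)" and c: "continuous_on {-\<epsilon>..\<epsilon>} f'"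
  shows "(\<integral>s. f' s \<partial>M) = f \<epsilon> - f (- \<epsilon>)"
proof -
  have "(f' has_integral f \<epsilon> - f (- \<epsilon>)) {-\<epsilon>..\<epsilon>}"
    by (rule fundamental_theorem_of_calculus[OF _ has_vector_derivative_at_within[OF f]])
      (use eps_pos in simp)
  then have "(f' has_integral f \<epsilon> - f (- \<epsilon>)) {-\<epsilon><..<\<epsilon>}"
    using has_integral_open_interval[of f' "f \<epsilon> - f (- \<epsilon>)" "- \<epsilon>" \<epsilon>]
    unfolding box_real by blast
  then show ?thesis
    using lebesgue_integral_eq_integral[OF continuous_integrable[OF c]] by
        (simp add: integral_unique)
qed

lemma FTC_real:
  fixes f :: "real \<Rightarrow> real"
  assumes "\<And>s. (f has_real_derivative f' s) (at s)" "continuous_on {-\<epsilon>..\<epsilon>} f'"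
  shows "(\<integral>s. f' s \<partial>M) = f \<epsilon> - f (- \<epsilon>)"
  by (rule FTC[OF _ assms(2)])
      (use assms(1) in \<open>simp add: has_real_derivative_iff_has_vector_derivative\<close>)

text \<open>\<open>A k\<close> and \<open>C k\<close> are the even and the odd basis functions
  before normalization, \<open>Q k\<close> is \<open>A k\<close> divided by sin \<theta>, and
  \<open>\<mu> k\<close> is the k-th squared singular value divided by \<alpha>^2.\<close>

definition A :: "nat \<Rightarrow> real \<Rightarrow> real" where "A k s = sin ((real k + 1) * \<theta> s)"
definition Q :: "nat \<Rightarrow> real \<Rightarrow> real" where "Q k s = poly (cheb k) (cos (\<theta> s))"
definition D :: "nat \<Rightarrow> real \<Rightarrow> real" where "D k s = poly (pderiv (cheb k)) (cos (\<theta> s))"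
definition C :: "nat \<Rightarrow> real \<Rightarrow> real" where "C k s = - (sin (\<theta> s))\<^sup>2 * D k s"
definition \<mu> :: "nat \<Rightarrow> real" where "\<mu> k = (real k + 1)\<^sup>2 - 1"

lemma A_eq: "A k s = sin (\<theta> s) * Q k s"
  by (simp add: A_def Q_def sin_cheb)

lemma Q_deriv: "(Q k has_real_derivative - (\<alpha> * sin (\<theta> s) * D k s)) (at s)"
  unfolding Q_def[abs_def] D_def
  by (auto intro!: derivative_eq_intros DERIV_chain'[OF _ poly_DERIV])

text \<open>As f sin \<theta> = - \<alpha> cos \<theta>, the second summand is - f
  \<open>A k\<close>. So this is (d/ds + f) \<open>A k\<close> = \<alpha> \<open>C k\<close>,
  written without the singular f.\<close>

lemma A_deriv: "(A k has_real_derivative \<alpha> * (C k s + cos (\<theta> s) * Q k s)) (at s)"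
  unfolding A_eq[abs_def] C_def
  by (auto intro!: derivative_eq_intros Q_deriv simp: algebra_simps power2_eq_square)

text \<open>Comparing two expressions for the derivative of \<open>A k\<close> removes the
  derivative of the polynomial, so \<open>C k\<close> can be differentiated without second
  derivatives of \<open>cheb k\<close>.\<close>

lemma C_eq: "C k s = (real k + 1) * cos ((real k + 1) * \<theta> s) - cos (\<theta> s) * Q k s"
proof -
  have "(A k has_real_derivative \<alpha> * ((real k + 1) * cos ((real k + 1) * \<theta> s))) (at s)"
    unfolding A_def[abs_def] by (auto intro!: derivative_eq_intros)
  then have "\<alpha> * ((real k + 1) * cos ((real k + 1) * \<theta> s)) = \<alpha> * (C k s + cos (\<theta> s) * Q k s)"
    using A_deriv by (rule DERIV_unique)
  then show ?thesis
    using alpha_pos by simp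
qed

text \<open>Here f \<open>C k\<close> = \<alpha> cos \<theta> sin \<theta> \<open>D k\<close>, so
  this is (d/ds - f) \<open>C k\<close> = - \<alpha> \<open>\<mu> k\<close> \<open>A k\<close>, the
  partner of \<open>A_deriv\<close>.\<close>

lemma C_deriv: "(C k has_real_derivative \<alpha> * (cos (\<theta> s) * sin (\<theta> s) * D k s - \<mu> k * A k s)) (at s)"
proof -
  have "((\<lambda>s. (real k + 1) * cos ((real k + 1) * \<theta> s) - cos (\<theta> s) * Q k s) has_real_derivative
      (real k + 1) * (- sin ((real k + 1) * \<theta> s) * ((real k + 1) * \<alpha>))
      - (- sin (\<theta> s) * \<alpha> * Q k s + - (\<alpha> * sin (\<theta> s) * D k s) * cos (\<theta> s))) (at s)"
    by (auto intro!: derivative_eq_intros Q_deriv simp: algebra_simps)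
  also have "(real k + 1) * (- sin ((real k + 1) * \<theta> s) * ((real k + 1) * \<alpha>))
      - (- sin (\<theta> s) * \<alpha> * Q k s + - (\<alpha> * sin (\<theta> s) * D k s) * cos (\<theta> s))
      = \<alpha> * (cos (\<theta> s) * sin (\<theta> s) * D k s - (real k + 1)\<^sup>2 * sin ((real k + 1) * \<theta> s) + sin (\<theta> s)
          * Q k s)"
    by (simp add: algebra_simps power2_eq_square)
  also have "\<dots> = \<alpha> * (cos (\<theta> s) * sin (\<theta> s) * D k s - \<mu> k * A k s)"
    unfolding A_eq[symmetric] unfolding A_def \<mu>_def by (simp add: algebra_simps)
  finally show ?thesis
    unfolding C_eq[abs_def] .
qed

lemma continuous_on_ACQD [continuous_intros]:
  "continuous_on X (A k)" "continuous_on X (Q k)" "continuous_on X (D k)" "continuous_on X (C k)"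
  unfolding A_def[abs_def] Q_def[abs_def] D_def[abs_def] C_def[abs_def]
  by (intro continuous_intros)+

lemma integral_A_A: "(\<integral>s. A j s * A k s \<partial>M) = (if j = k then \<epsilon> else 0)"
proof -
  have \<alpha>: "\<alpha> \<noteq> 0" "pi = 2 * (\<alpha> * \<epsilon>)"
    using eps_pos alpha_pos by (simp_all add: alpha_def)
  \<comment> \<open>p and d are the sum and the difference of the frequencies j + 1 and k + 1; only
    d can vanish.\<close>
  define p where "p = real j + real k + 2"
  have p: "p \<noteq> 0"
    by (simp add: p_def)
  have sp: "sin (p * pi) = 0"
    unfolding p_def using sin_npi[of "j + k + 2"] by (simp add: algebra_simps)
  define d where "d = real j - real k"
  have sd: "sin (d * pi) = 0"
    unfolding d_def left_diff_distrib sin_diff by (simp add: sin_npi)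
  have prod: "A j s * A k s = (cos (d * \<theta> s) - cos (p * \<theta> s)) / 2" for s
    unfolding A_def sin_times_sin by (simp add: d_def p_def algebra_simps)
  show ?thesis
  proof (cases "j = k")
    case True
    have "(\<integral>s. (1 - cos (p * \<theta> s)) / 2 \<partial>M)
        = (\<epsilon> / 2 - sin (p * \<theta> \<epsilon>) / (2 * p * \<alpha>)) - (- \<epsilon> / 2 - sin (p * \<theta> (- \<epsilon>)) / (2 * p * \<alpha>))"
      using p \<alpha> by (intro FTC_real)
          (auto intro!: derivative_eq_intros continuous_intros simp: field_simps)
    moreover have "d = 0"
      using True by (simp add: d_def)
    ultimately show ?thesis
      unfolding prod using True sp by (simp add: \<theta>_ends)
  next
    case False
    then have d: "d \<noteq> 0"
      by (simp add: d_def)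
    have "(\<integral>s. (cos (d * \<theta> s) - cos (p * \<theta> s)) / 2 \<partial>M)
        = (sin (d * \<theta> \<epsilon>) / (2 * d * \<alpha>) - sin (p * \<theta> \<epsilon>) / (2 * p * \<alpha>))
        - (sin (d * \<theta> (- \<epsilon>)) / (2 * d * \<alpha>) - sin (p * \<theta> (- \<epsilon>)) / (2 * p * \<alpha>))"
      using p d \<alpha> by (intro FTC_real)
          (auto intro!: derivative_eq_intros continuous_intros simp: field_simps)
    then show ?thesis
      using False sp sd by (simp add: prod \<theta>_ends)
  qed
qed

lemma A_ends: "A k (- \<epsilon>) = 0" "A k \<epsilon> = 0"
  using sin_npi[of "Suc k"] by (simp_all add: A_def \<theta>_ends algebra_simps)

text \<open>In the derivative of \<open>A j * C k\<close> the terms with f cancel and leave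
  \<open>C j * C k - \<mu> k * (A j * A k)\<close>, up to the factor \<alpha>. The boundary terms
  vanish, so the integrals reduce to those of the \<open>A k\<close>.\<close>

lemma integral_C_C: "(\<integral>s. C j s * C k s \<partial>M) = (if j = k then \<epsilon> * \<mu> k else 0)"
proof -
  let ?g = "\<lambda>s. A j s * C k s / \<alpha>" and ?g' = "\<lambda>s. C j s * C k s - \<mu> k * (A j s * A k s)"
  have "(?g has_real_derivative ?g' s) (at s)" for s
  proof -
    have "((\<lambda>s. A j s * C k s) has_real_derivative \<alpha> * (C j s + cos (\<theta> s) * Q j s) * C k s
        + \<alpha> * (cos (\<theta> s) * sin (\<theta> s) * D k s - \<mu> k * A k s) * A j s) (at s)"
      by (rule DERIV_mult[OF A_deriv C_deriv])
    also have "\<alpha> * (C j s + cos (\<theta> s) * Q j s) * C k s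
        + \<alpha> * (cos (\<theta> s) * sin (\<theta> s) * D k s - \<mu> k * A k s) * A j s
        = \<alpha> * ?g' s + \<alpha> * cos (\<theta> s) * (Q j s * C k s + sin (\<theta> s) * D k s * A j s)"
      by (simp add: algebra_simps)
    also have "Q j s * C k s + sin (\<theta> s) * D k s * A j s = 0"
      by (simp add: C_def A_eq power2_eq_square)
    finally show ?thesis
      using DERIV_cdivide[of "\<lambda>s. A j s * C k s" "\<alpha> * ?g' s" s UNIV \<alpha>] alpha_pos by simp
  qed
  then have "(\<integral>s. ?g' s \<partial>M) = ?g \<epsilon> - ?g (- \<epsilon>)"
    by (rule FTC_real) (intro continuous_intros)
  then have "(\<integral>s. ?g' s \<partial>M) = 0"
    by (simp add: A_ends)
  moreover have "(\<integral>s. ?g' s \<partial>M) = (\<integral>s. C j s * C k s \<partial>M) - \<mu> k * (\<integral>s. A j s * A k s \<partial>M)"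
    by (subst Bochner_Integration.integral_diff)
      (auto intro!: continuous_integrable continuous_intros)
  ultimately show ?thesis
    by (simp add: integral_A_A)
qed

text \<open>Weierstrass approximation extends the vanishing from polynomials in cos \<theta> to all
  continuous functions. Approximating the sign of w by continuous functions then shows that the
  integral of |w| is 0.\<close>

lemma moments_zero_real:
  fixes w :: "real \<Rightarrow> real"
  assumes w: "integrable M w" and mom: "\<And>p. (\<integral>s. w s * poly p (cos (\<theta> s)) \<partial>M) = 0"
  shows "AE s in M. w s = 0"
proof -
  have [measurable]: "w \<in> borel_measurable M"
    using w by simp
  have abs: "integrable M (\<lambda>s. \<bar>w s\<bar>)"
    using w by simp
  have int: "integrable M (\<lambda>s. w s * h s)" if h: "continuous_on {-\<epsilon>..\<epsilon>} h" for h :: "real \<Rightarrow> real"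
  proof -
    obtain B where B: "\<forall>y\<in>h ` {-\<epsilon>..\<epsilon>}. norm y \<le> B"
      using compact_imp_bounded[OF compact_continuous_image[OF h compact_Icc]]
          unfolding bounded_iff by blast
    have [measurable]: "h \<in> borel_measurable M"
      by (intro continuous_measurable continuous_on_subset[OF h]) auto
    show ?thesis
    proof (rule Bochner_Integration.integrable_bound)
      show "integrable M (\<lambda>s. B * \<bar>w s\<bar>)"
        using abs by simp
      show "AE s in M. norm (w s * h s) \<le> norm (B * \<bar>w s\<bar>)"
      proof (rule AE_I2)
        fix s
        assume "s \<in> space M"
        then have "\<bar>h s\<bar> \<le> B"
          using B by auto
        then have "\<bar>w s\<bar> * \<bar>h s\<bar> \<le> \<bar>w s\<bar> * \<bar>B\<bar>"
          by (intro mult_left_mono) auto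
        then show "norm (w s * h s) \<le> norm (B * \<bar>w s\<bar>)"
          by (simp add: abs_mult mult.commute)
      qed
    qed measurable
  qed
  have zero: "(\<integral>s. w s * h s \<partial>M) = 0" if h: "continuous_on UNIV h" for h :: "real \<Rightarrow> real"
  proof -
    \<comment> \<open>Cosine is injective on [0, \<pi>], so h is a continuous function of cos
      \<theta>, obtained by inverting \<theta> through \<open>arccos\<close>.\<close>
    let ?k = "\<lambda>y. h (arccos y / \<alpha> - \<epsilon>)"
    let ?W = "\<integral>s. \<bar>w s\<bar> \<partial>M"
    have hk: "h s = ?k (cos (\<theta> s))" if "s \<in> {-\<epsilon>..\<epsilon>}" for s
      using \<theta>_range[OF that] alpha_pos by (simp add: arccos_cos) (simp add: \<theta>_def)
    have "\<bar>\<integral>s. w s * h s \<partial>M\<bar> \<le> e * ?W" if e: "e > 0" for e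
    proof -
      have "continuous_on {-1..1} ?k"
        by (intro continuous_on_compose2[OF h] continuous_intros continuous_on_arccos')
            (use alpha_pos in auto)
      then obtain g where g: "real_polynomial_function g" "\<And>y. y \<in> {-1..1} \<Longrightarrow> \<bar>?k y - g y\<bar> < e"
        using Stone_Weierstrass_real_polynomial_function[OF compact_Icc _ e, of "-1" 1 ?k] by auto
      obtain p where p: "g = poly p"
        using real_polynomial_function_poly[OF g(1)] by blast
      let ?p = "\<lambda>s. poly p (cos (\<theta> s))"
      have ih: "integrable M (\<lambda>s. w s * h s)" and ip: "integrable M (\<lambda>s. w s * ?p s)"
        by (intro int continuous_intros continuous_on_subset[OF h] subset_UNIV)+
      have "(\<integral>s. w s * h s \<partial>M) = (\<integral>s. w s * h s - w s * ?p s \<partial>M)"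
        using ih ip mom[of p] by simp
      also have "\<bar>\<dots>\<bar> \<le> (\<integral>s. \<bar>w s * h s - w s * ?p s\<bar> \<partial>M)"
        using integral_norm_bound[of M "\<lambda>s. w s * h s - w s * ?p s"] by simp
      also have "\<dots> \<le> (\<integral>s. e * \<bar>w s\<bar> \<partial>M)"
      proof (rule integral_mono)
        show "integrable M (\<lambda>s. \<bar>w s * h s - w s * ?p s\<bar>)"
          using ih ip by simp
        show "integrable M (\<lambda>s. e * \<bar>w s\<bar>)"
          using abs by simp
        fix s
        assume "s \<in> space M"
        then have "s \<in> {-\<epsilon>..\<epsilon>}"
          by auto
        then have "\<bar>h s - ?p s\<bar> \<le> e"
          using g(2)[of "cos (\<theta> s)"] hk p by (auto simp: less_imp_le)
        then have "\<bar>w s\<bar> * \<bar>h s - ?p s\<bar> \<le> \<bar>w s\<bar> * e"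
          by (rule mult_left_mono) simp
        then show "\<bar>w s * h s - w s * ?p s\<bar> \<le> e * \<bar>w s\<bar>"
          by (simp add: abs_mult[symmetric] right_diff_distrib mult.commute)
      qed
      finally show ?thesis
        by simp
    qed
    then have le: "\<bar>\<integral>s. w s * h s \<partial>M\<bar> \<le> e * ?W" if "e > 0" for e
      using that .
    have W: "?W \<ge> 0"
      by simp
    then have W1: "?W + 1 > 0"
      by linarith
    have "\<bar>\<integral>s. w s * h s \<partial>M\<bar> \<le> 0 + e" if "e > 0" for e
    proof -
      \<comment> \<open>Division by \<open>?W + 1\<close> covers the case
        \<open>?W = 0\<close>.\<close>
      have "\<bar>\<integral>s. w s * h s \<partial>M\<bar> \<le> e / (?W + 1) * ?W"
        by (rule le[OF divide_pos_pos[OF that W1]])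
      also have "\<dots> \<le> e"
        using that W W1 by (simp add: field_simps)
      finally show ?thesis
        by simp
    qed
    then have "\<bar>\<integral>s. w s * h s \<partial>M\<bar> \<le> 0"
      by (rule field_le_epsilon)
    then show ?thesis
      by simp
  qed
  have "(\<lambda>s. sgn (w s)) measurable_on {-\<epsilon><..<\<epsilon>}"
    by (subst measurable_on_iff_borel_measurable) auto
  then obtain N g where N: "negligible N" and g: "\<And>n. continuous_on UNIV (g n)"
    and lim: "\<And>x. x \<notin> N \<Longrightarrow> (\<lambda>n. g n x) \<longlonglongrightarrow> (if x \<in> {-\<epsilon><..<\<epsilon>} then sgn (w x) else 0)"
    unfolding measurable_on_def by blast
  \<comment> \<open>Truncation to [-1, 1] leaves the limit, the sign of w, unchanged and provides
    |w| as dominating function.\<close>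
  define t where "t n x = max (- 1) (min 1 (g n x))" for n x
  have t: "continuous_on UNIV (t n)" for n
    unfolding t_def by (intro continuous_intros g)
  have [measurable]: "t n \<in> borel_measurable M" for n
    by (intro continuous_measurable continuous_on_subset[OF t]) auto
  have "(\<lambda>n. \<integral>s. w s * t n s \<partial>M) \<longlonglongrightarrow> (\<integral>s. w s * sgn (w s) \<partial>M)"
  proof (rule integral_dominated_convergence)
    show "integrable M (\<lambda>s. \<bar>w s\<bar>)"
      by (rule abs)
    show "AE s in M. norm (w s * t n s) \<le> \<bar>w s\<bar>" for n
      by (rule AE_I2) (auto simp: abs_mult t_def intro!: mult_left_le)
    have "AE s in lebesgue. s \<notin> N"
      using N by (simp add: negligible_iff_null_sets AE_not_in)
    then have "AE s in M. s \<notin> N"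
      by (auto simp: AE_restrict_space_iff elim: eventually_mono)
    then show "AE s in M. (\<lambda>n. w s * t n s) \<longlonglongrightarrow> w s * sgn (w s)"
    proof (rule AE_mp, intro AE_I2 impI)
      fix s
      assume "s \<in> space M" "s \<notin> N"
      then have "(\<lambda>n. g n s) \<longlonglongrightarrow> sgn (w s)"
        using lim[of s] by simp
      then have "(\<lambda>n. t n s) \<longlonglongrightarrow> max (- 1) (min 1 (sgn (w s)))"
        unfolding t_def by (intro tendsto_intros)
      moreover have "max (- 1) (min 1 (sgn (w s))) = sgn (w s)"
        by (simp add: sgn_if)
      ultimately show "(\<lambda>n. w s * t n s) \<longlonglongrightarrow> w s * sgn (w s)"
        by (intro tendsto_intros) simp
    qed
  qed measurable
  then have "(\<integral>s. \<bar>w s\<bar> \<partial>M) = 0"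
    using zero[OF t] by (simp add: LIMSEQ_const_iff abs_sgn mult.commute)
  then have "AE s in M. \<bar>w s\<bar> = 0"
    using abs by (subst (asm) integral_nonneg_eq_0_iff_AE) auto
  then show ?thesis
    by simp
qed

lemma moments_zero:
  fixes w :: "real \<Rightarrow> complex"
  assumes w: "integrable M w" and mom: "\<And>p. (\<integral>s. w s * of_real (poly p (cos (\<theta> s))) \<partial>M) = 0"
  shows "AE s in M. w s = 0"
proof -
  have int: "integrable M (\<lambda>s. w s * of_real (poly p (cos (\<theta> s))))" for p
  proof -
    have c: "continuous_on {-\<epsilon>..\<epsilon>} (\<lambda>s. complex_of_real (poly p (cos (\<theta> s))))"
      by (intro continuous_intros)
    obtain B where B: "\<forall>y\<in>(\<lambda>s. complex_of_real (poly p (cos (\<theta> s)))) ` {-\<epsilon>..\<epsilon>}. norm y \<le> B"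
      using compact_imp_bounded[OF compact_continuous_image[OF c compact_Icc]]
          unfolding bounded_iff by blast
    show ?thesis
    proof (rule Bochner_Integration.integrable_bound)
      show "integrable M (\<lambda>s. B * cmod (w s))"
        using w by simp
      show "(\<lambda>s. w s * complex_of_real (poly p (cos (\<theta> s)))) \<in> borel_measurable M"
        by (intro borel_measurable_times borel_measurable_integrable[OF w]
            continuous_measurable[OF continuous_on_subset[OF c]]) auto
      show "AE s in M. norm (w s * complex_of_real (poly p (cos (\<theta> s)))) \<le> norm (B * cmod (w s))"
      proof (rule AE_I2)
        fix s
        assume "s \<in> space M"
        then have "s \<in> {-\<epsilon>..\<epsilon>}"
          by auto
        then have "cmod (of_real (poly p (cos (\<theta> s)))) \<le> B"
          using B by blast
        then have "cmod (of_real (poly p (cos (\<theta> s)))) \<le> \<bar>B\<bar>"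
          by linarith
        then have "cmod (w s) * cmod (of_real (poly p (cos (\<theta> s)))) \<le> cmod (w s) * \<bar>B\<bar>"
          by (intro mult_left_mono) auto
        then show "norm (w s * complex_of_real (poly p (cos (\<theta> s)))) \<le> norm (B * cmod (w s))"
          by (simp only: norm_mult real_norm_def abs_mult abs_norm_cancel mult.commute)
      qed
    qed
  qed
  have "AE s in M. Re (w s) = 0"
  proof (rule moments_zero_real)
    show "integrable M (\<lambda>s. Re (w s))"
      using w by simp
    show "(\<integral>s. Re (w s) * poly p (cos (\<theta> s)) \<partial>M) = 0" for p
      using integral_Re[OF int[of p]] mom[of p] by simp
  qed
  moreover have "AE s in M. Im (w s) = 0"
  proof (rule moments_zero_real)
    show "integrable M (\<lambda>s. Im (w s))"
      using w by simp
    show "(\<integral>s. Im (w s) * poly p (cos (\<theta> s)) \<partial>M) = 0" for p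
      using integral_Im[OF int[of p]] mom[of p] by simp
  qed
  ultimately show ?thesis
    by eventually_elim (simp add: complex_eq_iff)
qed

end

section \<open>Cutoffs near the singular end points\<close>

text \<open>An arbitrary polynomial in 1 / t makes the family closed under differentiation. The
  parameter a is the scale on which exp (- a / t) rises towards 1.\<close>

definition flat :: "real poly \<Rightarrow> real \<Rightarrow> real \<Rightarrow> real" where
  "flat p a t = (if t > 0 then poly p (1 / t) * exp (- a / t) else 0)"

lemma power_times_exp_tendsto_0:
  assumes a: "(a :: real) > 0"
  shows "((\<lambda>u. u ^ k * exp (- a * u)) \<longlongrightarrow> 0) at_top"
proof -
  have "filterlim (\<lambda>u. a * u) at_top at_top"
    using a by (intro filterlim_tendsto_pos_mult_at_top[OF tendsto_const _ filterlim_ident])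
  from filterlim_compose[OF tendsto_power_div_exp_0 this, of k]
  have "((\<lambda>u. (a * u) ^ k / exp (a * u) / a ^ k) \<longlongrightarrow> 0 / a ^ k) at_top"
    using a by (intro tendsto_divide tendsto_const) auto
  then show ?thesis
    using a by (simp add: power_mult_distrib exp_minus field_simps)
qed

lemma poly_times_exp_tendsto_0:
  assumes a: "(a :: real) > 0"
  shows "((\<lambda>u. poly p u * exp (- a * u)) \<longlongrightarrow> 0) at_top"
proof -
  \<comment> \<open>The extra power u^k makes the induction over the coefficients go
    through.\<close>
  have "((\<lambda>u. u ^ k * poly p u * exp (- a * u)) \<longlongrightarrow> 0) at_top" for k
  proof (induction p arbitrary: k)
    case (pCons c p)
    have "((\<lambda>u. c * (u ^ k * exp (- a * u)) + u ^ Suc k * poly p u * exp (- a * u)) \<longlongrightarrow> c * 0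
        + 0) at_top"
      by (intro tendsto_intros power_times_exp_tendsto_0 a pCons)
    then show ?case
      by (simp add: algebra_simps)
  qed simp
  from this[of 0] show ?thesis
    by simp
qed

text \<open>In the variable u = 1 / t, differentiation sends p to u^2 (a p - p'). At t = 0 the
  difference quotient from the right is u p(u) exp (- a u), which tends to 0.\<close>

lemma flat_deriv:
  assumes a: "a > 0"
  shows "(flat p a has_real_derivative flat ([:0, 0, 1:] * (smult a p - pderiv p)) a t) (at t)"
proof -
  let ?q = "[:0, 0, 1:] * (smult a p - pderiv p)"
  consider "t > 0" | "t < 0" | "t = 0"
    by linarith
  then show ?thesis
  proof cases
    case 1
    have "((\<lambda>t. poly p (1 / t) * exp (- a / t)) has_real_derivative poly ?q (1 / t) * exp (- a /
        t)) (at t)"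
      using 1 by (auto intro!: derivative_eq_intros DERIV_chain'[OF _ poly_DERIV]
          simp: field_simps power2_eq_square)
    then have "((\<lambda>t. poly p (1 / t) * exp (- a / t)) has_real_derivative flat ?q a t) (at t)"
      using 1 by (simp add: flat_def)
    then show ?thesis
      by (rule has_field_derivative_transform_within_open[where S = "{0<..}"])
        (use 1 in \<open>auto simp: flat_def\<close>)
  next
    case 2
    have "((\<lambda>t. 0) has_real_derivative flat ?q a t) (at t)"
      using 2 by (simp add: flat_def)
    then show ?thesis
      by (rule has_field_derivative_transform_within_open[where S = "{..<0}"])
        (use 2 in \<open>auto simp: flat_def\<close>)
  next
    case 3
    have "((\<lambda>t. poly ([:0, 1:] * p) (inverse t) * exp (- a * inverse t)) \<longlongrightarrow> 0) (at_right 0)"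
      by (rule filterlim_compose[OF poly_times_exp_tendsto_0[OF a] filterlim_inverse_at_top_right])
    then have "((\<lambda>t. (flat p a t - flat p a 0) / (t - 0)) \<longlongrightarrow> 0) (at_right 0)"
    proof (rule Lim_transform_eventually)
      show "\<forall>\<^sub>F t in at_right 0. poly ([:0, 1:] * p) (inverse t) * exp (- a * inverse t)
          = (flat p a t - flat p a 0) / (t - 0)"
        unfolding eventually_at_right_field
        by (intro exI[of _ 1]) (auto simp: flat_def field_simps)
    qed
    moreover have "((\<lambda>t. (flat p a t - flat p a 0) / (t - 0)) \<longlongrightarrow> 0) (at_left 0)"
    proof (rule tendsto_eventually)
      show "\<forall>\<^sub>F t in at_left 0. (flat p a t - flat p a 0) / (t - 0) = 0"
        unfolding eventually_at_left_field
        by (intro exI[of _ "-1"]) (auto simp: flat_def)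
    qed
    ultimately have "((\<lambda>t. (flat p a t - flat p a 0) / (t - 0)) \<longlongrightarrow> 0) (at 0)"
      by (simp add: filterlim_split_at)
    then show ?thesis
      using 3 by (simp add: has_field_derivative_iff flat_def)
  qed
qed

lemma flat_1_bounds: "a > 0 \<Longrightarrow> 0 \<le> flat 1 a t" "a > 0 \<Longrightarrow> flat 1 a t \<le> 1"
  by (auto simp: flat_def)

lemma flat_1_deriv_eq: "flat ([:0, 0, 1:] * (smult a 1 - pderiv 1)) a t
  = (if t > 0 then a / t\<^sup>2 * exp (- a / t) else 0)"
  by (simp add: flat_def power2_eq_square)

text \<open>The bound is uniform in a. For t > 0 and v = a / t the left side is (v + v^2) exp (- v),
  and exp v \<ge> 1 + v + v^2 / 2 gives the constant 2. In the cutoff, t + a becomes the distance to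
  an end point.\<close>

lemma flat_1_deriv_bound:
  assumes a: "a > 0"
  shows "\<bar>flat ([:0, 0, 1:] * (smult a 1 - pderiv 1)) a t\<bar> * \<bar>t + a\<bar> \<le> 2"
proof (cases "t > 0")
  case True
  define v where "v = a / t"
  have v: "v > 0"
    using True a by (simp add: v_def)
  have "v + v\<^sup>2 \<le> 2 * exp v"
    using exp_lower_Taylor_quadratic[of v] v by simp
  then have "(v + v\<^sup>2) * exp (- v) \<le> 2"
    by (simp add: exp_minus field_simps)
  moreover have "\<bar>a / t\<^sup>2 * exp (- a / t)\<bar> * \<bar>t + a\<bar> = (v + v\<^sup>2) * exp (- v)"
    using True a by (simp add: v_def abs_mult field_simps power2_eq_square)
  ultimately show ?thesis
    unfolding flat_1_deriv_eq using True by simp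
next
  case False
  then show ?thesis
    unfolding flat_1_deriv_eq by simp
qed

section \<open>Derivatives of vector valued functions and the components of
  \<open>T0_fun\<close>\<close>

lemma bounded_linear_vec2: "bounded_linear (\<lambda>p. vec2 (fst p) (snd p))"
  unfolding linear_conv_bounded_linear[symmetric]
  by (rule linearI) (auto intro!: vec2_eqI)

lemma has_vector_derivative_vec2:
  assumes "(u has_vector_derivative u') (at s within A)"
      "(v has_vector_derivative v') (at s within A)"
  shows "((\<lambda>s. vec2 (u s) (v s)) has_vector_derivative vec2 u' v') (at s within A)"
  using bounded_linear.has_vector_derivative[OF bounded_linear_vec2 has_vector_derivative_Pair[OF
      assms]]
  by simp

lemma tendsto_vec2: "(f \<longlongrightarrow> a) F \<Longrightarrow> (g \<longlongrightarrow> b) F \<Longrightarrow> ((\<lambda>s. vec2 (f s) (g s)) \<longlongrightarrow> vec2 a b) F"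
  using bounded_linear.tendsto[OF bounded_linear_vec2 tendsto_Pair, of f a F g b] by simp

lemma vec2_smult: "c *s vec2 a b = vec2 (c * a) (c * b)"
  by (rule vec2_eqI) simp_all

lemma vec2_add: "vec2 a b + vec2 a' b' = vec2 (a + a') (b + b')"
  by (rule vec2_eqI) simp_all

lemma vec2_diff: "vec2 a b - vec2 a' b' = vec2 (a - a') (b - b')"
  by (rule vec2_eqI) simp_all

lemma norm_vec2_le: "norm (vec2 a b) \<le> cmod a + cmod b"
proof (rule power2_le_imp_le)
  show "(norm (vec2 a b))\<^sup>2 \<le> (cmod a + cmod b)\<^sup>2"
    by (simp add: norm_vec2_sq power2_sum)
qed simp

lemma gamma1_mult: "gamma1 *v w = vec2 (w $ 2) (w $ 1)"
  by (rule vec2_eqI) (simp_all add: gamma1_def matrix_vector_mult_def sum_2)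

lemma gamma2_mult: "gamma2 *v w = vec2 (- \<i> * w $ 2) (\<i> * w $ 1)"
  by (rule vec2_eqI) (simp_all add: gamma2_def matrix_vector_mult_def sum_2)

lemma T0_fun_eq:
  assumes "(\<psi> has_vector_derivative \<psi>') (at s)"
  shows "T0_fun \<epsilon> \<psi> s = vec2 (\<i> * (\<psi>' $ 2 - of_real (potential \<epsilon> s) * \<psi> s $ 2))
    (\<i> * (\<psi>' $ 1 + of_real (potential \<epsilon> s) * \<psi> s $ 1))"
  unfolding T0_fun_def vector_derivative_at[OF assms] gamma1_mult gamma2_mult
  by (simp add: vec2_smult vec2_add algebra_simps)

context interval
begin

text \<open>An algebra that is closed under differentiation and contains the components of the basis
  functions and the cutoffs. Membership yields all higher derivatives by induction, so smoothness is
  not computed case by case.\<close>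

inductive_set alg :: "(real \<Rightarrow> complex) set" where
  alg_const: "(\<lambda>_. c) \<in> alg"
| alg_sin: "(\<lambda>s. of_real (sin (\<theta> s))) \<in> alg"
| alg_cos: "(\<lambda>s. of_real (cos (\<theta> s))) \<in> alg"
| alg_flat_left: "a > 0 \<Longrightarrow> (\<lambda>s. of_real (flat p a (s - c))) \<in> alg"
| alg_flat_right: "a > 0 \<Longrightarrow> (\<lambda>s. of_real (flat p a (c - s))) \<in> alg"
| alg_add: "f \<in> alg \<Longrightarrow> g \<in> alg \<Longrightarrow> (\<lambda>s. f s + g s) \<in> alg"
| alg_mult: "f \<in> alg \<Longrightarrow> g \<in> alg \<Longrightarrow> (\<lambda>s. f s * g s) \<in> alg"

lemma of_real_deriv:
  assumes "(f has_real_derivative f') (at s)"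
  shows "((\<lambda>s. complex_of_real (f s)) has_vector_derivative of_real f') (at s)"
  using assms has_vector_derivative_of_real by blast

lemma alg_deriv: "f \<in> alg \<Longrightarrow> \<exists>f'\<in>alg. \<forall>s. (f has_vector_derivative f' s) (at s)"
proof (induction rule: alg.induct)
  case (alg_const c)
  show ?case
    by (rule bexI[OF _ alg.alg_const[of 0]]) simp
next
  case alg_sin
  have m: "(\<lambda>s. of_real \<alpha> * of_real (cos (\<theta> s))) \<in> alg"
    by (intro alg.intros)
  have d: "((\<lambda>s. complex_of_real (sin (\<theta> s))) has_vector_derivative of_real \<alpha> * of_real (cos (\<theta>
      s))) (at s)" for s
    unfolding of_real_mult[symmetric]
    by (rule of_real_deriv) (auto intro!: derivative_eq_intros)
  show ?case
    by (rule bexI[OF _ m], rule allI, rule d)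
next
  case alg_cos
  have m: "(\<lambda>s. of_real (- \<alpha>) * of_real (sin (\<theta> s))) \<in> alg"
    by (intro alg.intros)
  have d: "((\<lambda>s. complex_of_real (cos (\<theta> s))) has_vector_derivative of_real (- \<alpha>) * of_real (sin
      (\<theta> s))) (at s)" for s
    unfolding of_real_mult[symmetric]
    by (rule of_real_deriv) (auto intro!: derivative_eq_intros)
  show ?case
    by (rule bexI[OF _ m], rule allI, rule d)
next
  case (alg_flat_left a p c)
  let ?q = "[:0, 0, 1:] * (smult a p - pderiv p)"
  have d: "((\<lambda>s. complex_of_real (flat p a (s - c))) has_vector_derivative of_real (flat ?q a (s
      - c))) (at s)" for s
  proof (rule of_real_deriv)
    have "((\<lambda>s. s - c) has_real_derivative 1) (at s)"
      by (auto intro!: derivative_eq_intros)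
    from DERIV_chain2[OF flat_deriv[OF alg_flat_left] this]
    show "((\<lambda>s. flat p a (s - c)) has_real_derivative flat ?q a (s - c)) (at s)"
      by simp
  qed
  show ?case
    by (rule bexI[OF _ alg.alg_flat_left[OF alg_flat_left, of ?q c]], rule allI, rule d)
next
  case (alg_flat_right a p c)
  let ?q = "[:0, 0, 1:] * (smult a p - pderiv p)"
  have d: "((\<lambda>s. complex_of_real (flat p a (c
      - s))) has_vector_derivative of_real (- 1) * of_real (flat ?q a (c - s))) (at s)" for s
    unfolding of_real_mult[symmetric]
  proof (rule of_real_deriv)
    have "((\<lambda>s. c - s) has_real_derivative - 1) (at s)"
      by (auto intro!: derivative_eq_intros)
    from DERIV_chain2[OF flat_deriv[OF alg_flat_right] this]
    show "((\<lambda>s. flat p a (c - s)) has_real_derivative - 1 * flat ?q a (c - s)) (at s)"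
      by simp
  qed
  have m: "(\<lambda>s. of_real (- 1) * of_real (flat ?q a (c - s))) \<in> alg"
    by (intro alg.intros alg_flat_right)
  show ?case
    by (rule bexI[OF _ m], rule allI, rule d)
next
  case (alg_add f g)
  then obtain f' g' where "f' \<in> alg" "g' \<in> alg"
    "\<And>s. (f has_vector_derivative f' s) (at s)" "\<And>s. (g has_vector_derivative g' s) (at s)"
    by blast
  then show ?case
    by (intro bexI[of _ "\<lambda>s. f' s + g' s"] allI has_vector_derivative_add alg.intros)
next
  case (alg_mult f g)
  then obtain f' g' where "f' \<in> alg" "g' \<in> alg"
    "\<And>s. (f has_vector_derivative f' s) (at s)" "\<And>s. (g has_vector_derivative g' s) (at s)"
    by blast
  then show ?case
    using alg_mult.hyps
    by (intro bexI[of _ "\<lambda>s. f s * g' s + f' s * g s"] allI has_vector_derivative_mult alg.intros)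
qed

lemma alg_continuous: "f \<in> alg \<Longrightarrow> continuous_on X f"
  using alg_deriv[of f] by (meson continuous_at_imp_continuous_on has_vector_derivative_continuous)

lemma alg_poly_cos: "(\<lambda>s. of_real (poly p (cos (\<theta> s)))) \<in> alg"
proof (induction p)
  case 0
  show ?case
    using alg_const[of 0] by simp
next
  case (pCons c p)
  have "(\<lambda>s. of_real c + of_real (cos (\<theta> s)) * of_real (poly p (cos (\<theta> s)))) \<in> alg"
    by (intro alg.intros pCons)
  then show ?case
    by simp
qed

lemma smooth_alg:
  assumes "u \<in> alg" "v \<in> alg"
  shows "smooth (\<lambda>s. vec2 (u s) (v s))"
proof -
  have "\<exists>u' v'. u' \<in> alg \<and> v' \<in> alg \<and>
      ((\<lambda>\<xi> s. vector_derivative \<xi> (at s)) ^^ n) (\<lambda>s. vec2 (u s) (v s)) =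
          (\<lambda>s. vec2 (u' s) (v' s))" for n
  proof (induction n)
    case 0
    then show ?case
      using assms by auto
  next
    case (Suc n)
    then obtain u1 v1 where 1: "u1 \<in> alg" "v1 \<in> alg"
      "((\<lambda>\<xi> s. vector_derivative \<xi> (at s)) ^^ n) (\<lambda>s. vec2 (u s) (v s)) = (\<lambda>s. vec2 (u1 s) (v1 s))"
      by blast
    obtain u2 v2 where 2: "u2 \<in> alg" "v2 \<in> alg"
      "\<And>s. (u1 has_vector_derivative u2 s) (at s)" "\<And>s. (v1 has_vector_derivative v2 s) (at s)"
      using alg_deriv[OF 1(1)] alg_deriv[OF 1(2)] by blast
    have "((\<lambda>\<xi> s. vector_derivative \<xi> (at s)) ^^ Suc n) (\<lambda>s. vec2 (u s) (v s))
        = (\<lambda>s. vec2 (u2 s) (v2 s))"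
      using vector_derivative_at[OF has_vector_derivative_vec2[OF 2(3,4)]] by (simp add: 1(3))
    then show ?case
      using 2(1,2) by blast
  qed
  moreover have "(\<lambda>s. vec2 (u s) (v s)) differentiable_on UNIV" if uv: "u \<in> alg" "v \<in> alg" for u v
  proof -
    obtain u2 v2 where "\<And>s. (u has_vector_derivative u2 s) (at s)"
        "\<And>s. (v has_vector_derivative v2 s) (at s)"
      using alg_deriv[OF uv(1)] alg_deriv[OF uv(2)] by blast
    then show ?thesis
      unfolding differentiable_on_def using has_vector_derivative_vec2
      by (meson differentiableI_vector)
  qed
  ultimately show ?thesis
    unfolding smooth_def by metis
qed

text \<open>A factor sin \<theta> cancels the pole of the potential at both end points.\<close>

lemma potential_sin: "s \<in> {-\<epsilon><..<\<epsilon>} \<Longrightarrow> potential \<epsilon> s * sin (\<theta> s) = - (\<alpha> * cos (\<theta> s))"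
proof -
  assume s: "s \<in> {-\<epsilon><..<\<epsilon>}"
  have "\<theta> s = \<alpha> * s + pi / 2"
    using eps_pos by (simp add: \<theta>_def alpha_def field_simps)
  then have sc: "sin (\<theta> s) = cos (\<alpha> * s)" "cos (\<theta> s) = - sin (\<alpha> * s)"
    by (simp_all add: sin_add cos_add)
  then have "cos (\<alpha> * s) \<noteq> 0"
    using sin_\<theta>_pos[OF s] by simp
  then show ?thesis
    by (simp add: potential_def tan_def sc)
qed

lemma cl_cong:
  assumes "\<xi> \<in> S" "\<And>s. s \<in> {-\<epsilon><..<\<epsilon>} \<Longrightarrow> \<psi> s = \<xi> s"
  shows "\<psi> \<in> S" "cl \<psi> = cl \<xi>"
proof -
  have "\<psi> \<in> borel_measurable M"
    by (rule measurable_cong[THEN iffD1, OF _ S_measurable[OF assms(1)]]) (simp add: assms(2))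
  moreover have "integrable M (\<lambda>s. (norm (\<psi> s))\<^sup>2)"
    by (rule Bochner_Integration.integrable_cong[THEN iffD1, OF refl _ ])
      (use assms in \<open>auto simp: S_iff\<close>)
  ultimately show *: "\<psi> \<in> S"
    by (simp add: S_iff)
  show "cl \<psi> = cl \<xi>"
    by (rule cl_eqI[OF * assms(1)]) (rule AE_I2, simp add: assms(2))
qed

text \<open>Supported in \<open>{a - \<epsilon>..\<epsilon> - a}\<close>. There is no plateau, but
  at each interior point the value tends to 1 as a tends to 0. Both arguments of
  \<open>flat\<close>, increased by a, are the distances to the end points.\<close>

definition cutoff :: "real \<Rightarrow> real \<Rightarrow> real" where
  "cutoff a s = flat 1 a (s - (a - \<epsilon>)) * flat 1 a (\<epsilon> - a - s)"

definition cutoff' :: "real \<Rightarrow> real \<Rightarrow> real" where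
  "cutoff' a s = (let q = [:0, 0, 1:] * (smult a 1 - pderiv 1) in
     flat q a (s - (a - \<epsilon>)) * flat 1 a (\<epsilon> - a - s) - flat 1 a (s - (a - \<epsilon>)) * flat q a (\<epsilon> - a - s))"

lemma cutoff_deriv:
  assumes "a > 0"
  shows "(cutoff a has_real_derivative cutoff' a s) (at s)"
proof -
  let ?q = "[:0, 0, 1:] * (smult a 1 - pderiv 1)"
  have "((\<lambda>s. s - (a - \<epsilon>)) has_real_derivative 1) (at s)" "((\<lambda>s. \<epsilon> - a - s) has_real_derivative
      - 1) (at s)"
    by (auto intro!: derivative_eq_intros)
  note d = this[THEN DERIV_chain2[OF flat_deriv[OF assms]]]
  show ?thesis
    unfolding cutoff_def[abs_def] cutoff'_def Let_def
    by (rule DERIV_cong[OF DERIV_mult[OF d]]) (simp add: algebra_simps)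
qed

lemma cutoff_bounds: "a > 0 \<Longrightarrow> 0 \<le> cutoff a s" "a > 0 \<Longrightarrow> cutoff a s \<le> 1"
  using flat_1_bounds[of a] by (auto simp: cutoff_def mult_le_one)

text \<open>The derivative of the cutoff is bounded by a multiple of the inverse distances to the
  end points, and sin \<theta> by \<alpha> times each of these distances. Each end point contributes
  2 \<alpha>, independently of a.\<close>

lemma cutoff'_bound:
  assumes a: "a > 0" and s: "s \<in> {-\<epsilon>..\<epsilon>}"
  shows "\<bar>cutoff' a s\<bar> * \<bar>sin (\<theta> s)\<bar> \<le> 4 * \<alpha>"
proof -
  let ?q = "[:0, 0, 1:] * (smult a 1 - pderiv 1)"
  let ?l = "s - (a - \<epsilon>)" and ?r = "\<epsilon> - a - s"
  have "\<bar>sin (\<theta> s)\<bar> \<le> \<bar>\<theta> s\<bar>"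
    by (rule abs_sin_x_le_abs_x) 
  then have l: "\<bar>sin (\<theta> s)\<bar> \<le> \<alpha> * \<bar>?l + a\<bar>"
    using \<theta>_range(1)[OF s] s by (simp add: \<theta>_def)
  have "\<bar>sin (\<theta> s)\<bar> \<le> \<bar>pi - \<theta> s\<bar>"
    using abs_sin_x_le_abs_x[of "pi - \<theta> s"] by simp
  moreover have "pi - \<theta> s = \<alpha> * (?r + a)"
    unfolding \<theta>_ends(2)[symmetric] by (simp add: \<theta>_def algebra_simps)
  ultimately have r: "\<bar>sin (\<theta> s)\<bar> \<le> \<alpha> * \<bar>?r + a\<bar>"
    using alpha_pos by (simp add: abs_mult)
  have f: "\<bar>flat 1 a t\<bar> \<le> 1" for t
    using flat_1_bounds[OF a, of t] by simp
  have "\<bar>flat ?q a ?l * flat 1 a ?r\<bar> * \<bar>sin (\<theta> s)\<bar> \<le> \<bar>flat ?q a ?l\<bar> * \<bar>sin (\<theta> s)\<bar>"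
    using f[of ?r] by (simp add: abs_mult mult_right_mono mult_left_le)
  also have "\<dots> \<le> \<bar>flat ?q a ?l\<bar> * (\<alpha> * \<bar>?l + a\<bar>)"
    using l by (rule mult_left_mono) simp
  also have "\<dots> = \<alpha> * (\<bar>flat ?q a ?l\<bar> * \<bar>?l + a\<bar>)"
    by (simp only: mult_ac)
  also have "\<dots> \<le> \<alpha> * 2"
    using alpha_pos by (intro mult_left_mono flat_1_deriv_bound[OF a]) simp
  finally have 1: "\<bar>flat ?q a ?l * flat 1 a ?r\<bar> * \<bar>sin (\<theta> s)\<bar> \<le> \<alpha> * 2" .
  have "\<bar>flat 1 a ?l * flat ?q a ?r\<bar> * \<bar>sin (\<theta> s)\<bar> \<le> \<bar>flat ?q a ?r\<bar> * \<bar>sin (\<theta> s)\<bar>"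
    using f[of ?l] by (simp add: abs_mult mult_right_mono mult_right_le_one_le mult_left_le_one_le)
  also have "\<dots> \<le> \<bar>flat ?q a ?r\<bar> * (\<alpha> * \<bar>?r + a\<bar>)"
    using r by (rule mult_left_mono) simp
  also have "\<dots> = \<alpha> * (\<bar>flat ?q a ?r\<bar> * \<bar>?r + a\<bar>)"
    by (simp only: mult_ac)
  also have "\<dots> \<le> \<alpha> * 2"
    using alpha_pos by (intro mult_left_mono flat_1_deriv_bound[OF a]) simp
  finally have 2: "\<bar>flat 1 a ?l * flat ?q a ?r\<bar> * \<bar>sin (\<theta> s)\<bar> \<le> \<alpha> * 2" .
  have "\<bar>cutoff' a s\<bar> * \<bar>sin (\<theta> s)\<bar>
      \<le> (\<bar>flat ?q a ?l * flat 1 a ?r\<bar> + \<bar>flat 1 a ?l * flat ?q a ?r\<bar>) * \<bar>sin (\<theta> s)\<bar>"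
    unfolding cutoff'_def Let_def by (intro mult_right_mono abs_triangle_ineq4) simp
  also have "\<dots> \<le> 4 * \<alpha>"
    unfolding distrib_right using 1 2 by linarith
  finally show ?thesis .
qed

lemma flat_tendsto:
  assumes d: "d > 0" and a: "a \<longlonglongrightarrow> 0" and t: "t \<longlonglongrightarrow> d"
  shows "(\<lambda>n. flat 1 (a n) (t n)) \<longlonglongrightarrow> 1"
    and "(\<lambda>n. flat ([:0, 0, 1:] * (smult (a n) 1 - pderiv 1)) (a n) (t n)) \<longlonglongrightarrow> 0"
proof -
  have ev: "\<forall>\<^sub>F n in sequentially. t n > 0"
    using order_tendstoD(1)[OF t d] .
  have "(\<lambda>n. exp (- a n / t n)) \<longlonglongrightarrow> exp (- 0 / d)"
    using d by (intro tendsto_intros a t) simp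
  then have "(\<lambda>n. exp (- a n / t n)) \<longlonglongrightarrow> 1"
    by simp
  then show "(\<lambda>n. flat 1 (a n) (t n)) \<longlonglongrightarrow> 1"
    by (rule Lim_transform_eventually) (use ev in \<open>auto elim!: eventually_mono simp: flat_def\<close>)
  have "(\<lambda>n. a n / (t n)\<^sup>2 * exp (- a n / t n)) \<longlonglongrightarrow> 0 / d\<^sup>2 * exp (- 0 / d)"
    using d by (intro tendsto_intros a t) simp_all
  then have "(\<lambda>n. a n / (t n)\<^sup>2 * exp (- a n / t n)) \<longlonglongrightarrow> 0"
    by simp
  then show "(\<lambda>n. flat ([:0, 0, 1:] * (smult (a n) 1 - pderiv 1)) (a n) (t n)) \<longlonglongrightarrow> 0"
    unfolding flat_1_deriv_eq
    by (rule Lim_transform_eventually) (use ev in \<open>auto elim!: eventually_mono\<close>)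
qed

lemma cutoff_tendsto:
  assumes s: "s \<in> {-\<epsilon><..<\<epsilon>}" and a: "a \<longlonglongrightarrow> 0"
  shows "(\<lambda>n. cutoff (a n) s) \<longlonglongrightarrow> 1" "(\<lambda>n. cutoff' (a n) s) \<longlonglongrightarrow> 0"
proof -
  have l: "(\<lambda>n. s - (a n - \<epsilon>)) \<longlonglongrightarrow> s - (0 - \<epsilon>)" and r: "(\<lambda>n. \<epsilon> - a n - s) \<longlonglongrightarrow> \<epsilon> - 0 - s"
    by (intro tendsto_intros a)+
  have d: "s - (0 - \<epsilon>) > 0" "\<epsilon> - 0 - s > 0"
    using s by auto
  note L = flat_tendsto[OF d(1) a l] and R = flat_tendsto[OF d(2) a r]
  show "(\<lambda>n. cutoff (a n) s) \<longlonglongrightarrow> 1"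
    unfolding cutoff_def using tendsto_mult[OF L(1) R(1)] by simp
  show "(\<lambda>n. cutoff' (a n) s) \<longlonglongrightarrow> 0"
    unfolding cutoff'_def Let_def
    using tendsto_diff[OF tendsto_mult[OF L(2) R(1)] tendsto_mult[OF L(1) R(2)]] by simp
qed

lemma cutoff_alg:
  assumes "a > 0"
  shows "(\<lambda>s. of_real (cutoff a s)) \<in> alg" "(\<lambda>s. of_real (cutoff' a s)) \<in> alg"
proof -
  have "(\<lambda>s. of_real (flat 1 a (s - (a - \<epsilon>))) * of_real (flat 1 a (\<epsilon> - a - s))) \<in> alg"
    by (intro alg.intros assms)
  then show "(\<lambda>s. of_real (cutoff a s)) \<in> alg"
    by (simp add: cutoff_def)
  let ?q = "[:0, 0, 1:] * (smult a 1 - pderiv 1)"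
  have "(\<lambda>s. of_real (flat ?q a (s - (a - \<epsilon>))) * of_real (flat 1 a (\<epsilon> - a - s))
      + of_real (- 1) * (of_real (flat 1 a (s - (a - \<epsilon>))) * of_real (flat ?q a (\<epsilon> - a - s)))) \<in> alg"
    by (intro alg.intros assms)
  then show "(\<lambda>s. of_real (cutoff' a s)) \<in> alg"
    by (simp add: cutoff'_def Let_def)
qed

lemma cutoff_support: "a > 0 \<Longrightarrow> cutoff a s \<noteq> 0 \<Longrightarrow> s \<in> {a - \<epsilon>..\<epsilon> - a}"
  by (auto simp: cutoff_def flat_def split: if_splits)

lemma L2_convergence:
  assumes f: "\<And>n. f n \<in> S" and g: "g \<in> S"
    and bound: "\<And>n s. s \<in> {-\<epsilon><..<\<epsilon>} \<Longrightarrow> norm (f n s - g s) \<le> B"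
    and lim: "\<And>s. s \<in> {-\<epsilon><..<\<epsilon>} \<Longrightarrow> (\<lambda>n. f n s) \<longlonglongrightarrow> g s"
  shows "(\<lambda>n. hnorm L2 (hsub L2 (cl g) (cl (f n)))) \<longlonglongrightarrow> 0"
proof -
  have [measurable]: "f n \<in> borel_measurable M" "g \<in> borel_measurable M" for n
    by (intro S_measurable f g)+
  have "(\<lambda>n. \<integral>s. (norm (g s - f n s))\<^sup>2 \<partial>M) \<longlonglongrightarrow> (\<integral>s. 0 \<partial>M)"
  proof (rule integral_dominated_convergence)
    show "integrable M (\<lambda>_. B\<^sup>2)"
      by simp
    show "AE s in M. norm ((norm (g s - f n s))\<^sup>2) \<le> B\<^sup>2" for n
      by (rule AE_I2) (use bound in \<open>simp add: norm_minus_commute power_mono\<close>)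
    show "AE s in M. (\<lambda>n. (norm (g s - f n s))\<^sup>2) \<longlonglongrightarrow> 0"
    proof (rule AE_I2)
      fix s
      assume "s \<in> space M"
      then have "(\<lambda>n. (norm (g s - f n s))\<^sup>2) \<longlonglongrightarrow> (norm (g s - g s))\<^sup>2"
        by (intro tendsto_intros lim) simp
      then show "(\<lambda>n. (norm (g s - f n s))\<^sup>2) \<longlonglongrightarrow> 0"
        by simp
    qed
  qed measurable
  then have "(\<lambda>n. sqrt (\<integral>s. (norm (g s - f n s))\<^sup>2 \<partial>M)) \<longlonglongrightarrow> sqrt 0"
    by (intro tendsto_real_sqrt) simp
  then show ?thesis
    by (simp add: hsub_cl f g hnorm_cl S_sub)
qed

lemma alg_bounded: "f \<in> alg \<Longrightarrow> \<exists>B\<ge>0. \<forall>s\<in>{-\<epsilon>..\<epsilon>}. cmod (f s) \<le> B"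
proof -
  assume "f \<in> alg"
  then have "bounded (f ` {-\<epsilon>..\<epsilon>})"
    by (intro compact_imp_bounded compact_continuous_image alg_continuous) auto
  then obtain B where "\<forall>y\<in>f ` {-\<epsilon>..\<epsilon>}. cmod y \<le> B"
    unfolding bounded_iff by blast
  then show ?thesis
    by (intro exI[of _ "\<bar>B\<bar>"]) force
qed

lemma alg_in_S: "\<lbrakk>u \<in> alg; v \<in> alg\<rbrakk> \<Longrightarrow> (\<lambda>s. vec2 (u s) (v s)) \<in> S"
  by (intro continuous_S continuous_intros alg_continuous)

text \<open>For a cutoff \<eta>, \<open>T0_fun\<close> maps \<eta> x to \<eta> y + i \<eta>'
  \<open>gamma1\<close> x, where y is the formal image of x. By \<open>cutoff'_bound\<close> the
  last term stays bounded as the cutoffs exhaust the interval, and it tends to 0 pointwise, so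
  dominated convergence applies.\<close>

lemma sin_alg_in_T:
  assumes p: "p \<in> alg" and q: "q \<in> alg"
  shows "\<exists>y. (cl (\<lambda>s. vec2 (of_real (sin (\<theta> s)) * p s) (of_real (sin (\<theta> s)) * q s)), y) \<in> T_graph \<epsilon>"
proof -
  define u where "u s = of_real (sin (\<theta> s)) * p s" for s
  define v where "v s = of_real (sin (\<theta> s)) * q s" for s
  have u: "u \<in> alg" and v: "v \<in> alg"
    unfolding u_def[abs_def] v_def[abs_def] by (intro alg.intros p q)+
  obtain u' v' where u': "u' \<in> alg" "\<And>s. (u has_vector_derivative u' s) (at s)"
    and v': "v' \<in> alg" "\<And>s. (v has_vector_derivative v' s) (at s)"
    using alg_deriv[OF u] alg_deriv[OF v] by blast
  \<comment> \<open>The formal image of (u, v), with f sin \<theta> already replaced by - \<alpha>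
    cos \<theta>, so that it is continuous up to the end points.\<close>
  define g1 where "g1 s = \<i> * (v' s + of_real \<alpha> * (of_real (cos (\<theta> s)) * q s))" for s
  define g2 where "g2 s = \<i> * (u' s + of_real (- \<alpha>) * (of_real (cos (\<theta> s)) * p s))" for s
  have g: "g1 \<in> alg" "g2 \<in> alg"
    unfolding g1_def[abs_def] g2_def[abs_def] by (intro alg.intros p q u' v')+
  define a where "a n = \<epsilon> / (real n + 2)" for n :: nat
  have a: "a n > 0" for n
    using eps_pos by (simp add: a_def)
  have alim: "a \<longlonglongrightarrow> 0"
  proof -
    have "filterlim (\<lambda>n. real n + 2) at_infinity sequentially"
      by (intro filterlim_at_top_imp_at_infinity filterlim_tendsto_add_at_top[OF tendsto_const, of
          _ _ 2, simplified add.commute]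
          filterlim_real_sequentially)
    then show ?thesis
      unfolding a_def[abs_def] by (rule tendsto_divide_0[OF tendsto_const])
  qed
  let ?\<eta> = "\<lambda>n s. complex_of_real (cutoff (a n) s)"
      and ?\<eta>' = "\<lambda>n s. complex_of_real (cutoff' (a n) s)"
  define \<psi> where "\<psi> n s = vec2 (?\<eta> n s * u s) (?\<eta> n s * v s)" for n s
  define \<phi> where "\<phi> n s
      = vec2 (?\<eta> n s * g1 s + \<i> * (?\<eta>' n s * v s)) (?\<eta> n s * g2 s + \<i> * (?\<eta>' n s * u s))" for n s
  define x where "x s = vec2 (u s) (v s)" for s
  define y where "y s = vec2 (g1 s) (g2 s)" for s
  have S: "\<psi> n \<in> S" "\<phi> n \<in> S" "x \<in> S" "y \<in> S" for n
    unfolding \<psi>_def[abs_def] \<phi>_def[abs_def] x_def[abs_def] y_def[abs_def]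
    by (intro alg_in_S alg.intros cutoff_alg a u v g)+
  have test: "\<psi> n \<in> test_functions \<epsilon>" for n
  proof -
    have "smooth (\<psi> n)"
      unfolding \<psi>_def[abs_def] by (intro smooth_alg alg.intros cutoff_alg a u v)
    moreover have "{s. \<psi> n s \<noteq> 0} \<subseteq> {a n - \<epsilon>..\<epsilon> - a n}"
    proof clarify
      fix s
      assume "\<psi> n s \<noteq> 0"
      then have "cutoff (a n) s \<noteq> 0"
        by (metis \<psi>_def mult_zero_left of_real_0 vec2_eqI vec2_nth zero_index)
      then show "s \<in> {a n - \<epsilon>..\<epsilon> - a n}"
        by (rule cutoff_support[OF a])
    qed
    then have "closure {s. \<psi> n s \<noteq> 0} \<subseteq> {a n - \<epsilon>..\<epsilon> - a n}"
      by (rule closure_minimal) simp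
    then have "closure {s. \<psi> n s \<noteq> 0} \<subseteq> {-\<epsilon><..<\<epsilon>}"
      using a[of n] by force
    ultimately show ?thesis
      by (simp add: test_functions_def)
  qed
  have T0: "T0_fun \<epsilon> (\<psi> n) s = \<phi> n s" if s: "s \<in> {-\<epsilon><..<\<epsilon>}" for n s
  proof -
    have "(\<psi> n has_vector_derivative vec2 (?\<eta> n s * u' s + ?\<eta>' n s * u s) (?\<eta> n s * v' s
        + ?\<eta>' n s * v s)) (at s)"
      unfolding \<psi>_def[abs_def]
      by (intro has_vector_derivative_vec2 has_vector_derivative_mult of_real_deriv cutoff_deriv a
          u' v')
    note * = T0_fun_eq[OF this, of \<epsilon>]
    have f: "of_real (potential \<epsilon> s) * (of_real (sin (\<theta> s)) * z) =
        - (of_real \<alpha> * (of_real (cos (\<theta> s)) * z))" for z :: complex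
    proof -
      have "complex_of_real (potential \<epsilon> s) * of_real (sin (\<theta> s)) =
          - (of_real \<alpha> * of_real (cos (\<theta> s)))"
        using potential_sin[OF s] by (metis of_real_minus of_real_mult)
      then show ?thesis
        by (simp add: mult.assoc[symmetric])
    qed
    have fv: "of_real (potential \<epsilon> s) * (c * v s) =
        - (c * (of_real \<alpha> * (of_real (cos (\<theta> s)) * q s)))"
      and fu: "of_real (potential \<epsilon> s) * (c * u s) =
          - (c * (of_real \<alpha> * (of_real (cos (\<theta> s)) * p s)))" for c
      using f[of "c * q s"] f[of "c * p s"] by (simp_all add: u_def v_def mult_ac)
    show ?thesis
      unfolding * \<phi>_def \<psi>_def vec2_nth fu fv g1_def g2_def
      by (rule vec2_eqI) (simp_all add: algebra_simps)
  qed
  have cT0: "cl (T0_fun \<epsilon> (\<psi> n)) = cl (\<phi> n)" for n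
    by (rule cl_cong(2)[OF S(2)]) (rule T0)
  obtain B1 where B1: "B1 \<ge> 0" "\<And>s. s \<in> {-\<epsilon>..\<epsilon>} \<Longrightarrow> cmod (u s) \<le> B1"
    using alg_bounded[OF u] by blast
  obtain B2 where B2: "B2 \<ge> 0" "\<And>s. s \<in> {-\<epsilon>..\<epsilon>} \<Longrightarrow> cmod (v s) \<le> B2"
    using alg_bounded[OF v] by blast
  obtain B3 where B3: "B3 \<ge> 0" "\<And>s. s \<in> {-\<epsilon>..\<epsilon>} \<Longrightarrow> cmod (g1 s) \<le> B3"
    using alg_bounded[OF g(1)] by blast
  obtain B4 where B4: "B4 \<ge> 0" "\<And>s. s \<in> {-\<epsilon>..\<epsilon>} \<Longrightarrow> cmod (g2 s) \<le> B4"
    using alg_bounded[OF g(2)] by blast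
  obtain Bp where Bp: "Bp \<ge> 0" "\<And>s. s \<in> {-\<epsilon>..\<epsilon>} \<Longrightarrow> cmod (p s) \<le> Bp"
    using alg_bounded[OF p] by blast
  obtain Bq where Bq: "Bq \<ge> 0" "\<And>s. s \<in> {-\<epsilon>..\<epsilon>} \<Longrightarrow> cmod (q s) \<le> Bq"
    using alg_bounded[OF q] by blast
  note B = B1 B2 B3 B4 Bp Bq
  have \<eta>1: "cmod (?\<eta> n s - 1) \<le> 1" for n s
  proof -
    have "cmod (?\<eta> n s - 1) = \<bar>cutoff (a n) s - 1\<bar>"
      by (metis norm_of_real of_real_1 of_real_diff)
    then show ?thesis
      using cutoff_bounds[OF a, of n s] by simp
  qed
  have lim1: "(\<lambda>n. hnorm L2 (hsub L2 (cl x) (cl (\<psi> n)))) \<longlonglongrightarrow> 0"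
  proof (rule L2_convergence[OF S(1,3)])
    fix s
    assume s: "s \<in> {-\<epsilon><..<\<epsilon>}"
    then have s': "s \<in> {-\<epsilon>..\<epsilon>}"
      by auto
    have "(\<lambda>n. vec2 (?\<eta> n s * u s) (?\<eta> n s * v s)) \<longlonglongrightarrow> vec2 (of_real 1 * u s) (of_real 1 * v s)"
      by (intro tendsto_vec2 tendsto_intros cutoff_tendsto[OF s alim])
    then show "(\<lambda>n. \<psi> n s) \<longlonglongrightarrow> x s"
      by (simp add: \<psi>_def x_def)
    fix n
    have "\<psi> n s - x s = vec2 ((?\<eta> n s - 1) * u s) ((?\<eta> n s - 1) * v s)"
      by (simp add: \<psi>_def x_def vec2_diff algebra_simps)
    also have "norm \<dots> \<le> cmod (?\<eta> n s - 1) * cmod (u s) + cmod (?\<eta> n s - 1) * cmod (v s)"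
      by (rule order_trans[OF norm_vec2_le]) (simp add: norm_mult)
    also have "\<dots> \<le> 1 * B1 + 1 * B2"
      by (intro add_mono mult_mono \<eta>1 B s') auto
    finally show "norm (\<psi> n s - x s) \<le> 1 * B1 + 1 * B2" .
  qed
  have lim2: "(\<lambda>n. hnorm L2 (hsub L2 (cl y) (cl (\<phi> n)))) \<longlonglongrightarrow> 0"
  proof (rule L2_convergence[OF S(2,4)])
    fix s
    assume s: "s \<in> {-\<epsilon><..<\<epsilon>}"
    then have s': "s \<in> {-\<epsilon>..\<epsilon>}"
      by auto
    have "(\<lambda>n. \<phi> n s)
        \<longlonglongrightarrow> vec2 (of_real 1 * g1 s + \<i> * (of_real 0 * v s))
        (of_real 1 * g2 s + \<i> * (of_real 0 * u s))"
      unfolding \<phi>_def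
      by (intro tendsto_vec2 tendsto_intros cutoff_tendsto[OF s alim])
    then show "(\<lambda>n. \<phi> n s) \<longlonglongrightarrow> y s"
      by (simp add: y_def)
    fix n
    have e: "cmod (?\<eta>' n s * (of_real (sin (\<theta> s)) * z)) \<le> 4 * \<alpha> * B" if "cmod z \<le> B" for z B
    proof -
      have "cmod (?\<eta>' n s * (of_real (sin (\<theta> s)) * z)) = \<bar>cutoff' (a n) s\<bar> * \<bar>sin (\<theta> s)\<bar> * cmod z"
        by (simp add: norm_mult)
      also have "\<dots> \<le> 4 * \<alpha> * B"
        using alpha_pos by (intro mult_mono cutoff'_bound[OF a s'] that) auto
      finally show ?thesis .
    qed
    have "\<phi> n s - y s = vec2 ((?\<eta> n s - 1) * g1 s + \<i> * (?\<eta>' n s * v s)) ((?\<eta> n s - 1) * g2 s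
        + \<i> * (?\<eta>' n s * u s))"
      by (simp add: \<phi>_def y_def vec2_diff algebra_simps)
    also have "norm \<dots> \<le> (cmod (?\<eta> n s - 1) * cmod (g1 s) + cmod (?\<eta>' n s * v s))
        + (cmod (?\<eta> n s - 1) * cmod (g2 s) + cmod (?\<eta>' n s * u s))"
      by (intro order_trans[OF norm_vec2_le] add_mono norm_triangle_le) (simp_all add: norm_mult)
    also have "\<dots> \<le> (1 * B3 + 4 * \<alpha> * Bq) + (1 * B4 + 4 * \<alpha> * Bp)"
      by (intro add_mono mult_mono \<eta>1 B s')
          (simp_all only: u_def v_def e B s' norm_ge_zero zero_le_one)
    finally show "norm (\<phi> n s - y s) \<le> (1 * B3 + 4 * \<alpha> * Bq) + (1 * B4 + 4 * \<alpha> * Bp)" .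
  qed
  have "(cl x, cl y) \<in> T_graph \<epsilon>"
  proof -
    have "\<exists>(x', y')\<in>T0_graph \<epsilon>. hnorm L2 (hsub L2 (cl x) x') < e \<and> hnorm L2 (hsub L2 (cl y) y') < e"
      if e: "e > 0" for e
    proof -
      have ev: "\<forall>\<^sub>F n in sequentially. hnorm L2 (hsub L2 (cl x) (cl (\<psi> n))) < e
          \<and> hnorm L2 (hsub L2 (cl y) (cl (\<phi> n))) < e"
        using order_tendstoD(2)[OF lim1 e] order_tendstoD(2)[OF lim2 e] by (rule eventually_conj)
      have "\<exists>n. hnorm L2 (hsub L2 (cl x) (cl (\<psi> n))) < e \<and> hnorm L2 (hsub L2 (cl y) (cl (\<phi> n))) < e"
        by (rule eventually_happens'[OF sequentially_bot ev])
      then show ?thesis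
      proof (elim exE conjE)
        fix n
        assume n: "hnorm L2 (hsub L2 (cl x) (cl (\<psi> n))) < e" "hnorm L2 (hsub L2 (cl y) (cl (\<phi> n)))
            < e"
        have "(cl (\<psi> n), cl (T0_fun \<epsilon> (\<psi> n))) \<in> T0_graph \<epsilon>"
          unfolding T0_graph_def using test[of n] by blast
        then show ?thesis
          unfolding cT0 using n by (intro bexI[of _ "(cl (\<psi> n), cl (\<phi> n))"]) simp_all
      qed
    qed
    then show ?thesis
      unfolding T_graph_def graph_closure_def using cl_in[OF S(3)] cl_in[OF S(4)] by blast
  qed
  then show ?thesis
    unfolding x_def[abs_def] u_def v_def by blast
qed

end

section \<open>Diagonalization of \<open>T\<close>\<close>

text \<open>The index \<open>0\<close> belongs to the kernel, and \<open>2 k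
    - 1\<close>, \<open>2 k\<close> to the odd and the even basis vector with
  singular value number \<open>k\<close>.\<close>

definition pair_swap :: "nat \<Rightarrow> nat" where
  "pair_swap n = (if n = 0 then 0 else if even n then n - 1 else n + 1)"

lemma adjacent_involution_pair_swap: "adjacent_involution pair_swap"
  unfolding adjacent_involution_def pair_swap_def by auto

lemma pair_swap_index: "(pair_swap n + 1) div 2 = (n + 1) div 2"
  unfolding pair_swap_def by (auto elim!: evenE oddE)

lemma pair_swap_parity: "n > 0 \<Longrightarrow> even (pair_swap n) \<longleftrightarrow> odd n"
  unfolding pair_swap_def by auto

text \<open>The blocks are {0}, {1, 2}, {3, 4} and so on, and an odd \<open>N\<close> cuts between
  two blocks.\<close>

lemma pair_swap_le: "odd N \<Longrightarrow> pair_swap n < N \<longleftrightarrow> n < N"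
  unfolding pair_swap_def by (cases "n = 0"; cases "even n") (auto elim!: evenE oddE, presburger+)

context real_interval
begin

lemma measurable_vec2: "f \<in> borel_measurable N \<Longrightarrow> g \<in> borel_measurable N
  \<Longrightarrow> (\<lambda>s. vec2 (f s) (g s)) \<in> borel_measurable N"
  using borel_measurable_continuous_Pair[of f N g vec2]
  by (simp add: continuous_on_vec2[OF continuous_on_fst continuous_on_snd, OF continuous_on_id
      continuous_on_id])

lemma S_gamma3: "\<psi> \<in> S \<Longrightarrow> (\<lambda>s. vec2 (\<psi> s $ 1) (- (\<psi> s $ 2))) \<in> S"
  by (simp add: S_iff norm_vec2_sq measurable_vec2 measurable_vec_nth)

lemma gamma3_cl:
  assumes \<psi>: "\<psi> \<in> S"
  shows "gamma3_operator \<epsilon> (cl \<psi>) = cl (\<lambda>s. vec2 (\<psi> s $ 1) (- (\<psi> s $ 2)))"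
  unfolding gamma3_operator_def gamma3_mult
proof (rule cl_eqI)
  show "AE s in M. vec2 (ae_rep (cl \<psi>) s $ 1) (- (ae_rep (cl \<psi>) s $ 2))
      = vec2 (\<psi> s $ 1) (- (\<psi> s $ 2))"
    using rep_cl(2)[OF \<psi>] by eventually_elim simp
qed (intro S_gamma3 rep_cl \<psi>)+

end

context interval
begin

lemma mu_pos: "k \<ge> 1 \<Longrightarrow> \<mu> k > 0"
  by (simp add: \<mu>_def)

lemma mu_nonneg: "\<mu> k \<ge> 0"
  by (simp add: \<mu>_def)

text \<open>The factor i makes the matrix entries of \<open>T\<close> nonnegative, since
  \<open>T\<close> sends \<open>A k\<close> to i \<alpha> \<open>C k\<close>. An odd n has k \<ge>
  1, so the normalization does not divide by 0.\<close>

definition basis_fun :: "nat \<Rightarrow> real \<Rightarrow> complex ^ 2" where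
  "basis_fun n s = (let k = (n + 1) div 2 in
     if even n then vec2 (of_real (A k s / sqrt \<epsilon>)) 0
     else vec2 0 (\<i> * of_real (C k s / sqrt (\<epsilon> * \<mu> k))))"

lemma basis_fun_even: "even n \<Longrightarrow> basis_fun n = (\<lambda>s. vec2 (of_real (A ((n + 1) div 2) s / sqrt \<epsilon>)) 0)"
  by (simp add: basis_fun_def[abs_def] Let_def)

lemma basis_fun_odd: "odd n \<Longrightarrow> basis_fun n
  = (\<lambda>s. vec2 0 (\<i> * of_real (C ((n + 1) div 2) s / sqrt (\<epsilon> * \<mu> ((n + 1) div 2)))))"
  by (simp add: basis_fun_def[abs_def] Let_def)

text \<open>This is the form required by \<open>sin_alg_in_T\<close>; of the two factors sin
  \<theta> in \<open>C k\<close>, one is left in q.\<close>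

lemma basis_fun_alg:
  "\<exists>p\<in>alg. \<exists>q\<in>alg. basis_fun n = (\<lambda>s. vec2 (of_real (sin (\<theta> s)) * p s) (of_real (sin (\<theta> s)) * q s))"
proof (cases "even n")
  case True
  let ?k = "(n + 1) div 2"
  have e: "basis_fun n = (\<lambda>s. vec2 (of_real (sin (\<theta> s)) * (of_real (1 / sqrt \<epsilon>) * of_real (poly
      (cheb ?k) (cos (\<theta> s)))))
      (of_real (sin (\<theta> s)) * 0))"
    using True by (simp add: basis_fun_even A_eq Q_def)
  have m: "(\<lambda>s. of_real (1 / sqrt \<epsilon>) * of_real (poly (cheb ?k) (cos (\<theta> s)))) \<in> alg" "(\<lambda>_. 0) \<in> alg"
    by (intro alg.intros alg_poly_cos)+
  show ?thesis
    by (rule bexI[OF _ m(1)], rule bexI[OF _ m(2)], rule e)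
next
  case False
  let ?k = "(n + 1) div 2"
  let ?c = "- \<i> * of_real (1 / sqrt (\<epsilon> * \<mu> ?k))"
  have e: "basis_fun n = (\<lambda>s. vec2 (of_real (sin (\<theta> s)) * 0)
      (of_real (sin (\<theta> s)) *
          (?c * (of_real (sin (\<theta> s)) * of_real (poly (pderiv (cheb ?k)) (cos (\<theta> s)))))))"
    using False by (simp add: basis_fun_odd C_def D_def power2_eq_square fun_eq_iff mult_ac)
  have m: "(\<lambda>s. ?c * (of_real (sin (\<theta> s)) * of_real (poly (pderiv (cheb ?k)) (cos (\<theta> s))))) \<in> alg"
      "(\<lambda>_. 0) \<in> alg"
    by (intro alg.intros alg_poly_cos)+
  show ?thesis
    by (rule bexI[OF _ m(2)], rule bexI[OF _ m(1)], rule e)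
qed

lemma basis_fun_S: "basis_fun n \<in> S"
proof -
  obtain p q where pq: "p \<in> alg" "q \<in> alg"
    "basis_fun n = (\<lambda>s. vec2 (of_real (sin (\<theta> s)) * p s) (of_real (sin (\<theta> s)) * q s))"
    using basis_fun_alg by blast
  show ?thesis
    unfolding pq(3) by (intro alg_in_S alg.intros pq)
qed

lemma hip_basis_fun_even:
  assumes "\<psi> \<in> S" "even n"
  shows "hip L2 (cl (basis_fun n)) (cl \<psi>)
      = of_real (1 / sqrt \<epsilon>) * (\<integral>s. of_real (A ((n + 1) div 2) s) * \<psi> s $ 1 \<partial>M)"
proof -
  have "hip L2 (cl (basis_fun n)) (cl \<psi>)
      = (\<integral>s. of_real (1 / sqrt \<epsilon>) * (of_real (A ((n + 1) div 2) s) * \<psi> s $ 1) \<partial>M)"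
    unfolding hip_cl[OF basis_fun_S assms(1)] unfolding basis_fun_even[OF assms(2)]
    by (rule Bochner_Integration.integral_cong) (simp_all add: ipv_vec2)
  then show ?thesis
    by simp
qed

lemma hip_basis_fun_odd:
  assumes "\<psi> \<in> S" "odd n"
  shows "hip L2 (cl (basis_fun n)) (cl \<psi>) = - \<i> * of_real (1 / sqrt (\<epsilon> * \<mu> ((n + 1) div 2)))
    * (\<integral>s. of_real (C ((n + 1) div 2) s) * \<psi> s $ 2 \<partial>M)"
proof -
  have "hip L2 (cl (basis_fun n)) (cl \<psi>) = (\<integral>s. (- \<i> * of_real (1 / sqrt (\<epsilon> * \<mu> ((n + 1) div 2))))
      * (of_real (C ((n + 1) div 2) s) * \<psi> s $ 2) \<partial>M)"
    unfolding hip_cl[OF basis_fun_S assms(1)] unfolding basis_fun_odd[OF assms(2)]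
    by (rule Bochner_Integration.integral_cong) (simp_all add: ipv_vec2)
  then show ?thesis
    by simp
qed

lemma basis_fun_orthonormal: "hip L2 (cl (basis_fun i)) (cl (basis_fun j))
  = (if i = j then 1 else 0)"
proof -
  let ?k = "\<lambda>n :: nat. (n + 1) div 2"
  consider "even i" "even j" | "odd i" "odd j" | "even i" "odd j" | "odd i" "even j"
    by blast
  then show ?thesis
  proof cases
    case 1
    have "(\<integral>s. of_real (A (?k i) s) * basis_fun j s $ 1 \<partial>M)
        = (\<integral>s. complex_of_real (A (?k i) s * A (?k j) s / sqrt \<epsilon>) \<partial>M)"
      by (rule Bochner_Integration.integral_cong) (simp_all add: basis_fun_even 1)
    also have "\<dots> = of_real ((if ?k i = ?k j then \<epsilon> else 0) / sqrt \<epsilon>)"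
      unfolding integral_complex_of_real by (simp add: integral_A_A)
    finally have "hip L2 (cl (basis_fun i)) (cl (basis_fun j))
        = of_real (1 / sqrt \<epsilon> * ((if ?k i = ?k j then \<epsilon> else 0) / sqrt \<epsilon>))"
      unfolding hip_basis_fun_even[OF basis_fun_S 1(1)] by (simp only: of_real_mult)
    moreover have "?k i = ?k j \<longleftrightarrow> i = j"
      using 1 by (auto elim!: evenE)
    then have "1 / sqrt \<epsilon> * ((if ?k i = ?k j then \<epsilon> else 0) / sqrt \<epsilon>) = (if i = j then 1 else 0)"
      using eps_pos by simp
    ultimately show ?thesis
      by (simp only: of_real_0 of_real_1 split: if_split) simp
  next
    case 2
    have "(\<integral>s. of_real (C (?k i) s) * basis_fun j s $ 2 \<partial>M)
        = (\<integral>s. \<i> * complex_of_real (C (?k i) s * C (?k j) s / sqrt (\<epsilon> * \<mu> (?k j))) \<partial>M)"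
      by (rule Bochner_Integration.integral_cong) (simp_all add: basis_fun_odd 2)
    also have "\<dots> = \<i> * of_real ((if ?k i = ?k j then \<epsilon> * \<mu> (?k j) else 0) / sqrt (\<epsilon> * \<mu> (?k j)))"
      unfolding integral_mult_right_zero integral_complex_of_real by (simp add: integral_C_C)
    finally have "hip L2 (cl (basis_fun i)) (cl (basis_fun j)) = - (\<i> * \<i>)
        * of_real (1 / sqrt (\<epsilon> * \<mu> (?k i)) *
            ((if ?k i = ?k j then \<epsilon> * \<mu> (?k j) else 0) / sqrt (\<epsilon> * \<mu> (?k j))))"
      unfolding hip_basis_fun_odd[OF basis_fun_S 2(1)] of_real_mult by
          (simp only: mult_ac mult_minus_left mult_minus_right)
    moreover have "?k i = ?k j \<longleftrightarrow> i = j"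
      using 2 by (auto elim!: oddE)
    moreover have "\<mu> (?k j) > 0"
      using 2 by (intro mu_pos) (auto elim!: oddE)
    ultimately have "hip L2 (cl (basis_fun i)) (cl (basis_fun j)) =
        - (\<i> * \<i>) * of_real (if i = j then 1 else 0)"
      using eps_pos by (cases "i = j") (simp_all del: of_real_mult of_real_divide)
    then show ?thesis
      by simp
  next
    case 3
    then have "i \<noteq> j"
      by auto
    then show ?thesis
      unfolding hip_basis_fun_even[OF basis_fun_S 3(1)] unfolding basis_fun_odd[OF 3(2)] by simp
  next
    case 4
    then have "i \<noteq> j"
      by auto
    then show ?thesis
      unfolding hip_basis_fun_odd[OF basis_fun_S 4(1)] unfolding basis_fun_even[OF 4(2)] by simp
  qed
qed

lemma S_component_integrable:
  assumes \<psi>: "\<psi> \<in> S" and h: "continuous_on {-\<epsilon>..\<epsilon>} h"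
  shows "integrable M (\<lambda>s. complex_of_real (h s) * \<psi> s $ j)"
proof -
  have h: "(\<lambda>s. vec2 (of_real (h s)) 0) \<in> S" "(\<lambda>s. vec2 0 (of_real (h s))) \<in> S"
    by (intro continuous_S continuous_intros h)+
  from S_integrable_ipv[OF h(1) \<psi>] S_integrable_ipv[OF h(2) \<psi>]
  show ?thesis
    using exhaust_2[of j] by (auto simp: ipv_vec2)
qed

text \<open>Orthogonality says that sin \<theta> times the first and sin^2 \<theta> times the second
  component have vanishing moments against \<open>cheb n\<close> and
  \<open>pderiv (cheb (Suc n))\<close>, both of degree n. Inside the interval the sines are positive
  and can be cancelled.\<close>

lemma basis_fun_total:
  assumes X: "X \<in> hcarrier L2" and orth: "\<And>n. hip L2 (cl (basis_fun n)) X = 0"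
  shows "X = hzero L2"
proof -
  obtain \<psi> where \<psi>: "\<psi> \<in> S" "X = cl \<psi>"
    using cl_cases[OF X] .
  have 1: "(\<integral>s. of_real (A k s) * \<psi> s $ 1 \<partial>M) = 0" for k
    using orth[of "2 * k"] eps_pos unfolding \<psi>(2) by (simp add: hip_basis_fun_even[OF \<psi>(1)])
  \<comment> \<open>The odd family starts at k = 1, since \<open>cheb 0\<close> is constant and
    \<open>C 0\<close> vanishes.\<close>
  have 2: "(\<integral>s. of_real (C (Suc k) s) * \<psi> s $ 2 \<partial>M) = 0" for k
    using orth[of "2 * k + 1"] eps_pos mu_pos[of "Suc k"] unfolding \<psi>(2) by
        (simp add: hip_basis_fun_odd[OF \<psi>(1)])
  have "AE s in M. of_real (sin (\<theta> s)) * \<psi> s $ 1 = 0"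
  proof (rule moments_zero)
    let ?L = "\<lambda>p. \<integral>s. of_real (sin (\<theta> s)) * \<psi> s $ 1 * of_real (poly p (cos (\<theta> s))) \<partial>M"
    have int: "integrable M (\<lambda>s. of_real (sin (\<theta> s)) * \<psi> s $ 1 * of_real (poly p (cos (\<theta> s))))"
        for p
      using S_component_integrable[OF \<psi>(1), of "\<lambda>s. sin (\<theta> s) * poly p (cos (\<theta> s))" 1]
      by (simp add: mult_ac continuous_intros)
    show "?L p = 0" for p
    proof (rule polynomial_spanning[where q = cheb and L = ?L])
      show "?L (p + r) = ?L p + ?L r" for p r
        using int by (simp add: distrib_left)
      show "?L (smult c p) = of_real c * ?L p" for c p
        by (subst integral_mult_right_zero[symmetric]) (simp add: mult_ac)
      show "?L (cheb n) = 0" for n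
        using 1[of n] by (simp add: A_eq Q_def mult_ac)
    qed (simp_all add: degree_cheb)
    show "integrable M (\<lambda>s. of_real (sin (\<theta> s)) * \<psi> s $ 1)"
      using int[of 1] by simp
  qed
  moreover have "AE s in M. of_real ((sin (\<theta> s))\<^sup>2) * \<psi> s $ 2 = 0"
  proof (rule moments_zero)
    let ?L = "\<lambda>p. \<integral>s. of_real ((sin (\<theta> s))\<^sup>2) * \<psi> s $ 2 * of_real (poly p (cos (\<theta> s))) \<partial>M"
    have int: "integrable M (\<lambda>s. of_real ((sin (\<theta> s))\<^sup>2) * \<psi> s $ 2 * of_real (poly p (cos (\<theta> s))))"
        for p
      using S_component_integrable[OF \<psi>(1), of "\<lambda>s. (sin (\<theta> s))\<^sup>2 * poly p (cos (\<theta> s))" 2]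
      by (simp add: mult_ac continuous_intros)
    show "?L p = 0" for p
    proof (rule polynomial_spanning[where q = "\<lambda>n. pderiv (cheb (Suc n))" and L = ?L])
      show "?L (p + r) = ?L p + ?L r" for p r
        using int by (simp add: distrib_left)
      show "?L (smult c p) = of_real c * ?L p" for c p
        by (subst integral_mult_right_zero[symmetric]) (simp add: mult_ac)
      show "?L (pderiv (cheb (Suc n))) = 0" for n
        using 2[of n] by (simp add: C_def D_def mult_ac)
      show d: "degree (pderiv (cheb (Suc n))) = n" for n
        using degree_cheb[of "Suc n"] by (simp add: degree_pderiv)
      show "pderiv (cheb (Suc n)) \<noteq> 0" for n
        using degree_cheb[of "Suc n"] by (simp add: pderiv_eq_0_iff)
    qed
    show "integrable M (\<lambda>s. of_real ((sin (\<theta> s))\<^sup>2) * \<psi> s $ 2)"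
      using int[of 1] by simp
  qed
  moreover have "AE s in M. s \<in> {-\<epsilon><..<\<epsilon>}"
    by (rule AE_I2) simp
  ultimately have "AE s in M. \<psi> s = 0"
  proof eventually_elim
    case (elim s)
    then show ?case
      using sin_\<theta>_pos[of s] by (intro vec2_eqI) auto
  qed
  then show ?thesis
    unfolding \<psi>(2) hzero_cl by (intro cl_eqI \<psi>(1) S_zero)
qed

sublocale onb: orthonormal_basis L2 "\<lambda>n. cl (basis_fun n)"
proof (intro orthonormal_basis.intro complex_hilbert.intro hilbert_module_L2
    orthonormal_basis_axioms.intro)
  show "cl (basis_fun n) \<in> hcarrier L2" for n
    by (rule cl_in[OF basis_fun_S])
  show "hip L2 (cl (basis_fun i)) (cl (basis_fun j)) = (if i = j then 1 else 0)" for i j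
    by (rule basis_fun_orthonormal)
  show "X = hzero L2" if "X \<in> hcarrier L2" "\<And>n. hip L2 (cl (basis_fun n)) X = 0" for X
    using that by (rule basis_fun_total)
qed

definition lam :: "nat \<Rightarrow> real" where
  "lam n = \<alpha> * sqrt (\<mu> ((n + 1) div 2))"

section \<open>Test functions and integration by parts\<close>

lemma test_function_deriv:
  assumes "\<psi> \<in> test_functions \<epsilon>"
  obtains \<psi>' where "\<And>s. (\<psi> has_vector_derivative \<psi>' s) (at s)" "continuous_on UNIV \<psi>'"
proof
  have sm: "((\<lambda>\<xi> s. vector_derivative \<xi> (at s)) ^^ n) \<psi> differentiable_on UNIV" for n
    using assms by (simp add: test_functions_def smooth_def)
  show "(\<psi> has_vector_derivative vector_derivative \<psi> (at s)) (at s)" for s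
    using sm[of 0] by (simp add: differentiable_on_def vector_derivative_works)
  show "continuous_on UNIV (\<lambda>s. vector_derivative \<psi> (at s))"
    using sm[of 1] by (simp add: differentiable_imp_continuous_on)
qed

lemma potential_continuous: "continuous_on {-\<epsilon><..<\<epsilon>} (potential \<epsilon>)"
proof -
  have "cos (\<alpha> * s) \<noteq> 0" if s: "s \<in> {-\<epsilon><..<\<epsilon>}" for s
  proof -
    have "\<theta> s = \<alpha> * s + pi / 2"
      using eps_pos by (simp add: \<theta>_def alpha_def field_simps)
    then have "sin (\<theta> s) = cos (\<alpha> * s)"
      by (simp add: sin_add)
    then show ?thesis
      using sin_\<theta>_pos[OF s] by simp
  qed
  then show ?thesis
    unfolding potential_def[abs_def] by (intro continuous_intros) auto
qed

text \<open>The potential is unbounded on the interval; boundedness of the image comes from the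
  compact support, off which both the function and its derivative vanish.\<close>

lemma test_function_S:
  assumes \<psi>: "\<psi> \<in> test_functions \<epsilon>"
  shows "\<psi> \<in> S" "T0_fun \<epsilon> \<psi> \<in> S"
proof -
  obtain \<psi>' where d: "\<And>s. (\<psi> has_vector_derivative \<psi>' s) (at s)" and c': "continuous_on UNIV \<psi>'"
    using test_function_deriv[OF \<psi>] by blast
  have c: "continuous_on X \<psi>" for X
    using d by (meson continuous_at_imp_continuous_on has_vector_derivative_continuous)
  show "\<psi> \<in> S"
    by (rule continuous_S[OF c])
  define K where "K = closure {s. \<psi> s \<noteq> 0}"
  have K: "K \<subseteq> {-\<epsilon><..<\<epsilon>}"
    using \<psi> by (simp add: test_functions_def K_def)
  have "compact K"
    unfolding compact_eq_bounded_closed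
    using bounded_subset[OF _ K] by (simp add: K_def)
  have cT: "continuous_on {-\<epsilon><..<\<epsilon>} (T0_fun \<epsilon> \<psi>)"
    unfolding T0_fun_eq[OF d]
    by (intro continuous_intros c potential_continuous continuous_on_subset[OF c'] subset_UNIV)
  have "bounded (T0_fun \<epsilon> \<psi> ` K)"
    by (rule compact_imp_bounded[OF compact_continuous_image[OF continuous_on_subset[OF cT K]
        \<open>compact K\<close>]])
  then obtain B where B: "\<forall>y\<in>T0_fun \<epsilon> \<psi> ` K. norm y \<le> B"
    unfolding bounded_iff ..
  have zero: "T0_fun \<epsilon> \<psi> s = 0" if s: "s \<notin> K" for s
  proof -
    have "(\<psi> has_vector_derivative 0) (at s)"
    proof (rule has_vector_derivative_transform_within_open)
      show "((\<lambda>_. 0) has_vector_derivative (0 :: complex ^ 2)) (at s)"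
        by simp
      show "open (- K)"
        by (simp add: K_def open_Compl)
      show "s \<in> - K"
        using s by simp
      show "0 = \<psi> t" if "t \<in> - K" for t
        using that closure_subset[of "{s. \<psi> s \<noteq> 0}"] by (auto simp: K_def)
    qed
    moreover have "\<psi> s = 0"
      using s closure_subset[of "{s. \<psi> s \<noteq> 0}"] by (auto simp: K_def)
    ultimately show ?thesis
      by (intro vec2_eqI) (simp_all add: T0_fun_eq[of \<psi> 0])
  qed
  show "T0_fun \<epsilon> \<psi> \<in> S"
  proof (rule S_bound[OF continuous_measurable[OF cT]])
    show "norm (T0_fun \<epsilon> \<psi> s) \<le> \<bar>B\<bar>" for s
    proof (cases "s \<in> K")
      case True
      then have "norm (T0_fun \<epsilon> \<psi> s) \<le> B"
        using B by blast
      then show ?thesis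
        by linarith
    qed (simp add: zero)
  qed
qed

text \<open>Integration by parts against the basis functions, with boundary terms killed by the test
  function. By \<open>A_deriv\<close> and \<open>C_deriv\<close> the transposed expressions are
  multiples of \<open>C k\<close> and \<open>A k\<close>.\<close>

lemma T0_coef:
  assumes \<psi>: "\<psi> \<in> test_functions \<epsilon>"
  shows "onb.coef (cl (T0_fun \<epsilon> \<psi>)) n = of_real (lam n) * onb.coef (cl \<psi>) (pair_swap n)"
proof -
  obtain \<psi>' where d: "\<And>s. (\<psi> has_vector_derivative \<psi>' s) (at s)" and c': "continuous_on UNIV \<psi>'"
    using test_function_deriv[OF \<psi>] by blast
  have c: "continuous_on X \<psi>" for X
    using d by (meson continuous_at_imp_continuous_on has_vector_derivative_continuous)
  note c'' = continuous_on_subset[OF c' subset_UNIV]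
  have dc: "((\<lambda>s. \<psi> s $ j) has_vector_derivative \<psi>' s $ j) (at s)" for j s
    by (rule bounded_linear.has_vector_derivative[OF bounded_linear_vec_nth d])
  have ends: "\<psi> (- \<epsilon>) = 0" "\<psi> \<epsilon> = 0"
    using \<psi> closure_subset[of "{s. \<psi> s \<noteq> 0}"] by (auto simp: test_functions_def)
  note S = test_function_S[OF \<psi>]
  let ?f = "\<lambda>s. complex_of_real (potential \<epsilon> s)"
  have f: "?f s * (of_real (sin (\<theta> s)) * z) = - (of_real \<alpha> * of_real (cos (\<theta> s)) * z)"
    if "s \<in> {-\<epsilon><..<\<epsilon>}" for s z
  proof -
    have "?f s * of_real (sin (\<theta> s)) = - (of_real \<alpha> * of_real (cos (\<theta> s)))"
      using potential_sin[OF that] by (metis of_real_minus of_real_mult)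
    then show ?thesis
      by (simp add: mult.assoc[symmetric])
  qed
  have int: "integrable M (\<lambda>s. of_real (C k s) * \<psi> s $ j)"
      "integrable M (\<lambda>s. of_real (A k s) * \<psi> s $ j)" for k j
    by (intro S_component_integrable[OF S(1)] continuous_intros)+
  have part1: "(\<integral>s. of_real (A k s) * T0_fun \<epsilon> \<psi> s $ 1 \<partial>M) =
      - \<i> * of_real \<alpha> * (\<integral>s. of_real (C k s) * \<psi> s $ 2 \<partial>M)" for k
  proof -
    \<comment> \<open>The derivative of \<open>A k\<close> times the second component; its integral
      vanishes. The terms with cos \<theta> and with the potential cancel, and the multiple of
      \<open>C k\<close> remains.\<close>
    let ?g' = "\<lambda>s. of_real (A k s) * \<psi>' s $ 2 + of_real (\<alpha> * (C k s + cos (\<theta> s) * Q k s)) * \<psi> s $ 2"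
    have cg: "continuous_on {-\<epsilon>..\<epsilon>} ?g'"
      by (intro continuous_intros c c'')
    have "(\<integral>s. ?g' s \<partial>M) = of_real (A k \<epsilon>) * \<psi> \<epsilon> $ 2 - of_real (A k (- \<epsilon>)) * \<psi> (- \<epsilon>) $ 2"
      by (intro FTC[OF _ cg] has_vector_derivative_mult of_real_deriv A_deriv dc)
    then have 0: "(\<integral>s. ?g' s \<partial>M) = 0"
      by (simp add: ends)
    have "(\<integral>s. of_real (A k s) * T0_fun \<epsilon> \<psi> s $ 1 \<partial>M)
        = (\<integral>s. \<i> * (?g' s - of_real \<alpha> * (of_real (C k s) * \<psi> s $ 2)) \<partial>M)"
    proof (rule Bochner_Integration.integral_cong[OF refl])
      fix s
      assume "s \<in> space M"
      then have "?f s * (of_real (A k s) * \<psi> s $ 2) =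
          - (of_real \<alpha> * of_real (cos (\<theta> s)) * (of_real (Q k s) * \<psi> s $ 2))"
        using f[of s "of_real (Q k s) * \<psi> s $ 2"] by (simp add: A_eq mult.assoc)
      then show "of_real (A k s) * T0_fun \<epsilon> \<psi> s $ 1
          = \<i> * (?g' s - of_real \<alpha> * (of_real (C k s) * \<psi> s $ 2))"
        unfolding T0_fun_eq[OF d] vec2_nth by (simp add: algebra_simps)
    qed
    also have "\<dots> = \<i> * ((\<integral>s. ?g' s \<partial>M) - of_real \<alpha> * (\<integral>s. of_real (C k s) * \<psi> s $ 2 \<partial>M))"
      using continuous_integrable[OF cg] int(1)[of k 2]
      by (simp only: integral_mult_right_zero Bochner_Integration.integral_diff
          integrable_mult_right)
    finally show ?thesis
      unfolding 0 by simp
  qed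
  have part2: "(\<integral>s. of_real (C k s) * T0_fun \<epsilon> \<psi> s $ 2 \<partial>M)
      = \<i> * of_real (\<alpha> * \<mu> k) * (\<integral>s. of_real (A k s) * \<psi> s $ 1 \<partial>M)" for k
  proof -
    let ?g' = "\<lambda>s. of_real (C k s) * \<psi>' s $ 1
        + of_real (\<alpha> * (cos (\<theta> s) * sin (\<theta> s) * D k s - \<mu> k * A k s)) * \<psi> s $ 1"
    have cg: "continuous_on {-\<epsilon>..\<epsilon>} ?g'"
      by (intro continuous_intros c c'')
    have "(\<integral>s. ?g' s \<partial>M) = of_real (C k \<epsilon>) * \<psi> \<epsilon> $ 1 - of_real (C k (- \<epsilon>)) * \<psi> (- \<epsilon>) $ 1"
      by (intro FTC[OF _ cg] has_vector_derivative_mult of_real_deriv C_deriv dc)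
    then have 0: "(\<integral>s. ?g' s \<partial>M) = 0"
      by (simp add: ends)
    have "(\<integral>s. of_real (C k s) * T0_fun \<epsilon> \<psi> s $ 2 \<partial>M)
        = (\<integral>s. \<i> * (?g' s + of_real (\<alpha> * \<mu> k) * (of_real (A k s) * \<psi> s $ 1)) \<partial>M)"
    proof (rule Bochner_Integration.integral_cong[OF refl])
      fix s
      assume "s \<in> space M"
      then have "?f s * (of_real (C k s) * \<psi> s $ 1)
          = of_real \<alpha> * of_real (cos (\<theta> s)) * (of_real (sin (\<theta> s)) * of_real (D k s) * \<psi> s $ 1)"
        using f[of s "- of_real (sin (\<theta> s)) * of_real (D k s) * \<psi> s $ 1"]
        by (simp add: C_def power2_eq_square mult.assoc)
      then show "of_real (C k s) * T0_fun \<epsilon> \<psi> s $ 2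
          = \<i> * (?g' s + of_real (\<alpha> * \<mu> k) * (of_real (A k s) * \<psi> s $ 1))"
        unfolding T0_fun_eq[OF d] vec2_nth by (simp add: algebra_simps)
    qed
    also have "\<dots> = \<i> * ((\<integral>s. ?g' s \<partial>M) + of_real (\<alpha> * \<mu> k) * (\<integral>s. of_real (A k s) * \<psi> s $ 1 \<partial>M))"
      using continuous_integrable[OF cg] int(2)[of k 1]
      by (simp only: integral_mult_right_zero Bochner_Integration.integral_add
          integrable_mult_right)
    finally show ?thesis
      unfolding 0 by simp
  qed
  define k where "k = (n + 1) div 2"
  have kk: "(pair_swap n + 1) div 2 = k"
    unfolding k_def by (rule pair_swap_index)
  have lk: "lam n = \<alpha> * sqrt (\<mu> k)"
    by (simp only: lam_def k_def)
  have mu: "sqrt (\<mu> k) * sqrt (\<mu> k) = \<mu> k"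
    using mu_nonneg by simp
  show ?thesis
  proof (cases "even n")
    case True
    have lhs: "onb.coef (cl (T0_fun \<epsilon> \<psi>)) n
        = of_real (1 / sqrt \<epsilon>) * (- \<i> * of_real \<alpha> * (\<integral>s. of_real (C k s) * \<psi> s $ 2 \<partial>M))"
      unfolding onb.coef_def hip_basis_fun_even[OF S(2) True] part1 k_def ..
    show ?thesis
    \<comment> \<open>At n = 0 the partner index is 0 and not odd, so the formula for odd indices
      does not apply; both sides vanish because \<open>C 0\<close> and \<open>lam 0\<close>
      do.\<close>
    proof (cases "n = 0")
      case True
      then show ?thesis
        unfolding lhs by (simp add: k_def lam_def \<mu>_def C_def D_def)
    next
      case False
      then have odd: "odd (pair_swap n)"
        using True pair_swap_parity by simp
      have "k \<ge> 1"
        using False True by (auto simp: k_def elim!: evenE)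
      then have "sqrt (\<mu> k) > 0"
        using mu_pos by simp
      then have "lam n * (1 / sqrt (\<epsilon> * \<mu> k)) = \<alpha> * (1 / sqrt \<epsilon>)"
        by (simp add: lk real_sqrt_mult)
      then have e: "complex_of_real (lam n) * of_real (1 / sqrt (\<epsilon> * \<mu> k))
          = of_real \<alpha> * of_real (1 / sqrt \<epsilon>)"
        by (metis of_real_mult)
      have "of_real (lam n) * onb.coef (cl \<psi>) (pair_swap n)
          = - \<i> * (of_real (lam n) * of_real (1 / sqrt (\<epsilon> * \<mu> k))) *
              (\<integral>s. of_real (C k s) * \<psi> s $ 2 \<partial>M)"
        unfolding onb.coef_def hip_basis_fun_odd[OF S(1) odd] kk
        by (simp only: mult_ac mult_minus_left mult_minus_right)
      then show ?thesis
        unfolding lhs e by (simp only: mult_ac mult_minus_left mult_minus_right)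
    qed
  next
    case False
    then have ev: "even (pair_swap n)"
      using pair_swap_parity[of n] by (cases "n = 0") auto
    have "k \<ge> 1"
      using False by (auto simp: k_def elim!: oddE)
    then have "sqrt (\<mu> k) > 0"
      using mu_pos by simp
    then have "1 / sqrt (\<epsilon> * \<mu> k) * (\<alpha> * \<mu> k) = lam n * (1 / sqrt \<epsilon>)"
      using mu eps_pos by (simp add: lk real_sqrt_mult field_simps)
    then have e: "complex_of_real (1 / sqrt (\<epsilon> * \<mu> k)) * of_real (\<alpha> * \<mu> k)
        = of_real (lam n) * of_real (1 / sqrt \<epsilon>)"
      by (metis of_real_mult)
    have "onb.coef (cl (T0_fun \<epsilon> \<psi>)) n
        = - \<i> * of_real (1 / sqrt (\<epsilon> * \<mu> k)) *
            (\<i> * of_real (\<alpha> * \<mu> k) * (\<integral>s. of_real (A k s) * \<psi> s $ 1 \<partial>M))"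
      unfolding onb.coef_def hip_basis_fun_odd[OF S(2) False] k_def[symmetric] part2 ..
    also have "\<dots> = - (\<i> * \<i>) * (complex_of_real (1 / sqrt (\<epsilon> * \<mu> k)) * of_real (\<alpha> * \<mu> k)) * (\<integral>s.
        of_real (A k s) * \<psi> s $ 1 \<partial>M)"
      by (simp only: mult_ac mult_minus_left mult_minus_right)
    finally show ?thesis
      unfolding e onb.coef_def hip_basis_fun_even[OF S(1) ev] kk by (simp add: mult.assoc)
  qed
qed

section \<open>Identification of the closure\<close>

lemma coef_le_norm: "X \<in> hcarrier L2 \<Longrightarrow> cmod (onb.coef X n) \<le> hnorm L2 X"
  using onb.cauchy_schwarz[OF onb.b_closed[of n], of X] onb.b_orthonormal[of n n]
  by (simp add: onb.coef_def hnorm_def)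

text \<open>The relation holds for test functions and each coefficient is continuous, hence it
  persists in the closure; \<open>1 + lam n\<close> is the Lipschitz constant of the defect.\<close>

lemma T_graph_coef:
  assumes xy: "(x, y) \<in> T_graph \<epsilon>"
  shows "x \<in> hcarrier L2" "y \<in> hcarrier L2" "onb.coef y n
      = of_real (lam n) * onb.coef x (pair_swap n)"
proof -
  show c: "x \<in> hcarrier L2" "y \<in> hcarrier L2"
    using xy by (auto simp: T_graph_def graph_closure_def)
  let ?d = "cmod (onb.coef y n - of_real (lam n) * onb.coef x (pair_swap n))"
  have lam: "lam n \<ge> 0"
    using alpha_pos mu_nonneg by (simp add: lam_def)
  have le: "?d \<le> e + lam n * e" if e: "e > 0" for e
  proof -
    obtain \<psi> where \<psi>: "\<psi> \<in> test_functions \<epsilon>" "hnorm L2 (hsub L2 x (cl \<psi>)) < e"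
      "hnorm L2 (hsub L2 y (cl (T0_fun \<epsilon> \<psi>))) < e"
      using xy e unfolding T_graph_def graph_closure_def T0_graph_def by blast
    note S = test_function_S[OF \<psi>(1), THEN cl_in]
    have eq: "onb.coef y n - of_real (lam n) * onb.coef x (pair_swap n)
        = onb.coef (hsub L2 y (cl (T0_fun \<epsilon> \<psi>))) n - of_real (lam n) * onb.coef (hsub L2 x (cl \<psi>))
            (pair_swap n)"
      using c S by (simp add: onb.coef_sub T0_coef[OF \<psi>(1)] algebra_simps)
    have "?d \<le> cmod (onb.coef (hsub L2 y (cl (T0_fun \<epsilon> \<psi>))) n)
        + lam n * cmod (onb.coef (hsub L2 x (cl \<psi>)) (pair_swap n))"
      unfolding eq by (rule order_trans[OF norm_triangle_ineq4])
        (simp only: norm_mult norm_of_real abs_of_nonneg[OF lam] order_refl)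
    also have "\<dots> \<le> e + lam n * e"
      by (intro add_mono mult_left_mono lam
          order_trans[OF coef_le_norm[OF onb.sub_closed[OF c(2) S(2)]] less_imp_le[OF \<psi>(3)]]
          order_trans[OF coef_le_norm[OF onb.sub_closed[OF c(1) S(1)]] less_imp_le[OF \<psi>(2)]])
    finally show ?thesis .
  qed
  have "?d \<le> 0 + e" if "e > 0" for e
  proof -
    have l: "1 + lam n > 0"
      using lam by linarith
    have "?d \<le> e / (1 + lam n) + lam n * (e / (1 + lam n))"
      by (rule le[OF divide_pos_pos[OF that l]])
    also have "\<dots> = (1 + lam n) * (e / (1 + lam n))"
      by (simp only: distrib_right mult_1_left)
    also have "\<dots> = e"
      using l by simp
    finally show ?thesis
      by simp
  qed
  then have "?d \<le> 0"
    by (rule field_le_epsilon)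
  then show "onb.coef y n = of_real (lam n) * onb.coef x (pair_swap n)"
    by simp
qed

lemma psum_alg:
  "\<exists>p\<in>alg. \<exists>q\<in>alg. onb.psum a N
      = cl (\<lambda>s. vec2 (of_real (sin (\<theta> s)) * p s) (of_real (sin (\<theta> s)) * q s))"
proof (induction N)
  case 0
  have "(\<lambda>_. 0) = (\<lambda>s. vec2 (of_real (sin (\<theta> s)) * 0) (of_real (sin (\<theta> s)) * 0))"
    by (auto intro!: vec2_eqI)
  then show ?case
    using alg_const[of 0] by (auto simp: hzero_cl intro!: bexI[of _ "\<lambda>_. 0"])
next
  case (Suc N)
  obtain p q where pq: "p \<in> alg" "q \<in> alg"
    "onb.psum a N = cl (\<lambda>s. vec2 (of_real (sin (\<theta> s)) * p s) (of_real (sin (\<theta> s)) * q s))"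
    using Suc by blast
  obtain p' q' where pq': "p' \<in> alg" "q' \<in> alg"
    "basis_fun N = (\<lambda>s. vec2 (of_real (sin (\<theta> s)) * p' s) (of_real (sin (\<theta> s)) * q' s))"
    using basis_fun_alg by blast
  have S: "(\<lambda>s. vec2 (of_real (sin (\<theta> s)) * p s) (of_real (sin (\<theta> s)) * q s)) \<in> S"
    by (intro alg_in_S alg.intros pq)
  have "onb.psum a (Suc N) = cl (\<lambda>s. vec2 (of_real (sin (\<theta> s)) * p s) (of_real (sin (\<theta> s)) * q s)
      + a N *s basis_fun N s)"
    by (simp add: pq(3) hact_cl[OF basis_fun_S] hadd_cl[OF S S_smult[OF basis_fun_S]])
  also have "(\<lambda>s. vec2 (of_real (sin (\<theta> s)) * p s) (of_real (sin (\<theta> s)) * q s)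
      + a N *s basis_fun N s)
      = (\<lambda>s. vec2 (of_real (sin (\<theta> s)) * (p s + a N * p' s))
          (of_real (sin (\<theta> s)) * (q s + a N * q' s)))"
    unfolding pq'(3) vec2_smult vec2_add by (simp add: algebra_simps)
  finally show ?case
    by (intro bexI[of _ "\<lambda>s. p s + a N * p' s"] bexI[of _ "\<lambda>s. q s + a N * q' s"] alg.intros pq pq')
qed

text \<open>Only odd \<open>N\<close>, since then \<open>{..<N}\<close> is invariant under the pairing.\<close>

lemma psum_in_T_graph:
  assumes "odd N" and y: "\<And>n. y n = of_real (lam n) * x (pair_swap n)"
  shows "(onb.psum x N, onb.psum y N) \<in> T_graph \<epsilon>"
proof -
  obtain p q where pq: "p \<in> alg" "q \<in> alg"
    "onb.psum x N = cl (\<lambda>s. vec2 (of_real (sin (\<theta> s)) * p s) (of_real (sin (\<theta> s)) * q s))"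
    using psum_alg[of x N] by blast
  obtain z where z: "(onb.psum x N, z) \<in> T_graph \<epsilon>"
    using sin_alg_in_T[OF pq(1,2)] unfolding pq(3) by blast
  have "z = onb.psum y N"
  proof (rule onb.coef_eqI[OF T_graph_coef(2)[OF z] onb.psum_closed])
    fix n
    show "onb.coef z n = onb.coef (onb.psum y N) n"
      unfolding T_graph_coef(3)[OF z] onb.coef_psum y using pair_swap_le[OF assms(1), of n] by simp
  qed
  then show ?thesis
    using z by simp
qed

text \<open>The substantial inclusion is that the closure is as large as the maximal diagonal
  operator: truncated expansions lie in the closed graph and converge there, and approximating them
  in turn by test functions costs another e / 2.\<close>

lemma T_graph_eq:
  "T_graph \<epsilon> = {(x, y) \<in> hcarrier L2 \<times> hcarrier L2. \<forall>n. onb.coef y n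
      = of_real (lam n) * onb.coef x (pair_swap n)}"
proof (intro subset_antisym subrelI)
  fix x y
  assume "(x, y) \<in> T_graph \<epsilon>"
  then show "(x, y) \<in> {(x, y) \<in> hcarrier L2 \<times> hcarrier L2. \<forall>n. onb.coef y n
      = of_real (lam n) * onb.coef x (pair_swap n)}"
    using T_graph_coef[of x y] by blast
next
  fix x y
  assume "(x, y) \<in> {(x, y) \<in> hcarrier L2 \<times> hcarrier L2. \<forall>n. onb.coef y n
      = of_real (lam n) * onb.coef x (pair_swap n)}"
  then have c: "x \<in> hcarrier L2" "y \<in> hcarrier L2"
    and eq: "\<And>n. onb.coef y n = of_real (lam n) * onb.coef x (pair_swap n)"
    by auto
  have "\<exists>(x', y')\<in>T0_graph \<epsilon>. hnorm L2 (hsub L2 x x') < e \<and> hnorm L2 (hsub L2 y y') < e"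
      if e: "e > 0" for e
  proof -
    have e2: "e / 2 > 0"
      using e by simp
    obtain N1 where N1: "\<And>N. N \<ge> N1 \<Longrightarrow> hnorm L2 (hsub L2 (onb.psum (onb.coef x) N) x) < e / 2"
      using LIMSEQ_D[OF onb.psum_tendsto[OF c(1)] e2] by auto
    obtain N2 where N2: "\<And>N. N \<ge> N2 \<Longrightarrow> hnorm L2 (hsub L2 (onb.psum (onb.coef y) N) y) < e / 2"
      using LIMSEQ_D[OF onb.psum_tendsto[OF c(2)] e2] by auto
    \<comment> \<open>Odd, as \<open>psum_in_T_graph\<close> demands, and beyond both
      thresholds.\<close>
    define N where "N = 2 * (N1 + N2) + 1"
    let ?x = "onb.psum (onb.coef x) N" and ?y = "onb.psum (onb.coef y) N"
    have "(?x, ?y) \<in> T_graph \<epsilon>"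
      by (rule psum_in_T_graph[OF _ eq]) (simp add: N_def)
    then obtain \<psi> where \<psi>: "\<psi> \<in> test_functions \<epsilon>" "hnorm L2 (hsub L2 ?x (cl \<psi>)) < e / 2"
      "hnorm L2 (hsub L2 ?y (cl (T0_fun \<epsilon> \<psi>))) < e / 2"
      using e2 unfolding T_graph_def graph_closure_def T0_graph_def by blast
    note S = test_function_S[OF \<psi>(1), THEN cl_in]
    have "hnorm L2 (hsub L2 x (cl \<psi>)) < e"
      using onb.norm_sub_triangle[OF c(1) onb.psum_closed S(1), of "onb.coef x" N] N1[of N] \<psi>(2)
        onb.norm_sub_commute[OF c(1) onb.psum_closed, of "onb.coef x" N] by (simp add: N_def)
    moreover have "hnorm L2 (hsub L2 y (cl (T0_fun \<epsilon> \<psi>))) < e"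
      using onb.norm_sub_triangle[OF c(2) onb.psum_closed S(2), of "onb.coef y" N] N2[of N] \<psi>(3)
        onb.norm_sub_commute[OF c(2) onb.psum_closed, of "onb.coef y" N] by (simp add: N_def)
    moreover have "(cl \<psi>, cl (T0_fun \<epsilon> \<psi>)) \<in> T0_graph \<epsilon>"
      using \<psi>(1) by (auto simp: T0_graph_def)
    ultimately show ?thesis
      by blast
  qed
  then show "(x, y) \<in> T_graph \<epsilon>"
    unfolding T_graph_def graph_closure_def using c by blast
qed

lemma lam_at_top: "filterlim lam at_top sequentially"
proof (rule filterlim_at_top_mono)
  show "filterlim (\<lambda>n. \<alpha> / 2 * real n) at_top sequentially"
    using alpha_pos by (intro filterlim_tendsto_pos_mult_at_top[OF tendsto_const]
        filterlim_real_sequentially) simp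
  have "\<alpha> / 2 * real n \<le> lam n" for n
  proof -
    \<comment> \<open>With k for the index, (k + 1)^2 - 1 = k^2 + 2 k, so the root is at least
      k.\<close>
    have "real ((n + 1) div 2) \<le> sqrt (\<mu> ((n + 1) div 2))"
      by (rule real_le_rsqrt) (simp add: \<mu>_def power2_sum)
    moreover have "real n / 2 \<le> real ((n + 1) div 2)"
      by linarith
    ultimately have "real n / 2 \<le> sqrt (\<mu> ((n + 1) div 2))"
      by linarith
    then show ?thesis
      using mult_left_mono[of "real n / 2" "sqrt (\<mu> ((n + 1) div 2))" \<alpha>] alpha_pos by
          (simp add: lam_def)
  qed
  then show "\<forall>\<^sub>F n in sequentially. \<alpha> / 2 * real n \<le> lam n"
    by simp
qed

sublocale diag: diagonal_operator L2 "\<lambda>n. cl (basis_fun n)" pair_swap lam "\<lambda>n. (- 1) ^ n"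
    "gamma3_operator \<epsilon>" "T_graph \<epsilon>"
proof
  show "adjacent_involution pair_swap"
    by (rule adjacent_involution_pair_swap)
  show "lam n \<ge> 0" for n
    using alpha_pos mu_nonneg by (simp add: lam_def)
  show "lam 0 = 0"
    by (simp add: lam_def \<mu>_def)
  show "lam (pair_swap n) = lam n" for n
    unfolding lam_def pair_swap_index ..
  show "filterlim lam at_top sequentially"
    by (rule lam_at_top)
  show "(- 1 :: real) ^ n = 1 \<or> (- 1 :: real) ^ n = - 1" for n
    by (cases "even n") auto
  show "(- 1 :: real) ^ pair_swap n = - ((- 1) ^ n)" if "n > 0" for n
    using pair_swap_parity[OF that] by (cases "even n") auto
  show "gamma3_operator \<epsilon> x \<in> hcarrier L2" if x: "x \<in> hcarrier L2" for x
  proof -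
    obtain \<psi> where \<psi>: "\<psi> \<in> S" "x = cl \<psi>"
      using cl_cases[OF x] .
    show ?thesis
      unfolding \<psi>(2) gamma3_cl[OF \<psi>(1)] by (rule cl_in[OF S_gamma3[OF \<psi>(1)]])
  qed
  show "onb.coef (gamma3_operator \<epsilon> x) n = of_real ((- 1) ^ n) * onb.coef x n"
      if x: "x \<in> hcarrier L2" for x n
  proof -
    obtain \<psi> where \<psi>: "\<psi> \<in> S" "x = cl \<psi>"
      using cl_cases[OF x] .
    show ?thesis
      unfolding \<psi>(2) gamma3_cl[OF \<psi>(1)] onb.coef_def
      by (cases "even n") (simp_all add: hip_basis_fun_even hip_basis_fun_odd S_gamma3 \<psi>(1))
  qed
  show "T_graph \<epsilon> = {(x, y) \<in> hcarrier L2 \<times> hcarrier L2. \<forall>n. onb.coef y n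
      = of_real (lam n) * onb.coef x (pair_swap n)}"
    by (rule T_graph_eq)
qed simp_all

end

theorem proposition2p15:
  fixes \<epsilon> :: real
  assumes "0 < \<epsilon>" and "\<epsilon> < 1"
  shows "even_spectral_triple (L2_space \<epsilon>) (hscale (L2_space \<epsilon>)) (T_graph \<epsilon>) (gamma3_operator \<epsilon>) \<and>
    represents_kk_unit (L2_space \<epsilon>) (hscale (L2_space \<epsilon>)) (T_graph \<epsilon>) (gamma3_operator \<epsilon>)"
proof -
  interpret interval \<epsilon>
    by standard (fact assms(1))
  show ?thesis
    using diag.even_spectral_triple diag.represents_kk_unit ..
qed

end
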